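(* The Banach space $B_\infty$ (the natural predual of the space $JT_\infty$) fails the point of continuity property, does not contain any subspace isomorphic to $\ell_1$, and every semi-normalized basic sequence in $B_\infty$ has a boundedly complete subsequence whose closed linear span is a reflexive or an order one quasireflexive subspace of $B_\infty$.
   Context: Definition of $B_\infty$. Let $T_\infty=\bigcup_{n\ge 0}\mathbb{N}^n$ be the tree of all finite sequences of natural numbers (including the empty sequence), partially ordered by extension: $s\le t$ if $s$ is an initial part of $t$. A segment is a set of the form $\{t\in T_\infty: s\le t\le u\}$ with $s\le u$ in $T_\infty$. The space $JT_\infty$ is the completion of the space of finitely supported scalar functions $x=(x_t)_{t\in T_\infty}$ under the norm $$\|x\|=\sup\Big(\sum_{j=1}^{k}\Big|\sum_{t\in S_j}x_t\Big|^2\Big)^{1/2},$$ where the supremum is over all finite families $S_1,\dots,S_k$ of pairwise disjoint segments. For $t\in T_\infty$ let $e_t^*\in JT_\infty^*$ be the coordinate functional, i.e. the continuous extension of $x\mapsto x_t$. Then $B_\infty$ is the norm-closed linear span of $\{e_t^*:t\in T_\infty\}$ in $JT_\infty^*$. Point of continuity property (PCP): a Banach space has PCP if every non-empty closed and bounded subset $C$ admits a point at which the identity map from $C$ with the weak topology to $C$ with the norm topology is continuous. A basic sequence $\{e_n\}$ is semi-normalized if $0<\inf_n\|e_n\|\le\sup_n\|e_n\|<+\infty$. It is boundedly complete if, whenever scalars $\{\lambda_i\}$ satisfy $\sup_n\|\sum_{i=1}^n\lambda_ie_i\|<+\infty$, the series $\sum_n\lambda_ne_n$ converges in norm. A Banach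 space $Y$ is order one quasireflexive if (the canonical image of) $Y$ has codimension $1$ in $Y^{**}$. *)

theory Defs
  imports "HOL-Analysis.Analysis" "HOL-Library.Sublist"
begin

section \<open>The tree of finite sequences and the James tree norm\<close>

text \<open>The tree \<open>T\<close> of all finite sequences of natural numbers is the type \<^typ>\<open>nat list\<close>, ordered
  by \<^const>\<open>prefix\<close>. Scalars are real throughout.\<close>

definition segments :: "nat list set set" where
  "segments = {{t. prefix s t \<and> prefix t u} |s u. prefix s u}"

text \<open>Segments are non-empty, so a finite family of pairwise disjoint segments is the same as a
  finite set of them.\<close>

definition segment_families :: "nat list set set set" where
  "segment_families = {F. finite F \<and> F \<subseteq> segments \<and> pairwise disjnt F}"

definition jt_norm :: "(nat list \<Rightarrow> real) \<Rightarrow> real" where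
  "jt_norm x = (SUP F\<in>segment_families. sqrt (\<Sum>S\<in>F. \<bar>\<Sum>t\<in>S. x t\<bar>\<^sup>2))"

definition finitely_supported :: "(nat list \<Rightarrow> real) \<Rightarrow> bool" where
  "finitely_supported x \<longleftrightarrow> finite {t. x t \<noteq> 0}"

text \<open>As a supremum in \<^typ>\<open>real\<close>, \<^const>\<open>jt_norm\<close> is only meaningful for functions \<open>x\<close>
  satisfying \<open>jt_bounded x c\<close> for some \<open>c\<close>.\<close>

definition jt_bounded :: "(nat list \<Rightarrow> real) \<Rightarrow> real \<Rightarrow> bool" where
  "jt_bounded x c \<longleftrightarrow> (\<forall>F\<in>segment_families. sqrt (\<Sum>S\<in>F. \<bar>\<Sum>t\<in>S. x t\<bar>\<^sup>2) \<le> c)"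

lemma segments_finite: "S \<in> segments \<Longrightarrow> finite S"
proof -
  assume "S \<in> segments"
  then obtain s u where S: "S = {t. prefix s t \<and> prefix t u}"
    by (auto simp: segments_def)
  have "S \<subseteq> set (prefixes u)"
    using S by auto
  then show ?thesis
    using finite_subset by blast
qed

lemma singleton_segment: "{t} \<in> segments"
  unfolding segments_def by (auto intro!: exI[of _ t] simp: prefix_order.antisym)

lemma singleton_family: "{{t}} \<in> segment_families"
  by (simp add: segment_families_def singleton_segment)

lemma empty_family: "{} \<in> segment_families"
  by (simp add: segment_families_def)

lemma jt_bounded_L2_set:
  "jt_bounded x c \<longleftrightarrow> (\<forall>F\<in>segment_families. L2_set (sum x) F \<le> c)"
  by (simp add: jt_bounded_def L2_set_def)

lemma jt_norm_L2_set: "jt_norm x = (SUP F\<in>segment_families. L2_set (sum x) F)"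
  by (simp add: jt_norm_def L2_set_def)

lemma jt_norm_le: "jt_bounded x c \<Longrightarrow> jt_norm x \<le> c"
  unfolding jt_bounded_L2_set jt_norm_L2_set
  using empty_family by (intro cSUP_least) auto

lemma jt_bounded_norm: "jt_bounded x c \<Longrightarrow> jt_bounded x (jt_norm x)"
  unfolding jt_bounded_L2_set jt_norm_L2_set
  by (intro ballI cSUP_upper) (auto simp: bdd_above_def)

lemma jt_bounded_nonneg: "jt_bounded x c \<Longrightarrow> 0 \<le> c"
  using empty_family by (force simp: jt_bounded_L2_set)

lemma jt_bounded_mono: "jt_bounded x c \<Longrightarrow> c \<le> d \<Longrightarrow> jt_bounded x d"
  by (force simp: jt_bounded_L2_set)

lemma jt_bounded_coord: "jt_bounded x c \<Longrightarrow> \<bar>x t\<bar> \<le> c"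
  using singleton_family[of t] by (force simp: jt_bounded_L2_set)

lemma jt_bounded_add:
  assumes "jt_bounded x c" "jt_bounded y d"
  shows "jt_bounded (\<lambda>t. x t + y t) (c + d)"
  unfolding jt_bounded_L2_set
proof
  fix F assume F: "F \<in> segment_families"
  have "L2_set (sum (\<lambda>t. x t + y t)) F = L2_set (\<lambda>S. sum x S + sum y S) F"
    by (simp add: L2_set_def sum.distrib)
  also have "\<dots> \<le> L2_set (sum x) F + L2_set (sum y) F"
    by (rule L2_set_triangle_ineq)
  also have "\<dots> \<le> c + d"
    using assms F by (force simp: jt_bounded_L2_set intro: add_mono)
  finally show "L2_set (sum (\<lambda>t. x t + y t)) F \<le> c + d" .
qed

lemma jt_bounded_scale:
  assumes "jt_bounded x c"
  shows "jt_bounded (\<lambda>t. a * x t) (\<bar>a\<bar> * c)"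
  unfolding jt_bounded_def
proof
  fix F assume F: "F \<in> segment_families"
  have "sqrt (\<Sum>S\<in>F. \<bar>\<Sum>t\<in>S. a * x t\<bar>\<^sup>2) = \<bar>a\<bar> * sqrt (\<Sum>S\<in>F. \<bar>\<Sum>t\<in>S. x t\<bar>\<^sup>2)"
    by (simp add: sum_distrib_left[symmetric] power_mult_distrib real_sqrt_mult)
  also have "\<dots> \<le> \<bar>a\<bar> * c"
    using assms F by (intro mult_left_mono) (auto simp: jt_bounded_def)
  finally show "sqrt (\<Sum>S\<in>F. \<bar>\<Sum>t\<in>S. a * x t\<bar>\<^sup>2) \<le> \<bar>a\<bar> * c" .
qed

lemma finitely_supported_bounded:
  assumes "finitely_supported x"
  shows "jt_bounded x (\<Sum>t | x t \<noteq> 0. \<bar>x t\<bar>)"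
  unfolding jt_bounded_L2_set
proof
  fix F assume F: "F \<in> segment_families"
  then have fin: "finite F" "\<forall>S\<in>F. finite S" and dis: "pairwise disjnt F"
    using segments_finite by (auto simp: segment_families_def)
  have "L2_set (sum x) F \<le> (\<Sum>S\<in>F. \<bar>sum x S\<bar>)"
    by (rule L2_set_le_sum_abs)
  also have "\<dots> \<le> (\<Sum>S\<in>F. \<Sum>t\<in>S. \<bar>x t\<bar>)"
    by (intro sum_mono sum_abs)
  also have "\<dots> = (\<Sum>t\<in>\<Union>F. \<bar>x t\<bar>)"
    using fin dis
    by (subst sum.Union_disjoint) (auto simp: pairwise_def disjnt_def)
  also have "\<dots> = (\<Sum>t\<in>\<Union>F \<inter> {t. x t \<noteq> 0}. \<bar>x t\<bar>)"
    using fin by (intro sum.mono_neutral_right) auto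
  also have "\<dots> \<le> (\<Sum>t | x t \<noteq> 0. \<bar>x t\<bar>)"
    using assms by (intro sum_mono2) (auto simp: finitely_supported_def)
  finally show "L2_set (sum x) F \<le> (\<Sum>t | x t \<noteq> 0. \<bar>x t\<bar>)" .
qed

section \<open>The space JT\<close>

text \<open>The completion of the finitely supported functions is realised concretely, as the space of all
  functions that can be approximated by finitely supported ones in the James tree norm. That this is
  indeed a completion is the content of the \<open>banach\<close> instance and of \<open>jt_inf_dense\<close> below.\<close>

typedef jt_inf = "{x :: nat list \<Rightarrow> real.
    \<forall>\<epsilon>>0. \<exists>y. finitely_supported y \<and> jt_bounded (\<lambda>t. x t - y t) \<epsilon>}"
  morphisms jt_fun Abs_jt_inf
proof -
  have "finitely_supported (\<lambda>_. 0)" "\<And>\<epsilon>::real. \<epsilon> > 0 \<Longrightarrow> jt_bounded (\<lambda>t. 0 - 0) \<epsilon>"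
    by (auto simp: finitely_supported_def jt_bounded_def)
  then show ?thesis
    by (intro exI[of _ "\<lambda>_. 0"]) blast
qed

lemma jt_fun_approx:
  "\<epsilon> > 0 \<Longrightarrow> \<exists>y. finitely_supported y \<and> jt_bounded (\<lambda>t. jt_fun x t - y t) \<epsilon>"
  using jt_fun[of x] by simp

lemma jt_fun_bounded: "jt_bounded (jt_fun x) (jt_norm (jt_fun x))"
proof -
  obtain y where y: "finitely_supported y" "jt_bounded (\<lambda>t. jt_fun x t - y t) 1"
    using jt_fun_approx[of 1 x] by auto
  show ?thesis
    using jt_bounded_norm[OF jt_bounded_add[OF y(2) finitely_supported_bounded[OF y(1)]]]
    by simp
qed

lemma fin_supp_add:
  assumes "finitely_supported x" "finitely_supported y"
  shows "finitely_supported (\<lambda>t. x t + y t)"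
  using assms unfolding finitely_supported_def
  by (rule finite_subset[OF _ finite_UnI, rotated]) auto

lemma fin_supp_scale: "finitely_supported x \<Longrightarrow> finitely_supported (\<lambda>t. a * x t)"
  unfolding finitely_supported_def by (erule rev_finite_subset) auto

instantiation jt_inf :: real_normed_vector
begin

definition "0 = Abs_jt_inf (\<lambda>_. 0)"
definition "x + y = Abs_jt_inf (\<lambda>t. jt_fun x t + jt_fun y t)"
definition "- x = Abs_jt_inf (\<lambda>t. - jt_fun x t)"
definition "x - y = Abs_jt_inf (\<lambda>t. jt_fun x t - jt_fun y t)"
definition "a *\<^sub>R x = Abs_jt_inf (\<lambda>t. a * jt_fun x t)"
definition "norm x = jt_norm (jt_fun x)"
definition "sgn (x :: jt_inf) = inverse (norm x) *\<^sub>R x"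
definition "dist (x :: jt_inf) y = norm (x - y)"
definition "(uniformity :: (jt_inf \<times> jt_inf) filter) =
  (INF e\<in>{0<..}. principal {(x, y). dist x y < e})"
definition "open (U :: jt_inf set) \<longleftrightarrow> (\<forall>x\<in>U. \<forall>\<^sub>F (x', y) in uniformity. x' = x \<longrightarrow> y \<in> U)"

lemma jt_fun_zero: "jt_fun 0 = (\<lambda>_. 0)"
  unfolding zero_jt_inf_def
  by (rule Abs_jt_inf_inverse)
     (auto simp: finitely_supported_def jt_bounded_def intro!: exI[of _ "\<lambda>_. 0"])

lemma jt_fun_add: "jt_fun (x + y) = (\<lambda>t. jt_fun x t + jt_fun y t)"
  unfolding plus_jt_inf_def
proof (rule Abs_jt_inf_inverse, safe)
  fix \<epsilon> :: real assume "\<epsilon> > 0"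
  then obtain u v where u: "finitely_supported u" "jt_bounded (\<lambda>t. jt_fun x t - u t) (\<epsilon>/2)"
    and v: "finitely_supported v" "jt_bounded (\<lambda>t. jt_fun y t - v t) (\<epsilon>/2)"
    using jt_fun_approx[of "\<epsilon>/2"] by (meson half_gt_zero)
  show "\<exists>w. finitely_supported w \<and> jt_bounded (\<lambda>t. jt_fun x t + jt_fun y t - w t) \<epsilon>"
    using jt_bounded_add[OF u(2) v(2)] fin_supp_add[OF u(1) v(1)]
    by (intro exI[of _ "\<lambda>t. u t + v t"]) (simp add: algebra_simps)
qed

lemma jt_fun_scaleR: "jt_fun (a *\<^sub>R x) = (\<lambda>t. a * jt_fun x t)"
  unfolding scaleR_jt_inf_def
proof (rule Abs_jt_inf_inverse, safe)
  fix \<epsilon> :: real assume "\<epsilon> > 0"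
  then have "\<epsilon> / (\<bar>a\<bar> + 1) > 0"
    by simp
  then obtain u where u: "finitely_supported u" "jt_bounded (\<lambda>t. jt_fun x t - u t) (\<epsilon> / (\<bar>a\<bar> + 1))"
    using jt_fun_approx by blast
  have "\<bar>a\<bar> * (\<epsilon> / (\<bar>a\<bar> + 1)) \<le> \<epsilon>"
    using \<open>\<epsilon> > 0\<close> by (simp add: field_simps)
  then have "jt_bounded (\<lambda>t. a * jt_fun x t - a * u t) \<epsilon>"
    using jt_bounded_mono[OF jt_bounded_scale[OF u(2), of a]] by (simp add: algebra_simps)
  then show "\<exists>w. finitely_supported w \<and> jt_bounded (\<lambda>t. a * jt_fun x t - w t) \<epsilon>"
    using fin_supp_scale[OF u(1)] by blast
qed

lemma jt_fun_uminus: "jt_fun (- x) = (\<lambda>t. - jt_fun x t)"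
  using jt_fun_scaleR[of "-1" x] by (simp add: uminus_jt_inf_def scaleR_jt_inf_def)

lemma jt_fun_minus: "jt_fun (x - y) = (\<lambda>t. jt_fun x t - jt_fun y t)"
  using jt_fun_add[of x "- y"] by (simp add: minus_jt_inf_def plus_jt_inf_def jt_fun_uminus)

lemmas jt_fun_simps = jt_fun_zero jt_fun_add jt_fun_scaleR jt_fun_uminus jt_fun_minus

lemma norm_jt_le_iff: "norm (x :: jt_inf) \<le> c \<longleftrightarrow> jt_bounded (jt_fun x) c"
  unfolding norm_jt_inf_def using jt_norm_le jt_bounded_mono jt_fun_bounded by blast

instance
proof
  fix x y z :: jt_inf and a b :: real
  show "x + y + z = x + (y + z)" "x + y = y + x" "0 + x = x" "- x + x = 0" "x - y = x + - y"
    "a *\<^sub>R (x + y) = a *\<^sub>R x + a *\<^sub>R y" "(a + b) *\<^sub>R x = a *\<^sub>R x + b *\<^sub>R x"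
    "a *\<^sub>R b *\<^sub>R x = (a * b) *\<^sub>R x" "1 *\<^sub>R x = x"
    by (simp_all add: jt_fun_inject[symmetric] jt_fun_simps algebra_simps)
  show "sgn x = inverse (norm x) *\<^sub>R x" "dist x y = norm (x - y)"
    by (simp_all add: sgn_jt_inf_def dist_jt_inf_def)
  show "(uniformity :: (jt_inf \<times> jt_inf) filter) =
      (INF e\<in>{0<..}. principal {(x, y). dist x y < e})"
    by (rule uniformity_jt_inf_def)
  show "open U \<longleftrightarrow> (\<forall>x\<in>U. \<forall>\<^sub>F (x', y) in uniformity. x' = x \<longrightarrow> y \<in> U)" for U :: "jt_inf set"
    by (rule open_jt_inf_def)
  have nonneg: "0 \<le> norm x" for x :: jt_inf
    using jt_bounded_nonneg[OF jt_fun_bounded] by (simp add: norm_jt_inf_def)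
  show "norm x = 0 \<longleftrightarrow> x = 0"
  proof
    assume "norm x = 0"
    then have "jt_bounded (jt_fun x) 0"
      using norm_jt_le_iff[of x 0] by simp
    then have "jt_fun x t = 0" for t
      using jt_bounded_coord[of "jt_fun x" 0 t] by simp
    then show "x = 0"
      by (auto simp: jt_fun_inject[symmetric] jt_fun_zero)
  next
    assume "x = 0"
    then have "norm x \<le> 0"
      by (simp add: norm_jt_le_iff jt_fun_zero jt_bounded_def)
    then show "norm x = 0"
      using nonneg[of x] by simp
  qed
  show "norm (x + y) \<le> norm x + norm y"
    unfolding norm_jt_le_iff jt_fun_add
    by (rule jt_bounded_add) (simp_all add: norm_jt_le_iff[symmetric])
  have le: "norm (a *\<^sub>R x) \<le> \<bar>a\<bar> * norm x" for a and x :: jt_inf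
    unfolding norm_jt_le_iff jt_fun_scaleR
    by (rule jt_bounded_scale) (simp add: norm_jt_le_iff[symmetric])
  show "norm (a *\<^sub>R x) = \<bar>a\<bar> * norm x"
  proof (cases "a = 0")
    case True
    then show ?thesis
      using le[of a x] nonneg[of "a *\<^sub>R x"] by simp
  next
    case False
    then have "inverse a *\<^sub>R (a *\<^sub>R x) = x"
      by (auto simp: jt_fun_inject[symmetric] jt_fun_simps fun_eq_iff)
    then have "norm x \<le> \<bar>inverse a\<bar> * norm (a *\<^sub>R x)"
      using le[of "inverse a" "a *\<^sub>R x"] by simp
    then have "\<bar>a\<bar> * norm x \<le> norm (a *\<^sub>R x)"
      using False by (simp add: field_simps)
    then show ?thesis
      using le[of a x] by simp
  qed
qed

end

lemma jt_coord_le_norm: "\<bar>jt_fun x t\<bar> \<le> norm x"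
  using jt_bounded_coord norm_jt_le_iff by blast

instance jt_inf :: banach
proof
  fix X :: "nat \<Rightarrow> jt_inf"
  assume C: "Cauchy X"
  have "Cauchy (\<lambda>n. jt_fun (X n) t)" for t
  proof (rule metric_CauchyI)
    fix e :: real assume "e > 0"
    then obtain M where M: "\<forall>m\<ge>M. \<forall>n\<ge>M. norm (X m - X n) < e"
      using C by (auto simp: Cauchy_def dist_norm)
    have "dist (jt_fun (X m) t) (jt_fun (X n) t) < e" if "m \<ge> M" "n \<ge> M" for m n
      using M that jt_coord_le_norm[of "X m - X n" t]
      by (force simp: dist_real_def jt_fun_simps)
    then show "\<exists>M. \<forall>m\<ge>M. \<forall>n\<ge>M. dist (jt_fun (X m) t) (jt_fun (X n) t) < e"
      by blast
  qed
  then have "\<exists>l. (\<lambda>n. jt_fun (X n) t) \<longlonglongrightarrow> l" for t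
    by (simp add: Cauchy_convergent_iff convergent_def)
  then obtain x where x: "\<And>t. (\<lambda>n. jt_fun (X n) t) \<longlonglongrightarrow> x t"
    by metis
  have lim: "\<exists>M. \<forall>m\<ge>M. jt_bounded (\<lambda>t. x t - jt_fun (X m) t) e" if "e > 0" for e
  proof -
    obtain M where M: "\<forall>m\<ge>M. \<forall>n\<ge>M. norm (X m - X n) < e"
      using C \<open>e > 0\<close> by (auto simp: Cauchy_def dist_norm)
    have "jt_bounded (\<lambda>t. x t - jt_fun (X m) t) e" if m: "m \<ge> M" for m
      unfolding jt_bounded_def
    proof
      fix F assume F: "F \<in> segment_families"
      have "(\<lambda>n. sqrt (\<Sum>S\<in>F. \<bar>\<Sum>t\<in>S. jt_fun (X n) t - jt_fun (X m) t\<bar>\<^sup>2))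
          \<longlonglongrightarrow> sqrt (\<Sum>S\<in>F. \<bar>\<Sum>t\<in>S. x t - jt_fun (X m) t\<bar>\<^sup>2)"
        by (intro tendsto_intros x)
      moreover have "sqrt (\<Sum>S\<in>F. \<bar>\<Sum>t\<in>S. jt_fun (X n) t - jt_fun (X m) t\<bar>\<^sup>2) \<le> e"
        if n: "n \<ge> M" for n
      proof -
        have "norm (X n - X m) \<le> e"
          using M m n by (simp add: less_imp_le)
        then show ?thesis
          using F unfolding norm_jt_le_iff jt_bounded_def jt_fun_minus by blast
      qed
      ultimately show "sqrt (\<Sum>S\<in>F. \<bar>\<Sum>t\<in>S. x t - jt_fun (X m) t\<bar>\<^sup>2) \<le> e"
        by (intro LIMSEQ_le_const2) auto
    qed
    then show ?thesis
      by blast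
  qed
  have "\<exists>y. finitely_supported y \<and> jt_bounded (\<lambda>t. x t - y t) e" if "e > 0" for e
  proof -
    obtain m where m: "jt_bounded (\<lambda>t. x t - jt_fun (X m) t) (e/2)"
      using lim[of "e/2"] \<open>e > 0\<close> by auto
    obtain y where y: "finitely_supported y" "jt_bounded (\<lambda>t. jt_fun (X m) t - y t) (e/2)"
      using jt_fun_approx[of "e/2"] \<open>e > 0\<close> by (meson half_gt_zero)
    show ?thesis
      using jt_bounded_add[OF m y(2)] y(1) by auto
  qed
  then have fx: "jt_fun (Abs_jt_inf x) = x"
    by (intro Abs_jt_inf_inverse) blast
  have "X \<longlonglongrightarrow> Abs_jt_inf x"
  proof (rule metric_LIMSEQ_I)
    fix e :: real assume "e > 0"
    then obtain M where "\<forall>m\<ge>M. jt_bounded (\<lambda>t. x t - jt_fun (X m) t) (e/2)"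
      using lim[of "e/2"] by auto
    then have "\<forall>m\<ge>M. norm (Abs_jt_inf x - X m) \<le> e/2"
      unfolding norm_jt_le_iff jt_fun_minus fx .
    then show "\<exists>M. \<forall>m\<ge>M. dist (X m) (Abs_jt_inf x) < e"
      using \<open>e > 0\<close> by (force simp: dist_norm norm_minus_commute)
  qed
  then show "convergent X"
    by (auto simp: convergent_def)
qed

lemma finitely_supported_jt_fun:
  assumes "finitely_supported y"
  shows "jt_fun (Abs_jt_inf y) = y"
proof (rule Abs_jt_inf_inverse, safe)
  fix \<epsilon> :: real assume "\<epsilon> > 0"
  then show "\<exists>z. finitely_supported z \<and> jt_bounded (\<lambda>t. y t - z t) \<epsilon>"
    using assms by (intro exI[of _ y]) (simp add: jt_bounded_def)
qed

lemma jt_inf_dense: "closure {x. finitely_supported (jt_fun x)} = UNIV"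
proof (rule UNIV_eq_I[symmetric])
  fix x
  have "\<exists>y\<in>{x. finitely_supported (jt_fun x)}. dist y x < e" if "e > 0" for e
  proof -
    obtain y where y: "finitely_supported y" "jt_bounded (\<lambda>t. jt_fun x t - y t) (e/2)"
      using jt_fun_approx[of "e/2"] \<open>e > 0\<close> by (meson half_gt_zero)
    have "norm (x - Abs_jt_inf y) \<le> e/2"
      unfolding norm_jt_le_iff jt_fun_minus finitely_supported_jt_fun[OF y(1)] by (rule y(2))
    then show ?thesis
      using y(1) \<open>e > 0\<close>
      by (intro bexI[of _ "Abs_jt_inf y"])
         (auto simp: dist_norm norm_minus_commute finitely_supported_jt_fun)
  qed
  then show "x \<in> closure {x. finitely_supported (jt_fun x)}"
    by (simp add: closure_approachable)
qed

section \<open>The predual B\<close>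

definition jt_coord :: "nat list \<Rightarrow> jt_inf \<Rightarrow>\<^sub>L real" where
  "jt_coord t = Blinfun (\<lambda>x. jt_fun x t)"

lemma jt_coord_apply: "blinfun_apply (jt_coord t) x = jt_fun x t"
proof -
  have "bounded_linear (\<lambda>x. jt_fun x t)"
    by (rule bounded_linear_intro[of _ 1]) (simp_all add: jt_fun_simps jt_coord_le_norm)
  then show ?thesis
    by (simp add: jt_coord_def bounded_linear_Blinfun_apply)
qed

definition B_inf :: "(jt_inf \<Rightarrow>\<^sub>L real) set" where
  "B_inf = closure (span (range jt_coord))"

section \<open>Dual and bidual of a subspace\<close>

text \<open>In this and the following sections \<open>Y\<close> stands for a linear subspace of a normed space. Its
  dual consists of the continuous linear functionals on \<open>Y\<close> itself, extended by \<open>0\<close> off \<open>Y\<close> to make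
  them total functions; likewise for the bidual.\<close>

definition dual_on :: "'a::real_normed_vector set \<Rightarrow> ('a \<Rightarrow> real) set" where
  "dual_on Y = {f.
     (\<forall>x\<in>Y. \<forall>y\<in>Y. f (x + y) = f x + f y) \<and>
     (\<forall>c. \<forall>x\<in>Y. f (c *\<^sub>R x) = c * f x) \<and>
     (\<exists>C. \<forall>x\<in>Y. \<bar>f x\<bar> \<le> C * norm x) \<and>
     (\<forall>x. x \<notin> Y \<longrightarrow> f x = 0)}"

definition dual_norm :: "'a::real_normed_vector set \<Rightarrow> ('a \<Rightarrow> real) \<Rightarrow> real" where
  "dual_norm Y f = (SUP x\<in>{x\<in>Y. norm x \<le> 1}. \<bar>f x\<bar>)"

definition bidual_on :: "'a::real_normed_vector set \<Rightarrow> (('a \<Rightarrow> real) \<Rightarrow> real) set" where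
  "bidual_on Y = {\<phi>.
     (\<forall>f\<in>dual_on Y. \<forall>g\<in>dual_on Y. \<phi> (\<lambda>x. f x + g x) = \<phi> f + \<phi> g) \<and>
     (\<forall>c. \<forall>f\<in>dual_on Y. \<phi> (\<lambda>x. c * f x) = c * \<phi> f) \<and>
     (\<exists>C. \<forall>f\<in>dual_on Y. \<bar>\<phi> f\<bar> \<le> C * dual_norm Y f) \<and>
     (\<forall>f. f \<notin> dual_on Y \<longrightarrow> \<phi> f = 0)}"

definition canonical :: "'a::real_normed_vector set \<Rightarrow> 'a \<Rightarrow> ('a \<Rightarrow> real) \<Rightarrow> real" where
  "canonical Y y = (\<lambda>f. if f \<in> dual_on Y then f y else 0)"

definition reflexive_space :: "'a::real_normed_vector set \<Rightarrow> bool" where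
  "reflexive_space Y \<longleftrightarrow> canonical Y ` Y = bidual_on Y"

text \<open>Codimension one: the bidual is the direct sum of the canonical image of \<open>Y\<close> and a line.\<close>

definition order_one_quasireflexive :: "'a::real_normed_vector set \<Rightarrow> bool" where
  "order_one_quasireflexive Y \<longleftrightarrow>
     (\<exists>\<phi>\<in>bidual_on Y. \<phi> \<notin> canonical Y ` Y \<and>
        bidual_on Y = {\<lambda>f. canonical Y y f + c * \<phi> f |y c. y \<in> Y})"

section \<open>The point of continuity property\<close>

definition weak_topology :: "'a::real_normed_vector set \<Rightarrow> 'a topology" where
  "weak_topology Y = topology_generated_by {{x\<in>Y. f x \<in> U} |f U. f \<in> dual_on Y \<and> open U}"

definition point_of_continuity_property :: "'a::real_normed_vector set \<Rightarrow> bool" where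
  "point_of_continuity_property Y \<longleftrightarrow>
     (\<forall>C. C \<noteq> {} \<and> closedin (top_of_set Y) C \<and> bounded C \<longrightarrow>
        (\<exists>x\<in>C. topcontinuous_at (subtopology (weak_topology Y) C) (top_of_set C) id x))"

section \<open>Copies of l1\<close>

definition ell1 :: "(nat \<Rightarrow> real) set" where
  "ell1 = {a. summable (\<lambda>n. \<bar>a n\<bar>)}"

definition ell1_norm :: "(nat \<Rightarrow> real) \<Rightarrow> real" where
  "ell1_norm a = (\<Sum>n. \<bar>a n\<bar>)"

definition isomorphic_to_ell1 :: "'a::real_normed_vector set \<Rightarrow> bool" where
  "isomorphic_to_ell1 Z \<longleftrightarrow>
     (\<exists>T. bij_betw T ell1 Z \<and>
        (\<forall>a\<in>ell1. \<forall>b\<in>ell1. T (\<lambda>n. a n + b n) = T a + T b) \<and>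
        (\<forall>c. \<forall>a\<in>ell1. T (\<lambda>n. c * a n) = c *\<^sub>R T a) \<and>
        (\<exists>C. \<forall>a\<in>ell1. norm (T a) \<le> C * ell1_norm a) \<and>
        (\<exists>C. \<forall>a\<in>ell1. ell1_norm a \<le> C * norm (T a)))"

definition contains_ell1 :: "'a::real_normed_vector set \<Rightarrow> bool" where
  "contains_ell1 Y \<longleftrightarrow> (\<exists>Z. subspace Z \<and> Z \<subseteq> Y \<and> isomorphic_to_ell1 Z)"

section \<open>Basic sequences\<close>

definition closed_span :: "(nat \<Rightarrow> 'a::real_normed_vector) \<Rightarrow> 'a set" where
  "closed_span e = closure (span (range e))"

definition basic_sequence :: "(nat \<Rightarrow> 'a::real_normed_vector) \<Rightarrow> bool" where
  "basic_sequence e \<longleftrightarrow> (\<forall>x\<in>closed_span e. \<exists>!a. (\<lambda>n. a n *\<^sub>R e n) sums x)"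

definition semi_normalized :: "(nat \<Rightarrow> 'a::real_normed_vector) \<Rightarrow> bool" where
  "semi_normalized e \<longleftrightarrow> 0 < (INF n. norm (e n)) \<and> bdd_above (range (\<lambda>n. norm (e n)))"

definition boundedly_complete :: "(nat \<Rightarrow> 'a::real_normed_vector) \<Rightarrow> bool" where
  "boundedly_complete e \<longleftrightarrow> basic_sequence e \<and>
     (\<forall>a. bdd_above (range (\<lambda>n. norm (\<Sum>i<n. a i *\<^sub>R e i))) \<longrightarrow> summable (\<lambda>n. a n *\<^sub>R e n))"

end

theory Submission
  imports Defs "HOL-Complex_Analysis.Great_Picard"
begin

text \<open>Restriction to an order convex subset of the tree is a contraction, and the restrictions of a vector
  of \<open>JT\<close> to disjoint order convex sets satisfy a lower 2-estimate. Dually, functionals living on disjoint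
  shells of the tree satisfy an upper 2-estimate. A gliding hump then rules out copies of \<open>l1\<close>, and the
  path functionals \<open>\<Sum>s\<le>t. e*_s\<close> form a closed bounded set without points of continuity, because
  \<open>e*_(t@[n])\<close> tends weakly to \<open>0\<close> as \<open>n\<close> tends to infinity.

  A bounded sequence in \<open>B_inf\<close> has a subsequence converging pointwise to some functional \<open>z\<close> on \<open>JT\<close>. If \<open>z\<close>
  belongs to \<open>B_inf\<close>, basicness forces \<open>z = 0\<close> and a further subsequence is equivalent to the
  unit vector basis of \<open>l2\<close>. Otherwise \<open>z\<close> does not tend to zero along some branch, and a
  subsequence is equivalent to the sequence of coordinate functionals on the space of null sequences of bounded quadratic
  variation, the James space; this spans an order one quasireflexive space. Both cases rest on the fact that
  block vectors of \<open>JT\<close> have subsequences satisfying an upper 2-estimate once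
  they are corrected further out on the branches that carry a fixed amount of mass.\<close>

section \<open>Restrictions in the James tree space\<close>

text \<open>The obstacle is the lower estimate. Norms in \<open>B_inf\<close> are dual norms: upper
  2-estimates for functionals come from cutting, whereas lower estimates require vectors of
  \<open>JT\<close> to test on. Normalised block vectors satisfy no upper 2-estimate in general,
  since one branch may run through all blocks and add up their contributions. Unit vectors
  subtracted beyond each block make the sums along heavy branches zero, and the other branches carry
  too little to matter. The correction is harmless for a functional that is almost zero at the added
  nodes; this is why the behaviour of \<open>z\<close> along branches separates the two cases. Nodes
  have infinitely many successors, so finite boxes \<open>tbox k\<close> take the place of levels.
  Basic sequences are given by unique expansions alone, and bounded projections have to be derived
  by a category argument. The comparison with \<open>l2\<close> and with the James space is phrased
  through sets of test sequences, so that bounded completeness and the coefficients of bidual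
  elements are handled once for both.\<close>

definition order_convex :: "nat list set \<Rightarrow> bool" where
  "order_convex D \<longleftrightarrow> (\<forall>s\<in>D. \<forall>u\<in>D. \<forall>t. prefix s t \<longrightarrow> prefix t u \<longrightarrow> t \<in> D)"

text \<open>A segment is a finite chain, so the intersection has a shortest node \<open>a\<close>
  and a longest node \<open>b\<close>; convexity of \<open>D\<close> supplies every node between
  them.\<close>

lemma segment_Int_order_convex:
  assumes "S \<in> segments" "order_convex D" "S \<inter> D \<noteq> {}"
  shows "S \<inter> D \<in> segments"
proof -
  obtain s u where S: "S = {t. prefix s t \<and> prefix t u}"
    using assms(1) by (auto simp: segments_def)
  have fin: "finite (S \<inter> D)"
    using segments_finite[OF assms(1)] by auto
  obtain a where a: "a \<in> S \<inter> D" "\<forall>t\<in>S \<inter> D. length a \<le> length t"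
    using ex_has_least_nat[of "\<lambda>t. t \<in> S \<inter> D" _ length] assms(3) by blast
  obtain b where b: "b \<in> S \<inter> D" "\<forall>t\<in>S \<inter> D. length t \<le> length b"
    using Max_in[of "length ` (S \<inter> D)"] Max_ge[of "length ` (S \<inter> D)"] fin assms(3)
    by (smt (verit, best) finite_imageI image_iff image_is_empty)
  have "S \<inter> D = {t. prefix a t \<and> prefix t b}"
  proof safe
    fix t assume t: "t \<in> S" "t \<in> D"
    show "prefix a t" "prefix t b"
      using a b t prefix_length_prefix[of _ u] by (auto simp: S)
  next
    fix t assume t: "prefix a t" "prefix t b"
    show "t \<in> S"
      using t a b by (auto simp: S)
    show "t \<in> D"
      using t a b assms(2) by (auto simp: order_convex_def)
  qed
  moreover have "prefix a b"
    using calculation a(1) by auto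
  ultimately show ?thesis
    by (auto simp: segments_def)
qed

text \<open>The nonempty sets \<open>S \<inter> D i\<close> with \<open>S\<close> in
  \<open>F i\<close> form one single segment family: pieces with the same \<open>i\<close> are
  disjoint because \<open>F i\<close> is a family, the others because the \<open>D i\<close> are
  disjoint. With one index this gives contractivity of restrictions, with near-optimal families the
  lower 2-estimate.\<close>

lemma segment_families_restrict:
  assumes I: "finite I" "\<And>i. i \<in> I \<Longrightarrow> order_convex (D i)" "disjoint_family_on D I"
    and F: "\<And>i. i \<in> I \<Longrightarrow> F i \<in> segment_families" and x: "jt_bounded x c"
  shows "(\<Sum>i\<in>I. \<Sum>S\<in>F i. (\<Sum>t\<in>S. if t \<in> D i then x t else 0)\<^sup>2) \<le> c\<^sup>2"
proof -
  define K where "K = Sigma I (\<lambda>i. {S\<in>F i. S \<inter> D i \<noteq> {}})"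
  define g where "g = (\<lambda>(i, S). S \<inter> D i)"
  have finF: "finite (F i)" "F i \<subseteq> segments" "pairwise disjnt (F i)" if "i \<in> I" for i
    using F[OF that] by (auto simp: segment_families_def)
  have finK: "finite K"
    unfolding K_def using I(1) finF by auto
  have dis: "g p \<inter> g q = {}" if "p \<in> K" "q \<in> K" "p \<noteq> q" for p q
  proof -
    obtain i S j R where pq: "p = (i, S)" "q = (j, R)"
      by fastforce
    show ?thesis
    proof (cases "i = j")
      case True
      then show ?thesis
        using that finF(3)[of i] by (auto simp: pq g_def K_def pairwise_def disjnt_def)
    next
      case False
      then show ?thesis
        using that I(3) by (auto simp: pq g_def K_def disjoint_family_on_def)
    qed
  qed
  have ne: "g p \<noteq> {}" if "p \<in> K" for p
    using that by (auto simp: K_def g_def)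
  have inj: "inj_on g K"
    using dis ne by (metis Int_absorb inj_onI)
  have G: "g ` K \<in> segment_families"
    unfolding segment_families_def
  proof safe
    show "finite (g ` K)"
      using finK by simp
    show "pairwise disjnt (g ` K)"
      by (rule pairwise_imageI) (simp add: dis disjnt_def)
    fix i S assume "(i, S) \<in> K"
    then show "g (i, S) \<in> segments"
      unfolding K_def g_def using segment_Int_order_convex[of S "D i"] I(2)[of i] finF(2)[of i] by auto
  qed
  have "(\<Sum>i\<in>I. \<Sum>S\<in>F i. (\<Sum>t\<in>S. if t \<in> D i then x t else 0)\<^sup>2)
      = (\<Sum>i\<in>I. \<Sum>S\<in>{S\<in>F i. S \<inter> D i \<noteq> {}}. (sum x (S \<inter> D i))\<^sup>2)"
  proof (rule sum.cong[OF refl])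
    fix i assume i: "i \<in> I"
    have "(\<Sum>S\<in>F i. (\<Sum>t\<in>S. if t \<in> D i then x t else 0)\<^sup>2) = (\<Sum>S\<in>F i. (sum x (S \<inter> D i))\<^sup>2)"
      using finF(2)[OF i] segments_finite by (intro sum.cong refl) (subst sum.inter_restrict, auto)
    also have "\<dots> = (\<Sum>S\<in>{S\<in>F i. S \<inter> D i \<noteq> {}}. (sum x (S \<inter> D i))\<^sup>2)"
      using finF(1)[OF i] by (intro sum.mono_neutral_right) auto
    finally show "(\<Sum>S\<in>F i. (\<Sum>t\<in>S. if t \<in> D i then x t else 0)\<^sup>2) = \<dots>" .
  qed
  also have "\<dots> = (\<Sum>p\<in>K. (sum x (g p))\<^sup>2)"
    unfolding K_def g_def using I(1) finF by (subst sum.Sigma) (auto simp: case_prod_beta)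
  also have "\<dots> = (\<Sum>S\<in>g ` K. (sum x S)\<^sup>2)"
    using inj by (simp add: sum.reindex)
  also have "\<dots> = (L2_set (sum x) (g ` K))\<^sup>2"
    by (simp add: L2_set_def sum_nonneg)
  also have "\<dots> \<le> c\<^sup>2"
    using x G by (intro power_mono) (auto simp: jt_bounded_L2_set)
  finally show ?thesis .
qed

lemma jt_bounded_restrict:
  assumes "order_convex D" "jt_bounded x c"
  shows "jt_bounded (\<lambda>t. if t \<in> D then x t else 0) c"
  unfolding jt_bounded_L2_set
proof
  fix F assume F: "F \<in> segment_families"
  have "(L2_set (sum (\<lambda>t. if t \<in> D then x t else 0)) F)\<^sup>2 \<le> c\<^sup>2"
    using segment_families_restrict[of "{()}" "\<lambda>_. D" "\<lambda>_. F" x c] assms F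
    by (simp add: L2_set_def sum_nonneg disjoint_family_on_def)
  then show "L2_set (sum (\<lambda>t. if t \<in> D then x t else 0)) F \<le> c"
    using jt_bounded_nonneg[OF assms(2)] by (rule power2_le_imp_le)
qed

lemma jt_family_le: "F \<in> segment_families \<Longrightarrow> L2_set (sum (jt_fun x)) F \<le> norm x"
  using jt_fun_bounded[of x] unfolding jt_bounded_L2_set norm_jt_inf_def by blast

lemma jt_eqI: "(\<And>t. jt_fun x t = jt_fun y t) \<Longrightarrow> x = y"
  by (subst jt_fun_inject[symmetric]) (rule ext)

lemma jt_bounded_jt_fun: "jt_bounded (jt_fun x) (norm x)"
  using norm_jt_le_iff[of x "norm x"] by simp

lemma jt_segment_le:
  assumes "S \<in> segments"
  shows "\<bar>sum (jt_fun x) S\<bar> \<le> norm x"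
proof -
  have "{S} \<in> segment_families"
    using assms by (simp add: segment_families_def)
  from jt_family_le[OF this, of x] show ?thesis
    by simp
qed

section \<open>Cutting vectors and functionals to order convex sets\<close>

definition jcut :: "nat list set \<Rightarrow> jt_inf \<Rightarrow> jt_inf" where
  "jcut D x = Abs_jt_inf (\<lambda>t. if t \<in> D then jt_fun x t else 0)"

lemma jt_fun_cut:
  assumes "order_convex D"
  shows "jt_fun (jcut D x) = (\<lambda>t. if t \<in> D then jt_fun x t else 0)"
  unfolding jcut_def
proof (rule Abs_jt_inf_inverse, safe)
  fix \<epsilon> :: real assume "\<epsilon> > 0"
  then obtain y where y: "finitely_supported y" "jt_bounded (\<lambda>t. jt_fun x t - y t) \<epsilon>"
    using jt_fun_approx by blast
  have "finitely_supported (\<lambda>t. if t \<in> D then y t else 0)"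
    using y(1) unfolding finitely_supported_def by (rule rev_finite_subset) auto
  moreover have "(\<lambda>t. (if t \<in> D then jt_fun x t else 0) - (if t \<in> D then y t else 0))
      = (\<lambda>t. if t \<in> D then jt_fun x t - y t else 0)"
    by auto
  ultimately show "\<exists>w. finitely_supported w \<and>
      jt_bounded (\<lambda>t. (if t \<in> D then jt_fun x t else 0) - w t) \<epsilon>"
    using jt_bounded_restrict[OF assms y(2)]
    by (intro exI[of _ "\<lambda>t. if t \<in> D then y t else 0"]) simp
qed

lemma norm_cut_le: "order_convex D \<Longrightarrow> norm (jcut D x) \<le> norm x"
  unfolding norm_jt_le_iff by (simp only: jt_fun_cut) (rule jt_bounded_restrict[OF _ jt_bounded_jt_fun])

lemma jt_norm_approx:
  assumes "0 < \<eta>" "\<eta> < 1"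
  shows "\<exists>F\<in>segment_families. \<eta> * norm x \<le> L2_set (sum (jt_fun x)) F"
proof (cases "norm x = 0")
  case True
  then show ?thesis
    using empty_family by force
next
  case False
  show ?thesis
  proof (rule ccontr)
    assume "\<not> ?thesis"
    then have "norm x \<le> \<eta> * norm x"
      unfolding norm_jt_le_iff jt_bounded_L2_set by (auto simp: not_le less_imp_le)
    then show False
      using False assms by simp
  qed
qed

text \<open>Near-norming families for the individual pieces are put together by
  \<open>segment_families_restrict\<close>; letting \<open>\<eta>\<close> tend to 1 removes the
  loss.\<close>

lemma L2_norm_cut_le:
  assumes I: "finite I" "\<And>i. i \<in> I \<Longrightarrow> order_convex (D i)" "disjoint_family_on D I"
  shows "L2_set (\<lambda>i. norm (jcut (D i) x)) I \<le> norm x"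
proof (rule field_le_mult_one_interval)
  fix \<eta> :: real assume \<eta>: "0 < \<eta>" "\<eta> < 1"
  obtain F where F: "\<And>i. F i \<in> segment_families"
    "\<And>i. \<eta> * norm (jcut (D i) x) \<le> L2_set (sum (jt_fun (jcut (D i) x))) (F i)"
    using jt_norm_approx[OF \<eta>, of "jcut (D _) x"] by metis
  have "(L2_set (\<lambda>i. \<eta> * norm (jcut (D i) x)) I)\<^sup>2
      \<le> (L2_set (\<lambda>i. L2_set (sum (jt_fun (jcut (D i) x))) (F i)) I)\<^sup>2"
    using F \<eta> by (intro power_mono L2_set_mono) auto
  also have "\<dots> = (\<Sum>i\<in>I. \<Sum>S\<in>F i. (\<Sum>t\<in>S. if t \<in> D i then jt_fun x t else 0)\<^sup>2)"
    using I(2) by (simp add: L2_set_def sum_nonneg jt_fun_cut)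
  also have "\<dots> \<le> (norm x)\<^sup>2"
    using segment_families_restrict[OF I(1,2,3) F(1) jt_bounded_jt_fun] by simp
  finally have "L2_set (\<lambda>i. \<eta> * norm (jcut (D i) x)) I \<le> norm x"
    by (rule power2_le_imp_le) simp
  then show "\<eta> * L2_set (\<lambda>i. norm (jcut (D i) x)) I \<le> norm x"
    using \<eta> by (simp add: L2_set_right_distrib)
qed

lemma bounded_linear_cut: "order_convex D \<Longrightarrow> bounded_linear (jcut D)"
proof (rule bounded_linear_intro[of _ 1])
  assume D: "order_convex D"
  show "jcut D (x + y) = jcut D x + jcut D y" "jcut D (a *\<^sub>R x) = a *\<^sub>R jcut D x" for a x y
    using D by (auto intro!: jt_eqI simp: jt_fun_simps jt_fun_cut)
  show "norm (jcut D x) \<le> norm x * 1" for x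
    using norm_cut_le[OF D] by simp
qed

text \<open>Both \<^const>\<open>jcut\<close> and \<open>fcut\<close> are only meaningful for order convex sets.\<close>

definition fcut :: "(jt_inf \<Rightarrow>\<^sub>L real) \<Rightarrow> nat list set \<Rightarrow> jt_inf \<Rightarrow>\<^sub>L real" where
  "fcut f D = f o\<^sub>L Blinfun (jcut D)"

lemma fcut_apply: "order_convex D \<Longrightarrow> blinfun_apply (fcut f D) x = f (jcut D x)"
  by (simp add: fcut_def bounded_linear_Blinfun_apply bounded_linear_cut)

lemma norm_blinfun_le: "\<bar>blinfun_apply f x\<bar> \<le> norm f * norm x" for f :: "'a::real_normed_vector \<Rightarrow>\<^sub>L real"
  using norm_blinfun[of f x] by simp

lemma norm_fcut_le:
  assumes "order_convex D"
  shows "norm (fcut f D) \<le> norm f"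
proof (rule norm_blinfun_bound)
  fix x
  have "norm (blinfun_apply (fcut f D) x) \<le> norm f * norm (jcut D x)"
    using norm_blinfun_le by (simp add: fcut_apply assms)
  also have "\<dots> \<le> norm f * norm x"
    by (intro mult_left_mono norm_cut_le assms) auto
  finally show "norm (blinfun_apply (fcut f D) x) \<le> norm f * norm x" .
qed simp

lemma fcut_diff: "fcut (f - g) D = fcut f D - fcut g D"
  by (simp add: fcut_def bounded_bilinear.diff_left[OF bounded_bilinear_blinfun_compose])

text \<open>Dual to \<open>L2_norm_cut_le\<close>: each summand sees only the piece of
  \<open>x\<close> in \<open>D i\<close>, and Cauchy-Schwarz combines the norms of the functionals
  with the lower 2-estimate for the pieces.\<close>

lemma fcut_upper_2:
  assumes I: "finite I" "\<And>i. i \<in> I \<Longrightarrow> order_convex (D i)" "disjoint_family_on D I"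
  shows "norm (\<Sum>i\<in>I. fcut (f i) (D i)) \<le> L2_set (\<lambda>i. norm (f i)) I"
proof (rule norm_blinfun_bound)
  fix x
  have "norm (blinfun_apply (\<Sum>i\<in>I. fcut (f i) (D i)) x) = \<bar>\<Sum>i\<in>I. f i (jcut (D i) x)\<bar>"
    using I(2) by (simp add: blinfun.sum_left fcut_apply)
  also have "\<dots> \<le> (\<Sum>i\<in>I. \<bar>norm (f i)\<bar> * \<bar>norm (jcut (D i) x)\<bar>)"
    using norm_blinfun_le by (intro order_trans[OF sum_abs] sum_mono) auto
  also have "\<dots> \<le> L2_set (\<lambda>i. norm (f i)) I * L2_set (\<lambda>i. norm (jcut (D i) x)) I"
    by (rule L2_set_mult_ineq)
  also have "\<dots> \<le> L2_set (\<lambda>i. norm (f i)) I * norm x"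
    using L2_norm_cut_le[OF I] by (intro mult_left_mono) auto
  finally show "norm (blinfun_apply (\<Sum>i\<in>I. fcut (f i) (D i)) x) \<le> L2_set (\<lambda>i. norm (f i)) I * norm x" .
qed simp

text \<open>Length and entries are both bounded, because a level of the tree is infinite. The boxes
  are finite, closed under prefixes and exhaust the tree, so boxes, their complements and their
  differences are all order convex.\<close>

definition tbox :: "nat \<Rightarrow> nat list set" where
  "tbox k = {t. length t < k \<and> set t \<subseteq> {..<k}}"

lemma finite_box: "finite (tbox k)"
  by (rule finite_subset[OF _ finite_lists_length_le[of "{..<k}" k]]) (auto simp: tbox_def)

lemma box_mono: "m \<le> n \<Longrightarrow> tbox m \<subseteq> tbox n"
  unfolding tbox_def by (auto intro: order_less_le_trans)

lemma prefix_box: "prefix s t \<Longrightarrow> t \<in> tbox k \<Longrightarrow> s \<in> tbox k"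
  using prefix_length_le[of s t] set_mono_prefix[of s t] unfolding tbox_def by auto

lemma in_some_box: "\<exists>k. t \<in> tbox k"
proof -
  have "t \<in> tbox (Suc (length t + Max (insert 0 (set t))))"
    by (auto simp: tbox_def less_Suc_eq_le intro!: trans_le_add2)
  then show ?thesis ..
qed

lemma finite_subset_box:
  assumes "finite E"
  shows "\<exists>k. E \<subseteq> tbox k"
  using assms
proof induction
  case (insert t E)
  then obtain k l where "E \<subseteq> tbox k" "t \<in> tbox l"
    using in_some_box by blast
  then have "insert t E \<subseteq> tbox (max k l)"
    using box_mono[of k "max k l"] box_mono[of l "max k l"] by auto
  then show ?case ..
qed simp

definition tcone :: "nat list \<Rightarrow> nat list set" where
  "tcone r = {t. prefix r t}"

lemma order_convex_box: "order_convex (tbox k)"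
  and order_convex_co_box: "order_convex (- tbox k)"
  and order_convex_shell: "order_convex (tbox n - tbox m)"
  and order_convex_cone: "order_convex (tcone r)"
proof -
  show "order_convex (tbox k)" "order_convex (- tbox k)" "order_convex (tbox n - tbox m)"
    unfolding order_convex_def by (blast dest: prefix_box)+
  show "order_convex (tcone r)"
    unfolding order_convex_def tcone_def by (auto intro: prefix_order.trans)
qed

lemmas order_convex_simps [simp] =
  order_convex_box order_convex_co_box order_convex_shell order_convex_cone

lemmas jt_fun_cut' [simp] = order_convex_simps[THEN jt_fun_cut]

definition jt_unit :: "nat list \<Rightarrow> jt_inf" where
  "jt_unit t = Abs_jt_inf (\<lambda>s. if s = t then 1 else 0)"

lemma jt_fun_unit: "jt_fun (jt_unit t) = (\<lambda>s. if s = t then 1 else 0)"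
  unfolding jt_unit_def
  by (rule finitely_supported_jt_fun) (simp add: finitely_supported_def)

lemma jt_fun_sum: "jt_fun (sum f A) t = (\<Sum>i\<in>A. jt_fun (f i) t)"
  by (induction A rule: infinite_finite_induct) (simp_all add: jt_fun_simps)

lemma sum_jt_unit:
  assumes "finite A" "\<And>t. t \<notin> A \<Longrightarrow> jt_fun x t = 0"
  shows "(\<Sum>t\<in>A. jt_fun x t *\<^sub>R jt_unit t) = x"
proof -
  have "jt_fun (\<Sum>t\<in>A. jt_fun x t *\<^sub>R jt_unit t) s = jt_fun x s" for s
    using assms by (auto simp: jt_fun_sum jt_fun_scaleR jt_fun_unit if_distrib sum.delta cong: if_cong)
  then show ?thesis
    by (rule jt_eqI)
qed

lemma norm_jt_unit_le: "norm (jt_unit t) \<le> 1"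
proof -
  have fs: "finitely_supported (jt_fun (jt_unit t))"
    by (simp add: finitely_supported_def jt_fun_unit)
  have *: "{s. (if s = t then 1 else 0 :: real) \<noteq> 0} = {t}"
    by auto
  show ?thesis
    using finitely_supported_bounded[OF fs] by (simp add: norm_jt_le_iff jt_fun_unit *)
qed

text \<open>The tail operators are contractions and annihilate every finitely supported vector from
  some box on, so density of these vectors suffices.\<close>

lemma cut_box_tendsto: "(\<lambda>n. jcut (tbox n) x) \<longlonglongrightarrow> x"
proof (rule metric_LIMSEQ_I)
  fix e :: real assume "e > 0"
  then obtain y where y: "finitely_supported y" "jt_bounded (\<lambda>t. jt_fun x t - y t) (e/2)"
    using jt_fun_approx[of "e/2"] by auto
  define w where "w = Abs_jt_inf y"
  have w: "jt_fun w = y"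
    by (simp add: w_def finitely_supported_jt_fun y(1))
  obtain k where k: "{t. y t \<noteq> 0} \<subseteq> tbox k"
    using finite_subset_box y(1) by (auto simp: finitely_supported_def)
  have "dist (jcut (tbox n) x) x < e" if "n \<ge> k" for n
  proof -
    have "x - jcut (tbox n) x = jcut (- tbox n) (x - w)"
      using k box_mono[OF that]
      by (intro jt_eqI) (auto simp: jt_fun_simps w)
    then have "norm (x - jcut (tbox n) x) \<le> norm (x - w)"
      using norm_cut_le order_convex_simps by metis
    also have "\<dots> \<le> e/2"
      unfolding norm_jt_le_iff jt_fun_simps w by (rule y(2))
    finally show ?thesis
      using \<open>e > 0\<close> by (simp add: dist_norm norm_minus_commute)
  qed
  then show "\<exists>k. \<forall>n\<ge>k. dist (jcut (tbox n) x) x < e"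
    by blast
qed

text \<open>For cuts to finite sets, pointwise convergence of functionals is therefore norm
  convergence, and every such cut of an arbitrary functional lies in \<open>B_inf\<close>.\<close>

lemma fcut_finite:
  assumes "order_convex D" "finite D"
  shows "fcut f D = (\<Sum>t\<in>D. f (jt_unit t) *\<^sub>R jt_coord t)"
proof (rule blinfun_eqI)
  fix x
  have "(\<Sum>t\<in>D. jt_fun (jcut D x) t *\<^sub>R jt_unit t) = jcut D x"
    using assms by (intro sum_jt_unit) (auto simp: jt_fun_cut)
  then have "f (jcut D x) = f (\<Sum>t\<in>D. jt_fun (jcut D x) t *\<^sub>R jt_unit t)"
    by simp
  also have "\<dots> = (\<Sum>t\<in>D. jt_fun x t * f (jt_unit t))"
    using assms by (simp add: blinfun.sum_right blinfun.scaleR_right jt_fun_cut)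
  finally show "blinfun_apply (fcut f D) x = blinfun_apply (\<Sum>t\<in>D. f (jt_unit t) *\<^sub>R jt_coord t) x"
    using assms by (simp add: fcut_apply blinfun.sum_left blinfun.scaleR_left jt_coord_apply mult.commute)
qed

section \<open>The predual as the space of functionals with vanishing tails\<close>

lemma subspace_closure:
  fixes S :: "'a::real_normed_vector set"
  assumes "subspace S"
  shows "subspace (closure S)"
  unfolding subspace_def
proof safe
  show "0 \<in> closure S"
    using subspace_0[OF assms] closure_subset by blast
next
  fix x y assume "x \<in> closure S" "y \<in> closure S"
  then obtain f g where "\<forall>n. f n \<in> S" "f \<longlonglongrightarrow> x" "\<forall>n. g n \<in> S" "g \<longlonglongrightarrow> y"
    by (meson closure_sequential)
  then show "x + y \<in> closure S"
    unfolding closure_sequential using assms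
    by (intro exI[of _ "\<lambda>n. f n + g n"]) (auto intro: tendsto_add subspace_add)
next
  fix c x assume "x \<in> closure S"
  then obtain f where "\<forall>n. f n \<in> S" "f \<longlonglongrightarrow> x"
    by (meson closure_sequential)
  then show "c *\<^sub>R x \<in> closure S"
    unfolding closure_sequential using assms
    by (intro exI[of _ "\<lambda>n. c *\<^sub>R f n"]) (auto intro: tendsto_scaleR subspace_scale)
qed

lemma closed_B_inf: "closed B_inf"
  and subspace_B_inf: "subspace B_inf"
  by (auto simp: B_inf_def subspace_closure)

lemma jt_coord_in_B_inf: "jt_coord t \<in> B_inf"
  unfolding B_inf_def by (intro subsetD[OF closure_subset] span_base) auto

lemma fcut_finite_in_B_inf: "order_convex D \<Longrightarrow> finite D \<Longrightarrow> fcut f D \<in> B_inf"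
  unfolding fcut_finite
  by (intro subspace_sum subspace_scale subspace_B_inf jt_coord_in_B_inf)

lemma cut_box_split: "x = jcut (tbox n) x + jcut (- tbox n) x"
  by (intro jt_eqI) (simp add: jt_fun_simps)

lemma fcut_box_split: "f = fcut f (tbox n) + fcut f (- tbox n)"
proof (rule blinfun_eqI)
  fix x
  show "f x = (fcut f (tbox n) + fcut f (- tbox n)) x"
    using arg_cong[OF cut_box_split[of x n], of "blinfun_apply f"]
    by (simp add: blinfun.add_left blinfun.add_right fcut_apply)
qed

lemma fcut_co_box_antimono:
  assumes "m \<le> n"
  shows "norm (fcut f (- tbox n)) \<le> norm (fcut f (- tbox m))"
proof -
  have "fcut f (- tbox n) = fcut (fcut f (- tbox m)) (- tbox n)"
  proof (rule blinfun_eqI)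
    fix x
    have "jcut (- tbox n) x = jcut (- tbox m) (jcut (- tbox n) x)"
      using box_mono[OF assms] by (intro jt_eqI) auto
    then show "fcut f (- tbox n) x = fcut (fcut f (- tbox m)) (- tbox n) x"
      by (simp add: fcut_apply)
  qed
  then show ?thesis
    using norm_fcut_le by (metis order_convex_simps(2))
qed

text \<open>Tails of a finite combination of coordinates vanish outside a large box, and cutting is
  a contraction, so the property passes to the norm closure. Together with
  \<open>not_B_inf_tail\<close> it characterises \<open>B_inf\<close> by norm convergence of the
  cuts to boxes.\<close>

lemma B_inf_tail:
  assumes "f \<in> B_inf" "e > 0"
  shows "\<exists>k. \<forall>n\<ge>k. norm (fcut f (- tbox n)) < e"
proof -
  obtain g where g: "g \<in> span (range jt_coord)" "dist g f < e"
    using assms by (auto simp: B_inf_def closure_approachable)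
  from g(1) have "\<exists>k. fcut g (- tbox k) = 0"
  proof (induction rule: span_induct_alt)
    case base
    then show ?case
      by (auto intro!: exI[of _ 0] blinfun_eqI simp: fcut_apply)
  next
    case (step c h g')
    then obtain t k where t: "h = jt_coord t" and k: "fcut g' (- tbox k) = 0"
      by auto
    obtain l where l: "t \<in> tbox l"
      using in_some_box by blast
    have "norm (fcut g' (- tbox (max k l))) \<le> 0"
      using fcut_co_box_antimono[of k "max k l" g'] k by simp
    then have "fcut g' (- tbox (max k l)) x = 0" for x
      by simp
    moreover have "t \<in> tbox (max k l)"
      using l box_mono[of l "max k l"] by auto
    ultimately have "fcut (c *\<^sub>R h + g') (- tbox (max k l)) = 0"
      by (intro blinfun_eqI) (auto simp: t fcut_apply blinfun.add_left blinfun.scaleR_left jt_coord_apply)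
    then show ?case ..
  qed
  then obtain k where k: "fcut g (- tbox k) = 0"
    by blast
  have "norm (fcut f (- tbox n)) < e" if "n \<ge> k" for n
  proof -
    have "norm (fcut f (- tbox n)) \<le> norm (fcut f (- tbox k))"
      using that by (rule fcut_co_box_antimono)
    also have "\<dots> = norm (fcut (f - g) (- tbox k))"
      by (simp add: fcut_diff k)
    also have "\<dots> \<le> norm (f - g)"
      by (rule norm_fcut_le) simp
    also have "\<dots> < e"
      using g(2) by (simp add: dist_norm norm_minus_commute)
    finally show ?thesis .
  qed
  then show ?thesis
    by blast
qed

text \<open>If some tails were arbitrarily small, the cuts to boxes, which lie in
  \<open>B_inf\<close>, would approximate \<open>f\<close> in norm.\<close>

lemma not_B_inf_tail:
  assumes "f \<notin> B_inf"
  shows "\<exists>\<delta>>0. \<forall>n. \<delta> \<le> norm (fcut f (- tbox n))"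
proof (rule ccontr)
  assume "\<not> ?thesis"
  then have *: "\<exists>n. norm (fcut f (- tbox n)) < \<delta>" if "\<delta> > 0" for \<delta>
    using that by (meson not_le)
  have "f \<in> closure B_inf"
    unfolding closure_approachable
  proof safe
    fix e :: real assume "e > 0"
    then obtain n where n: "norm (fcut f (- tbox n)) < e"
      using * by blast
    have "dist (fcut f (tbox n)) f < e"
      using n arg_cong[OF fcut_box_split[of f n], of "\<lambda>g. g - fcut f (tbox n)"]
      by (simp add: dist_norm norm_minus_commute)
    then show "\<exists>y\<in>B_inf. dist y f < e"
      using fcut_finite_in_B_inf[of "tbox n" f] finite_box by auto
  qed
  then show False
    using assms closed_B_inf by simp
qed

section \<open>Failure of the point of continuity property\<close>

lemma dual_on_sum:
  assumes "subspace Y" "f \<in> dual_on Y" "\<And>i. i \<in> I \<Longrightarrow> x i \<in> Y"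
  shows "f (\<Sum>i\<in>I. a i *\<^sub>R x i) = (\<Sum>i\<in>I. a i * f (x i))"
  using assms(3)
proof (induction I rule: infinite_finite_induct)
  case (insert i I)
  have "(\<Sum>i\<in>I. a i *\<^sub>R x i) \<in> Y" "a i *\<^sub>R x i \<in> Y"
    using insert.prems assms(1) by (auto intro: subspace_sum subspace_scale)
  then show ?case
    using insert assms(2) by (simp add: dual_on_def)
next
  case empty
  have "f (0 *\<^sub>R 0) = 0 * f 0"
    using assms(1,2) subspace_0 unfolding dual_on_def by blast
  then show ?case
    by simp
next
  case (infinite I)
  have "f (0 *\<^sub>R 0) = 0 * f 0"
    using assms(1,2) subspace_0 unfolding dual_on_def by blast
  then show ?case
    using infinite by simp
qed

text \<open>The functional is tested on the combination whose coefficients are its own values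
  \<open>f (y n)\<close>: the square of the l2 norm \<open>?L\<close> is then at most a constant
  times \<open>?L\<close>. In particular, such a sequence \<open>y\<close> is weakly null.\<close>

lemma dual_on_upper_2_summable:
  assumes Y: "subspace Y" "\<And>n. y n \<in> Y" and f: "f \<in> dual_on Y"
    and up: "\<And>N a. norm (\<Sum>n<N. a n *\<^sub>R y n) \<le> K * L2_set a {..<N}" and "0 \<le> K"
  shows "summable (\<lambda>n. (f (y n))\<^sup>2)"
proof -
  obtain C where C: "\<forall>x\<in>Y. \<bar>f x\<bar> \<le> C * norm x"
    using f by (auto simp: dual_on_def)
  have bound: "(\<Sum>n<N. (f (y n))\<^sup>2) \<le> (\<bar>C\<bar> * K)\<^sup>2" for N
  proof -
    let ?L = "L2_set (\<lambda>n. f (y n)) {..<N}"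
    have "?L * ?L = (\<Sum>n<N. f (y n) * f (y n))"
      by (simp add: L2_set_def sum_nonneg power2_eq_square)
    also have "\<dots> = f (\<Sum>n<N. f (y n) *\<^sub>R y n)"
      using dual_on_sum[OF Y(1) f, of "{..<N}" y "\<lambda>n. f (y n)"] Y(2) by simp
    also have "\<dots> \<le> C * norm (\<Sum>n<N. f (y n) *\<^sub>R y n)"
      using C Y by (meson abs_le_D1 subspace_sum subspace_scale)
    also have "\<dots> \<le> \<bar>C\<bar> * (K * ?L)"
      by (intro mult_mono up) auto
    finally have "?L * ?L \<le> (\<bar>C\<bar> * K) * ?L"
      by (simp add: mult_ac)
    then have "?L \<le> \<bar>C\<bar> * K"
      using \<open>0 \<le> K\<close> L2_set_nonneg[of "\<lambda>n. f (y n)" "{..<N}"]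
      by (cases "?L = 0") (auto simp: mult_le_cancel_right)
    then have "?L\<^sup>2 \<le> (\<bar>C\<bar> * K)\<^sup>2"
      by (intro power_mono) auto
    then show ?thesis
      by (simp add: L2_set_def sum_nonneg)
  qed
  show ?thesis
    by (rule summableI_nonneg_bounded[OF _ bound]) auto
qed

lemma norm_jt_coord_le: "norm (jt_coord t) \<le> 1"
  by (rule norm_blinfun_bound) (auto simp: jt_coord_apply jt_coord_le_norm)

lemma order_convex_singleton: "order_convex {t}"
  unfolding order_convex_def using prefix_order.antisym by blast

lemma jt_coord_upper_2:
  assumes "inj_on t {..<N::nat}"
  shows "norm (\<Sum>n<N. a n *\<^sub>R jt_coord (t n)) \<le> L2_set a {..<N}"
proof -
  have "(\<Sum>n<N. a n *\<^sub>R jt_coord (t n)) = (\<Sum>n<N. fcut (a n *\<^sub>R jt_coord (t n)) {t n})"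
    by (intro sum.cong refl blinfun_eqI)
      (simp add: fcut_apply order_convex_singleton blinfun.scaleR_left jt_coord_apply jt_fun_cut)
  also have "norm \<dots> \<le> L2_set (\<lambda>n. norm (a n *\<^sub>R jt_coord (t n))) {..<N}"
    using assms by (intro fcut_upper_2) (auto simp: order_convex_singleton disjoint_family_on_def inj_on_def)
  also have "\<dots> \<le> L2_set (\<lambda>n. \<bar>a n\<bar>) {..<N}"
    using mult_left_mono[OF norm_jt_coord_le] by (intro L2_set_mono) fastforce+
  also have "\<dots> = L2_set a {..<N}"
    by (simp add: L2_set_def)
  finally show ?thesis .
qed

text \<open>A path from the root is a segment, so the norms stay bounded, while the successors of a
  node give infinitely many functionals at mutual distance at least 1.\<close>

definition path_functional :: "nat list \<Rightarrow> jt_inf \<Rightarrow>\<^sub>L real" where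
  "path_functional t = (\<Sum>s\<in>{s. prefix s t}. jt_coord s)"

lemma path_segment: "{s. prefix s t} \<in> segments"
proof -
  have "{s. prefix s t} = {s. prefix [] s \<and> prefix s t}"
    by simp
  then show ?thesis
    unfolding segments_def by blast
qed

lemma path_functional_apply: "path_functional t x = sum (jt_fun x) {s. prefix s t}"
  by (simp add: path_functional_def blinfun.sum_left jt_coord_apply)

lemma path_functional_unit: "path_functional t (jt_unit s) = (if prefix s t then 1 else 0)"
  using segments_finite[OF path_segment, of t] by (simp add: path_functional_apply jt_fun_unit)

lemma norm_path_functional_le: "norm (path_functional t) \<le> 1"
  by (rule norm_blinfun_bound) (auto simp: path_functional_apply intro: jt_segment_le path_segment)

text \<open>One of the two nodes is not a prefix of the other, and the unit vector there tells the
  functionals apart.\<close>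

lemma path_functional_separated:
  assumes "t \<noteq> u"
  shows "1 \<le> dist (path_functional t) (path_functional u)"
proof -
  obtain s where s: "prefix s t \<noteq> prefix s u"
    using assms prefix_order.antisym by blast
  have "1 \<le> \<bar>(path_functional t - path_functional u) (jt_unit s)\<bar>"
    using s by (auto simp: blinfun.diff_left path_functional_unit)
  also have "\<dots> \<le> norm (path_functional t - path_functional u) * norm (jt_unit s)"
    by (rule norm_blinfun_le)
  also have "\<dots> \<le> norm (path_functional t - path_functional u) * 1"
    by (intro mult_left_mono norm_jt_unit_le) auto
  finally show ?thesis
    by (simp add: dist_norm)
qed

lemma path_functional_append: "path_functional (t @ [n]) = path_functional t + jt_coord (t @ [n])"
proof -
  have "{s. prefix s (t @ [n])} = insert (t @ [n]) {s. prefix s t}"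
    by auto
  then show ?thesis
    using segments_finite[OF path_segment, of t] by (simp add: path_functional_def)
qed

lemma path_functional_in_B_inf: "path_functional t \<in> B_inf"
  unfolding path_functional_def by (intro subspace_sum subspace_B_inf jt_coord_in_B_inf)

lemma eventually_weak_topology:
  assumes Y: "x \<in> Y" "\<And>n. y n \<in> Y" and lim: "\<And>f. f \<in> dual_on Y \<Longrightarrow> (\<lambda>n. f (y n)) \<longlonglongrightarrow> f x"
    and U: "openin (weak_topology Y) U" "x \<in> U"
  shows "eventually (\<lambda>n. y n \<in> U) sequentially"
proof -
  have "generate_topology_on {{x\<in>Y. f x \<in> U} |f U. f \<in> dual_on Y \<and> open U} U"
    using U(1) by (simp add: weak_topology_def openin_topology_generated_by_iff)
  then show ?thesis
    using U(2)
  proof induction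
    case (Basis S)
    then obtain f V where S: "S = {x\<in>Y. f x \<in> V}" "f \<in> dual_on Y" "open V"
      by auto
    then have "eventually (\<lambda>n. f (y n) \<in> V) sequentially"
      using topological_tendstoD[OF lim[OF S(2)] S(3)] Basis by auto
    then show ?case
      using Y(2) by (simp add: S(1))
  next
    case (Int a b)
    then show ?case
      by (auto intro: eventually_conj)
  next
    case (UN K)
    then obtain k where "k \<in> K" "x \<in> k"
      by blast
    then have "eventually (\<lambda>n. y n \<in> k) sequentially"
      using UN by blast
    then show ?case
      by (rule eventually_mono) (use \<open>k \<in> K\<close> in blast)
  qed simp
qed

theorem B_inf_not_pcp: "\<not> point_of_continuity_property B_inf"
proof
  assume pcp: "point_of_continuity_property B_inf"
  define C where "C = range path_functional"
  have "closed C"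
  proof (rule discrete_imp_closed[of 1])
    show "\<forall>x\<in>C. \<forall>y\<in>C. dist y x < 1 \<longrightarrow> y = x"
      unfolding C_def by (metis imageE not_le path_functional_separated)
  qed simp
  moreover have sub: "C \<subseteq> B_inf"
    using path_functional_in_B_inf by (auto simp: C_def)
  ultimately have "closedin (top_of_set B_inf) C"
    by (simp add: closed_subset)
  moreover have "bounded C"
    unfolding C_def bounded_iff using norm_path_functional_le by blast
  ultimately obtain x where x: "x \<in> C"
    and cont: "topcontinuous_at (subtopology (weak_topology B_inf) C) (top_of_set C) id x"
    using pcp unfolding point_of_continuity_property_def C_def by blast
  obtain t where t: "x = path_functional t"
    using x by (auto simp: C_def)
  \<comment> \<open>By the separation this ball isolates \<open>x\<close> in \<open>C\<close>, so
    continuity at \<open>x\<close> would make \<open>x\<close> weakly isolated in \<open>C\<close>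
    as well.\<close>
  have "openin (top_of_set C) (C \<inter> ball x (1/2))"
    by auto
  then obtain U where U: "openin (subtopology (weak_topology B_inf) C) U" "x \<in> U"
    "\<forall>y\<in>U. id y \<in> C \<inter> ball x (1/2)"
    using cont x unfolding topcontinuous_at_def by (metis IntI centre_in_ball half_gt_zero id_apply zero_less_one)
  then obtain W where W: "openin (weak_topology B_inf) W" "U = W \<inter> C"
    by (auto simp: openin_subtopology)
  have "eventually (\<lambda>n. path_functional (t @ [n]) \<in> W) sequentially"
  proof (rule eventually_weak_topology[OF _ _ _ W(1)])
    show "x \<in> B_inf" "x \<in> W"
      using x sub U W by auto
    show "path_functional (t @ [n]) \<in> B_inf" for n
      by (rule path_functional_in_B_inf)
    fix f assume f: "f \<in> dual_on B_inf"
    have "summable (\<lambda>n. (f (jt_coord (t @ [n])))\<^sup>2)"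
      by (rule dual_on_upper_2_summable[OF subspace_B_inf jt_coord_in_B_inf f, where K = 1])
        (use jt_coord_upper_2[of "\<lambda>n. t @ [n]"] in \<open>auto simp: inj_on_def\<close>)
    then have "(\<lambda>n. (f (jt_coord (t @ [n])))\<^sup>2) \<longlonglongrightarrow> 0"
      by (rule summable_LIMSEQ_zero)
    then have "(\<lambda>n. f (jt_coord (t @ [n]))) \<longlonglongrightarrow> 0"
      by simp
    then have "(\<lambda>n. f x + f (jt_coord (t @ [n]))) \<longlonglongrightarrow> f x + 0"
      by (intro tendsto_intros)
    moreover have "f (path_functional (t @ [n])) = f x + f (jt_coord (t @ [n]))" for n
      using f path_functional_in_B_inf jt_coord_in_B_inf
      by (simp add: t path_functional_append dual_on_def)
    ultimately show "(\<lambda>n. f (path_functional (t @ [n]))) \<longlonglongrightarrow> f x"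
      by simp
  qed
  then obtain n where "path_functional (t @ [n]) \<in> W"
    by (auto simp: eventually_sequentially)
  then have "path_functional (t @ [n]) \<in> U"
    by (simp add: W C_def)
  then have "dist x (path_functional (t @ [n])) < 1/2"
    using U(3) by auto
  then show False
    using path_functional_separated[of t "t @ [n]"] by (simp add: t)
qed

section \<open>Gliding humps and the absence of l1\<close>

text \<open>A diagonal argument makes the values converge at the countably many unit vectors, hence
  at all finitely supported vectors; these are dense in \<open>JT\<close>, and the common bound
  \<open>M\<close> extends the convergence to all of it.\<close>

lemma pointwise_convergent_subsequence:
  fixes e :: "nat \<Rightarrow> jt_inf \<Rightarrow>\<^sub>L real"
  assumes bound: "\<And>n. norm (e n) \<le> M"
  obtains r z where "strict_mono (r :: nat \<Rightarrow> nat)" "\<And>x. (\<lambda>n. e (r n) x) \<longlonglongrightarrow> blinfun_apply z x"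
proof -
  have "norm (e n (jt_unit t)) \<le> M" for n t
  proof -
    have "norm (e n (jt_unit t)) \<le> norm (e n) * norm (jt_unit t)"
      by (rule norm_blinfun)
    also have "\<dots> \<le> norm (e n) * 1"
      by (intro mult_left_mono norm_jt_unit_le) auto
    finally show ?thesis
      using bound[of n] by simp
  qed
  then have *: "norm (e n (jt_unit t)) \<le> M" if "t \<in> UNIV" for n t
    by simp
  obtain r where r: "strict_mono (r :: nat \<Rightarrow> nat)"
    and conv: "\<And>t. t \<in> UNIV \<Longrightarrow> \<exists>l. (\<lambda>n. e (r n) (jt_unit t)) \<longlonglongrightarrow> l"
    by (rule function_convergent_subsequence[of UNIV "\<lambda>n t. e n (jt_unit t)" M, OF countableI_type *], assumption) (rule that)
  have M: "0 \<le> M"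
    using order_trans[OF norm_ge_zero bound] .
  have app: "\<bar>e n x\<bar> \<le> M * norm x" for n x
    by (meson bound mult_right_mono norm_blinfun_le norm_ge_zero order_trans)
  have "Cauchy (\<lambda>n. e (r n) x)" for x
  proof (rule metric_CauchyI)
    fix \<epsilon> :: real assume \<epsilon>: "\<epsilon> > 0"
    then have "\<epsilon> / (3 * (M + 1)) > 0"
      using M by simp
    then obtain k where k: "dist (jcut (tbox k) x) x < \<epsilon> / (3 * (M + 1))"
      using cut_box_tendsto[of x] unfolding lim_sequentially by blast
    define w where "w = jcut (tbox k) x"
    have close: "\<bar>e n x - e n w\<bar> < \<epsilon> / 3" for n
    proof -
      have "\<bar>e n x - e n w\<bar> \<le> M * norm (x - w)"
        using app[of n "x - w"] by (simp add: blinfun.diff_right)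
      also have "\<dots> \<le> (M + 1) * norm (x - w)"
        by (intro mult_right_mono) auto
      also have "\<dots> < (M + 1) * (\<epsilon> / (3 * (M + 1)))"
        using k M by (intro mult_strict_left_mono) (auto simp: w_def dist_norm norm_minus_commute)
      also have "(M + 1) * (\<epsilon> / (3 * (M + 1))) = \<epsilon> / 3"
        using M by (simp add: divide_simps)
      finally show ?thesis .
    qed
    have w: "w = (\<Sum>t\<in>tbox k. jt_fun w t *\<^sub>R jt_unit t)"
      unfolding w_def by (rule sum_jt_unit[symmetric]) (auto simp: finite_box)
    obtain l where "\<And>t. (\<lambda>n. e (r n) (jt_unit t)) \<longlonglongrightarrow> l t"
      using conv[OF UNIV_I] by metis
    then have "(\<lambda>n. \<Sum>t\<in>tbox k. jt_fun w t * e (r n) (jt_unit t)) \<longlonglongrightarrow> (\<Sum>t\<in>tbox k. jt_fun w t * l t)"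
      by (intro tendsto_intros)
    moreover have "(\<Sum>t\<in>tbox k. jt_fun w t * e (r n) (jt_unit t)) = e (r n) w" for n
      by (subst (2) w) (simp add: blinfun.sum_right blinfun.scaleR_right)
    ultimately have "Cauchy (\<lambda>n. e (r n) w)"
      by (simp add: convergentI convergent_Cauchy)
    then obtain N where N: "\<forall>m\<ge>N. \<forall>n\<ge>N. dist (e (r m) w) (e (r n) w) < \<epsilon> / 3"
      using \<epsilon> by (meson metric_CauchyD zero_less_divide_iff zero_less_numeral)
    have "dist (e (r m) x) (e (r n) x) < \<epsilon>" if "m \<ge> N" "n \<ge> N" for m n
      using N[rule_format, OF that] close[of "r m"] close[of "r n"] unfolding dist_real_def by linarith
    then show "\<exists>N. \<forall>m\<ge>N. \<forall>n\<ge>N. dist (e (r m) x) (e (r n) x) < \<epsilon>"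
      by blast
  qed
  then have "\<exists>l. (\<lambda>n. e (r n) x) \<longlonglongrightarrow> l" for x
    by (simp add: Cauchy_convergent_iff convergent_def)
  then obtain g where g: "\<And>x. (\<lambda>n. e (r n) x) \<longlonglongrightarrow> g x"
    by metis
  have "bounded_linear g"
  proof (rule bounded_linear_intro[of _ M])
    show "g (x + y) = g x + g y" for x y
      using tendsto_add[OF g[of x] g[of y]] g[of "x + y"]
      by (intro LIMSEQ_unique) (auto simp: blinfun.add_right)
    show "g (a *\<^sub>R x) = a *\<^sub>R g x" for a x
      using tendsto_scaleR[OF tendsto_const g[of x], of a] g[of "a *\<^sub>R x"]
      by (intro LIMSEQ_unique) (auto simp: blinfun.scaleR_right)
    show "norm (g x) \<le> norm x * M" for x
      by (rule Lim_bounded[OF tendsto_norm[OF g], of 0]) (use app in \<open>auto simp: mult.commute\<close>)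
  qed
  then have "blinfun_apply (Blinfun g) = g"
    by (rule bounded_linear_Blinfun_apply)
  then show thesis
    using that[OF r, of "Blinfun g"] g by simp
qed

lemma fcut_finite_tendsto:
  assumes "\<And>x. (\<lambda>n. blinfun_apply (e n) x) \<longlonglongrightarrow> blinfun_apply z x" "order_convex D" "finite D"
  shows "(\<lambda>n. fcut (e n) D) \<longlonglongrightarrow> fcut z D"
  unfolding fcut_finite[OF assms(2,3)] by (intro tendsto_intros assms(1))

text \<open>The function \<^term>\<open>h\<close> prescribes the gaps between consecutive shells.\<close>

lemma gliding_hump:
  fixes e :: "nat \<Rightarrow> jt_inf \<Rightarrow>\<^sub>L real"
  assumes B: "\<And>n. e n \<in> B_inf" and lim: "\<And>x. (\<lambda>n. e n x) \<longlonglongrightarrow> blinfun_apply z x"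
    and h: "\<And>q. q \<le> h q" and \<eta>: "0 < \<eta>"
  obtains i q :: "nat \<Rightarrow> nat" where "strict_mono i" "strict_mono q" "q 0 = 0"
    "\<And>n. h (q n) < q (Suc n)"
    "\<And>n. norm (e (i n) - fcut z (tbox (h (q n)))
      - fcut (e (i n)) (tbox (q (Suc n)) - tbox (h (q n)))) \<le> \<eta> / 2 ^ n"
proof -
  \<comment> \<open>\<open>R n p (i, q')\<close> describes stage \<open>n\<close>: up to
    \<open>\<eta> / 2 ^ n\<close>, the functional \<open>e i\<close> agrees with \<open>z\<close> on
    the inner box, with itself on the next shell, and vanishes beyond.\<close>
  define R where "R n p = (\<lambda>(i, q'). h p < q' \<and>
    norm (e i - fcut z (tbox (h p)) - fcut (e i) (tbox q' - tbox (h p))) \<le> \<eta> / 2 ^ n)"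
    for n p :: nat
  have ex: "\<exists>i q'. i0 < i \<and> R n p (i, q')" for n p i0
  proof -
    have pos: "0 < \<eta> / 2 ^ n / 2"
      using \<eta> by simp
    \<comment> \<open>A late index makes the cut to the inner box close to that of \<open>z\<close>;
      only then is the outer box chosen, so large that it catches this functional up to a small
      tail.\<close>
    obtain N where "\<forall>i\<ge>N. dist (fcut (e i) (tbox (h p))) (fcut z (tbox (h p))) < \<eta> / 2 ^ n / 2"
      using fcut_finite_tendsto[OF lim order_convex_box finite_box] pos unfolding lim_sequentially by blast
    then have 1: "norm (fcut (e (max N (Suc i0))) (tbox (h p)) - fcut z (tbox (h p))) < \<eta> / 2 ^ n / 2"
      by (simp add: dist_norm)
    define i where "i = max N (Suc i0)"
    obtain k where k: "\<forall>n'\<ge>k. norm (fcut (e i) (- tbox n')) < \<eta> / 2 ^ n / 2"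
      using B_inf_tail[OF B pos] by blast
    define q' where "q' = max k (Suc (h p))"
    have 2: "norm (fcut (e i) (- tbox q')) < \<eta> / 2 ^ n / 2"
      using k by (simp add: q'_def)
    have sub: "tbox (h p) \<subseteq> tbox q'"
      by (rule box_mono) (simp add: q'_def)
    have "x = jcut (tbox (h p)) x + jcut (tbox q' - tbox (h p)) x + jcut (- tbox q') x" for x
      using sub by (intro jt_eqI) (auto simp: jt_fun_simps)
    then have split: "e i = fcut (e i) (tbox (h p)) + fcut (e i) (tbox q' - tbox (h p)) + fcut (e i) (- tbox q')"
      by (intro blinfun_eqI) (simp add: blinfun.add_left fcut_apply flip: blinfun.add_right)
    have "e i - fcut z (tbox (h p)) - fcut (e i) (tbox q' - tbox (h p))
        = (fcut (e i) (tbox (h p)) - fcut z (tbox (h p))) + fcut (e i) (- tbox q')"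
      by (subst (1) split) (simp add: algebra_simps)
    then have "norm (e i - fcut z (tbox (h p)) - fcut (e i) (tbox q' - tbox (h p)))
        \<le> norm (fcut (e i) (tbox (h p)) - fcut z (tbox (h p))) + norm (fcut (e i) (- tbox q'))"
      by (simp only: norm_triangle_ineq)
    also have "\<dots> \<le> \<eta> / 2 ^ n"
      using 1[folded i_def] 2 by linarith
    finally have "norm (e i - fcut z (tbox (h p)) - fcut (e i) (tbox q' - tbox (h p))) \<le> \<eta> / 2 ^ n" .
    moreover have "h p < q'" "i0 < i"
      by (simp_all add: q'_def i_def)
    ultimately have "i0 < i \<and> R n p (i, q')"
      by (simp add: R_def)
    then show ?thesis
      by blast
  qed
  \<comment> \<open>The predicate only pins down the first stage, which has to start at
    \<open>p = 0\<close>; the relation between consecutive stages does the rest.\<close>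
  define P where "P n s \<longleftrightarrow> (n = 0 \<longrightarrow> R 0 0 s)" for n :: nat and s
  have "\<exists>f. \<forall>n. P n (f n) \<and> (R (Suc n) (snd (f n)) (f (Suc n)) \<and> fst (f n) < fst (f (Suc n)))"
  proof (rule dependent_nat_choice)
    show "\<exists>s. P 0 s"
      using ex unfolding P_def by blast
    show "\<exists>s'. P (Suc n) s' \<and> R (Suc n) (snd s) s' \<and> fst s < fst s'" for s n
      using ex[of "fst s" "Suc n" "snd s"] by (auto simp: P_def)
  qed
  then obtain f where f: "P 0 (f 0)" "\<And>n. R (Suc n) (snd (f n)) (f (Suc n))"
    "\<And>n. fst (f n) < fst (f (Suc n))"
    by blast
  define q where "q n = (case n of 0 \<Rightarrow> 0 | Suc m \<Rightarrow> snd (f m))" for n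
  define i where "i n = fst (f n)" for n
  have R: "R n (q n) (i n, q (Suc n))" for n
    using f(1,2) by (cases n) (auto simp: P_def q_def i_def)
  show thesis
  proof (rule that)
    show "strict_mono i"
      using f(3) by (simp add: strict_mono_Suc_iff i_def)
    show "q 0 = 0"
      by (simp add: q_def)
    show "h (q n) < q (Suc n)" for n
      using R[of n] by (simp add: R_def)
    then show "strict_mono q"
      using h by (meson strict_mono_Suc_iff order_le_less_trans)
    show "norm (e (i n) - fcut z (tbox (h (q n)))
      - fcut (e (i n)) (tbox (q (Suc n)) - tbox (h (q n)))) \<le> \<eta> / 2 ^ n" for n
      using R[of n] by (simp add: R_def)
  qed
qed

lemma disjoint_shells:
  assumes "strict_mono q"
  shows "disjoint_family (\<lambda>n. tbox (q (Suc n)) - tbox (q n))"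
  unfolding disjoint_family_on_def
proof safe
  fix m n t
  assume *: "m \<noteq> n" "t \<in> tbox (q (Suc m))" "t \<notin> tbox (q m)" "t \<in> tbox (q (Suc n))" "t \<notin> tbox (q n)"
  have "q (Suc m) \<le> q n" if "m < n" for m n
    using that assms by (simp add: Suc_leI strict_mono_less_eq)
  then show "t \<in> {}"
    using * box_mono by (metis linorder_neqE_nat subsetD)
qed

lemma sum_even_odd: "(\<Sum>k<2 * N. f k) = (\<Sum>j<N. f (2 * j) + f (Suc (2 * j)))"
  for f :: "nat \<Rightarrow> 'a::comm_monoid_add"
  by (induction N) (auto simp: add.assoc)

lemma sum_half_powers_le: "(\<Sum>n<N. \<eta> / 2 ^ n) \<le> 2 * \<eta>" if "0 \<le> \<eta>" for \<eta> :: real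
proof -
  have "(\<Sum>n<N. \<eta> / 2 ^ n) = 2 * \<eta> - 2 * (\<eta> / 2 ^ N)"
    by (induction N) auto
  also have "\<dots> \<le> 2 * \<eta>"
    using that by simp
  finally show ?thesis
    by simp
qed

lemma ell1_isomorphism_sum:
  fixes T :: "(nat \<Rightarrow> real) \<Rightarrow> 'a::real_normed_vector"
  assumes add: "\<forall>a\<in>ell1. \<forall>b\<in>ell1. T (\<lambda>n. a n + b n) = T a + T b"
    and scale: "\<forall>c. \<forall>a\<in>ell1. T (\<lambda>n. c * a n) = c *\<^sub>R T a"
    and x: "\<And>k. x k \<in> ell1" and "finite I"
  shows "(\<lambda>n. \<Sum>k\<in>I. c k * x k n) \<in> ell1 \<and> T (\<lambda>n. \<Sum>k\<in>I. c k * x k n) = (\<Sum>k\<in>I. c k *\<^sub>R T (x k))"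
  using \<open>finite I\<close>
proof induction
  case empty
  have z: "(\<lambda>_. 0) \<in> ell1"
    by (simp add: ell1_def)
  show ?case
    using z scale[rule_format, OF z, of 0] by simp
next
  case (insert i I)
  have s: "(\<lambda>n. c i * x i n) \<in> ell1"
    using x[of i] by (auto simp: ell1_def abs_mult intro: summable_mult)
  have "(\<lambda>n. c i * x i n + (\<Sum>k\<in>I. c k * x k n)) \<in> ell1"
    unfolding ell1_def mem_Collect_eq
  proof (rule summable_comparison_test)
    show "\<exists>N. \<forall>n\<ge>N. norm \<bar>c i * x i n + (\<Sum>k\<in>I. c k * x k n)\<bar>
        \<le> \<bar>c i * x i n\<bar> + \<bar>\<Sum>k\<in>I. c k * x k n\<bar>"
      by auto
    show "summable (\<lambda>n. \<bar>c i * x i n\<bar> + \<bar>\<Sum>k\<in>I. c k * x k n\<bar>)"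
      using s insert.IH by (intro summable_add) (auto simp: ell1_def)
  qed
  moreover have "T (\<lambda>n. c i * x i n + (\<Sum>k\<in>I. c k * x k n)) = c i *\<^sub>R T (x i) + (\<Sum>k\<in>I. c k *\<^sub>R T (x k))"
    using add s insert.IH scale x by auto
  ultimately show ?case
    using insert.hyps by simp
qed

text \<open>The pointwise limit \<open>z\<close> need not vanish, and the parts
  \<open>fcut z (tbox (q n))\<close> do not live on disjoint sets. Alternating signs turn
  consecutive ones into differences on disjoint shells, so that alternating sums of
  \<open>2 * N\<close> terms grow like \<open>sqrt N\<close>, whereas \<open>ell1\<close> demands
  linear growth.\<close>

theorem B_inf_no_ell1: "\<not> contains_ell1 B_inf"
proof
  assume "contains_ell1 B_inf"
  then obtain Z T C C' where Z: "Z \<subseteq> B_inf" "bij_betw T ell1 Z"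
    and add: "\<forall>a\<in>ell1. \<forall>b\<in>ell1. T (\<lambda>n. a n + b n) = T a + T b"
    and scale: "\<forall>c. \<forall>a\<in>ell1. T (\<lambda>n. c * a n) = c *\<^sub>R T a"
    and C: "\<forall>a\<in>ell1. norm (T a) \<le> C * ell1_norm a"
    and C': "\<forall>a\<in>ell1. ell1_norm a \<le> C' * norm (T a)"
    unfolding contains_ell1_def isomorphic_to_ell1_def by blast
  define \<delta> where "\<delta> k = (\<lambda>n. if n = k then 1 else 0 :: real)" for k :: nat
  have abs_\<delta>: "(\<lambda>n. \<bar>\<delta> k n\<bar>) = (\<lambda>n. if n = k then 1 else 0)" for k
    by (auto simp: \<delta>_def)
  have \<delta>: "\<delta> k \<in> ell1" "ell1_norm (\<delta> k) = 1" for k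
    using sums_single[of k "\<lambda>_. 1 :: real"] unfolding ell1_def ell1_norm_def mem_Collect_eq abs_\<delta>
    by (auto simp: sums_iff)
  define e where "e k = T (\<delta> k)" for k
  have eB: "e k \<in> B_inf" for k
    using Z \<delta> by (auto simp: e_def bij_betw_def)
  have eC: "norm (e k) \<le> C" for k
    using C \<delta>[of k] by (force simp: e_def)
  have C0: "0 \<le> C"
    using order_trans[OF norm_ge_zero eC] .
  obtain r z where r: "strict_mono (r :: nat \<Rightarrow> nat)" and z: "\<And>x. (\<lambda>n. e (r n) x) \<longlonglongrightarrow> blinfun_apply z x"
    by (rule pointwise_convergent_subsequence[of e C, OF eC]) (rule that)
  obtain i q where i: "strict_mono (i :: nat \<Rightarrow> nat)" and q: "strict_mono q" "q 0 = 0"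
    and err: "\<And>n. norm (e (r (i n)) - fcut z (tbox (q n))
      - fcut (e (r (i n))) (tbox (q (Suc n)) - tbox (q n))) \<le> 1 / 2 ^ n"
    by (rule gliding_hump[of "\<lambda>n. e (r n)", OF eB z order_refl zero_less_one]) (rule that)
  define u where "u n = e (r (i n))" for n
  define D where "D n = tbox (q (Suc n)) - tbox (q n)" for n
  define \<rho> where "\<rho> n = u n - fcut z (tbox (q n)) - fcut (u n) (D n)" for n
  have \<rho>: "norm (\<rho> n) \<le> 1 / 2 ^ n" for n
    using err by (simp add: \<rho>_def u_def D_def)
  have Dcx: "order_convex (D n)" for n
    by (simp add: D_def)
  have Ddis: "disjoint_family D"
    using disjoint_shells[OF q(1)] by (simp add: D_def[abs_def])
  define \<sigma> where "\<sigma> k = (if even k then - 1 else 1 :: real)" for k :: nat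
  have upper: "norm (\<Sum>k<2 * N. \<sigma> k *\<^sub>R u k) \<le> norm z * sqrt N + C * sqrt (2 * N) + 2" for N
  proof -
    have "fcut z (tbox (q (Suc n))) - fcut z (tbox (q n)) = fcut z (D n)" for n
    proof (rule blinfun_eqI)
      fix x
      have "tbox (q n) \<subseteq> tbox (q (Suc n))"
        using q by (intro box_mono) (simp add: strict_mono_less_eq)
      then have "jcut (tbox (q (Suc n))) x = jcut (tbox (q n)) x + jcut (D n) x"
        by (intro jt_eqI) (auto simp: D_def jt_fun_simps)
      then show "(fcut z (tbox (q (Suc n))) - fcut z (tbox (q n))) x = fcut z (D n) x"
        using Dcx by (simp add: blinfun.diff_left fcut_apply blinfun.add_right)
    qed
    then have 1: "(\<Sum>k<2 * N. \<sigma> k *\<^sub>R fcut z (tbox (q k))) = (\<Sum>j<N. fcut z (D (2 * j)))"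
      by (simp add: sum_even_odd \<sigma>_def)
    have "inj_on (\<lambda>j::nat. 2 * j) UNIV"
      by (auto simp: inj_on_def)
    then have "norm (\<Sum>j<N. fcut z (D (2 * j))) \<le> L2_set (\<lambda>j. norm z) {..<N}"
      using Ddis Dcx by (intro fcut_upper_2) (auto simp: disjoint_family_on_def)
    then have 2: "norm (\<Sum>j<N. fcut z (D (2 * j))) \<le> norm z * sqrt N"
      by (simp add: L2_set_def real_sqrt_mult mult.commute)
    have "(\<Sum>k<2 * N. \<sigma> k *\<^sub>R fcut (u k) (D k)) = (\<Sum>k<2 * N. fcut (\<sigma> k *\<^sub>R u k) (D k))"
      using Dcx by (intro sum.cong refl blinfun_eqI) (simp add: fcut_apply blinfun.scaleR_left)
    also have "norm \<dots> \<le> L2_set (\<lambda>k. norm (\<sigma> k *\<^sub>R u k)) {..<2 * N}"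
      using Ddis Dcx by (intro fcut_upper_2) (auto simp: disjoint_family_on_def)
    also have "\<dots> \<le> L2_set (\<lambda>k. C) {..<2 * N}"
      using eC by (intro L2_set_mono) (auto simp: \<sigma>_def u_def)
    also have "\<dots> = C * sqrt (2 * N)"
      using C0 by (simp add: L2_set_def real_sqrt_mult mult.commute)
    finally have 3: "norm (\<Sum>k<2 * N. \<sigma> k *\<^sub>R fcut (u k) (D k)) \<le> C * sqrt (2 * N)" .
    have "norm (\<Sum>k<2 * N. \<sigma> k *\<^sub>R \<rho> k) \<le> (\<Sum>k<2 * N. 1 / 2 ^ k)"
      by (rule order_trans[OF norm_sum]) (use \<rho> in \<open>auto intro!: sum_mono simp: \<sigma>_def\<close>)
    also have "\<dots> \<le> 2"
      using sum_half_powers_le[of 1] by simp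
    finally have 4: "norm (\<Sum>k<2 * N. \<sigma> k *\<^sub>R \<rho> k) \<le> 2" .
    have "(\<Sum>k<2 * N. \<sigma> k *\<^sub>R u k) = (\<Sum>j<N. fcut z (D (2 * j)))
        + (\<Sum>k<2 * N. \<sigma> k *\<^sub>R fcut (u k) (D k)) + (\<Sum>k<2 * N. \<sigma> k *\<^sub>R \<rho> k)"
      unfolding 1[symmetric] sum.distrib[symmetric]
      by (intro sum.cong refl) (simp add: \<rho>_def algebra_simps)
    also have "norm \<dots> \<le> norm (\<Sum>j<N. fcut z (D (2 * j)))
        + norm (\<Sum>k<2 * N. \<sigma> k *\<^sub>R fcut (u k) (D k)) + norm (\<Sum>k<2 * N. \<sigma> k *\<^sub>R \<rho> k)"
      by (meson add_right_mono norm_triangle_ineq order_trans)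
    finally show ?thesis
      using 2 3 4 by linarith
  qed
  have lower: "2 * N \<le> C' * norm (\<Sum>k<2 * N. \<sigma> k *\<^sub>R u k)" for N :: nat
  proof -
    let ?x = "\<lambda>k. \<delta> (r (i k))"
    let ?a = "\<lambda>n. \<Sum>k<2 * N. \<sigma> k * ?x k n"
    have a: "?a \<in> ell1" "T ?a = (\<Sum>k<2 * N. \<sigma> k *\<^sub>R u k)"
      unfolding u_def e_def
      using ell1_isomorphism_sum[OF add scale \<delta>(1) finite_lessThan, of \<sigma> "\<lambda>k. r (i k)" "2 * N"] by blast+
    have inj: "inj (\<lambda>k. r (i k))"
      using inj_compose[OF strict_mono_imp_inj_on[OF r] strict_mono_imp_inj_on[OF i]] by (simp add: o_def)
    have val: "\<bar>?a (r (i k))\<bar> = 1" if "k < 2 * N" for k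
    proof -
      have "?a (r (i k)) = (\<Sum>k'<2 * N. if k' = k then \<sigma> k' else 0)"
        using inj by (intro sum.cong refl) (auto simp: \<delta>_def inj_def)
      then show ?thesis
        using that by (simp add: \<sigma>_def)
    qed
    have "real (2 * N) = (\<Sum>k<2 * N. \<bar>?a (r (i k))\<bar>)"
      using val by simp
    also have "\<dots> = (\<Sum>n\<in>(\<lambda>k. r (i k)) ` {..<2 * N}. \<bar>?a n\<bar>)"
      using inj by (subst sum.reindex) (auto simp: inj_def inj_on_def)
    also have "\<dots> \<le> ell1_norm ?a"
      unfolding ell1_norm_def using a(1) by (intro sum_le_suminf) (auto simp: ell1_def)
    also have "\<dots> \<le> C' * norm (T ?a)"
      using C' a(1) by blast
    finally show ?thesis
      by (simp add: a(2))
  qed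
  define K where "K = \<bar>C'\<bar> * (norm z + C * 2 + 2)"
  have "2 * N \<le> K * sqrt N" if "N \<ge> 1" for N :: nat
  proof -
    have "1 \<le> sqrt N"
      using that by simp
    then have "norm (\<Sum>k<2 * N. \<sigma> k *\<^sub>R u k) \<le> norm z * sqrt N + C * (2 * sqrt N) + 2 * sqrt N"
    proof -
      have "sqrt (2 * N) \<le> sqrt (4 * N)"
        by simp
      also have "\<dots> = 2 * sqrt N"
        by (simp add: real_sqrt_mult)
      finally have "C * sqrt (2 * N) \<le> C * (2 * sqrt N)"
        using C0 by (rule mult_left_mono)
      then show ?thesis
        using upper[of N] \<open>1 \<le> sqrt N\<close> by linarith
    qed
    then have "\<bar>C'\<bar> * norm (\<Sum>k<2 * N. \<sigma> k *\<^sub>R u k) \<le> \<bar>C'\<bar> * (norm z * sqrt N + C * (2 * sqrt N) + 2 * sqrt N)"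
      by (intro mult_left_mono) auto
    moreover have "C' * norm (\<Sum>k<2 * N. \<sigma> k *\<^sub>R u k) \<le> \<bar>C'\<bar> * norm (\<Sum>k<2 * N. \<sigma> k *\<^sub>R u k)"
      by (intro mult_right_mono) auto
    ultimately show ?thesis
      using lower[of N] by (simp add: K_def algebra_simps)
  qed
  moreover obtain N :: nat where N': "K\<^sup>2 + 1 \<le> N"
    using real_arch_simple by blast
  moreover have N: "N \<ge> 1" "sqrt N > \<bar>K\<bar>"
  proof -
    have "1 \<le> real N"
      using N' zero_le_power2[of K] by linarith
    then show "N \<ge> 1"
      by simp
    show "sqrt N > \<bar>K\<bar>"
      using N' by (intro real_less_rsqrt) simp
  qed
  ultimately have "2 * N \<le> K * sqrt N"
    by blast
  also have "\<dots> \<le> \<bar>K\<bar> * sqrt N"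
    by (intro mult_right_mono) auto
  also have "\<dots> \<le> sqrt N * sqrt N"
    using N by (intro mult_right_mono) auto
  also have "\<dots> = N"
    by simp
  finally show False
    using N by simp
qed

section \<open>Vectors satisfying an upper 2-estimate\<close>

definition antichain :: "nat list set \<Rightarrow> bool" where
  "antichain Q \<longleftrightarrow> (\<forall>s\<in>Q. \<forall>t\<in>Q. prefix s t \<longrightarrow> s = t)"

lemma antichainI: "(\<And>s t. s \<in> Q \<Longrightarrow> t \<in> Q \<Longrightarrow> prefix s t \<Longrightarrow> s = t) \<Longrightarrow> antichain Q"
  by (simp add: antichain_def)

lemma antichainD: "antichain Q \<Longrightarrow> s \<in> Q \<Longrightarrow> t \<in> Q \<Longrightarrow> prefix s t \<Longrightarrow> s = t"
  by (simp add: antichain_def)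

text \<open>Take an antichain of largest cardinality in \<open>G\<close>. A node of \<open>G\<close>
  outside a box around \<open>R\<close> that extended no node of \<open>R\<close> could be added to
  it, and two incomparable nodes of \<open>G\<close> above some \<open>r\<close> could replace
  \<open>r\<close>. Hence, outside a finite box, \<open>G\<close> consists of finitely many
  chains.\<close>

lemma maximal_antichain:
  assumes bound: "\<And>Q. Q \<subseteq> G \<Longrightarrow> finite Q \<Longrightarrow> antichain Q \<Longrightarrow> card Q \<le> L"
  obtains R where "R \<subseteq> G" "finite R" "antichain R"
    "\<And>k t. R \<subseteq> tbox k \<Longrightarrow> t \<in> G - tbox k \<Longrightarrow> \<exists>r\<in>R. prefix r t"
    "\<And>r s t. r \<in> R \<Longrightarrow> s \<in> G \<Longrightarrow> t \<in> G \<Longrightarrow> prefix r s \<Longrightarrow> prefix r t \<Longrightarrow> prefix s t \<or> prefix t s"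
proof -
  let ?P = "\<lambda>n. \<exists>Q. Q \<subseteq> G \<and> finite Q \<and> antichain Q \<and> card Q = n"
  have "?P 0"
    by (rule exI[of _ "{}"]) (simp add: antichain_def)
  moreover have "\<forall>n. ?P n \<longrightarrow> n \<le> L"
    using bound by blast
  ultimately obtain n where n: "?P n" "\<forall>m. ?P m \<longrightarrow> m \<le> n"
    using Nat.ex_has_greatest_nat[of ?P 0 L] by blast
  then obtain R where R: "R \<subseteq> G" "finite R" "antichain R" "card R = n"
    by blast
  have max: "card Q \<le> card R" if "Q \<subseteq> G" "finite Q" "antichain Q" for Q
    using n(2) R(4) that by blast
  show thesis
  proof (rule that[OF R(1,2,3)])
    fix k t assume k: "R \<subseteq> tbox k" and t: "t \<in> G - tbox k"
    show "\<exists>r\<in>R. prefix r t"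
    proof (rule ccontr)
      assume no: "\<not> ?thesis"
      have "\<not> prefix t r" if "r \<in> R" for r
        using prefix_box[of t r k] k t that by blast
      with no have "antichain (insert t R)"
        using antichainD[OF R(3)] by (intro antichainI) (metis insert_iff)
      then have "card (insert t R) \<le> card R"
        using R(1,2) t by (intro max) auto
      moreover have "t \<notin> R"
        using k t by blast
      ultimately show False
        using R(2) by simp
    qed
  next
    fix r s t assume r: "r \<in> R" and st: "s \<in> G" "t \<in> G" "prefix r s" "prefix r t"
    show "prefix s t \<or> prefix t s"
    proof (rule ccontr)
      assume no: "\<not> ?thesis"
      have new: "\<not> prefix r' v \<and> \<not> prefix v r'" if "r' \<in> R - {r}" "prefix r v" for r' v
      proof -
        have "\<not> prefix r r'" "\<not> prefix r' r"
          using antichainD[OF R(3)] r that(1) by (metis Diff_iff insertI1)+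
        then show ?thesis
          using that(2) prefix_same_cases[of r' v r] prefix_order.trans[of r v r'] by blast
      qed
      have "antichain (insert s (insert t (R - {r})))"
      proof (rule antichainI)
        fix a b assume ab: "a \<in> insert s (insert t (R - {r}))" "b \<in> insert s (insert t (R - {r}))" "prefix a b"
        show "a = b"
          using ab new[of a b] new[of b a] st(3,4) no antichainD[OF R(3), of a b] by (metis Diff_iff insert_iff)
      qed
      moreover have "insert s (insert t (R - {r})) \<subseteq> G" "finite (insert s (insert t (R - {r})))"
        using R(1,2) st(1,2) by auto
      ultimately have "card (insert s (insert t (R - {r}))) \<le> card R"
        by (intro max)
      moreover have "s \<notin> R - {r}" "t \<notin> R - {r}"
        using new st(3,4) prefix_order.refl by metis+
      moreover have "s \<noteq> t"
        using no by auto
      ultimately show False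
        using R(2) r card_Suc_Diff1[OF R(2) r] by simp
    qed
  qed
qed

lemma L2_norm_cone_le:
  assumes "finite Q" "antichain Q"
  shows "L2_set (\<lambda>r. norm (jcut (tcone r) x)) Q \<le> norm x"
proof (rule L2_norm_cut_le[OF assms(1)])
  show "disjoint_family_on tcone Q"
    unfolding disjoint_family_on_def
  proof (intro ballI impI)
    fix r s assume rs: "r \<in> Q" "s \<in> Q" "r \<noteq> s"
    then have "\<not> prefix r s" "\<not> prefix s r"
      using antichainD[OF assms(2)] by metis+
    then show "tcone r \<inter> tcone s = {}"
      unfolding tcone_def using prefix_same_cases[of r _ s] by blast
  qed
qed simp

text \<open>Cones over an antichain are disjoint, so the lower 2-estimate bounds the sum of the
  squared masses by 1, and this survives the passage to the limit \<open>\<mu>\<close>.\<close>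

lemma card_antichain_le:
  fixes \<mu> :: "nat list \<Rightarrow> real"
  assumes x: "\<And>n. norm (x n) \<le> 1" and \<mu>: "\<And>r. (\<lambda>n. norm (jcut (tcone r) (x n))) \<longlonglongrightarrow> \<mu> r"
    and Q: "finite Q" "antichain Q" "\<And>r. r \<in> Q \<Longrightarrow> \<epsilon> \<le> \<mu> r" and \<epsilon>: "0 < \<epsilon>"
  shows "real (card Q) \<le> 1 / \<epsilon>\<^sup>2"
proof -
  have "(\<Sum>r\<in>Q. (norm (jcut (tcone r) (x n)))\<^sup>2) \<le> 1" for n
  proof -
    have "(L2_set (\<lambda>r. norm (jcut (tcone r) (x n))) Q)\<^sup>2 \<le> 1\<^sup>2"
      by (intro power_mono order_trans[OF L2_norm_cone_le[OF Q(1,2)] x]) auto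
    then show ?thesis
      by (simp add: L2_set_def sum_nonneg)
  qed
  moreover have "(\<lambda>n. \<Sum>r\<in>Q. (norm (jcut (tcone r) (x n)))\<^sup>2) \<longlonglongrightarrow> (\<Sum>r\<in>Q. (\<mu> r)\<^sup>2)"
    by (intro tendsto_intros \<mu>)
  ultimately have "(\<Sum>r\<in>Q. (\<mu> r)\<^sup>2) \<le> 1"
    by (intro Lim_bounded[where M = 0]) auto
  moreover have "(\<Sum>r\<in>Q. \<epsilon>\<^sup>2) \<le> (\<Sum>r\<in>Q. (\<mu> r)\<^sup>2)"
    using Q(3) \<epsilon> by (intro sum_mono power_mono) auto
  ultimately show ?thesis
    using \<epsilon> by (simp add: field_simps)
qed

lemma sum_eq_on_support:
  fixes f :: "'a \<Rightarrow> real"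
  assumes "finite A" "finite B" "\<And>s. f s \<noteq> 0 \<Longrightarrow> s \<in> A \<longleftrightarrow> s \<in> B"
  shows "sum f A = sum f B"
proof -
  have "sum f A = sum f (A \<inter> B)"
    using assms by (intro sum.mono_neutral_right) auto
  also have "\<dots> = sum f B"
    using assms by (intro sum.mono_neutral_left) auto
  finally show ?thesis .
qed

lemma finite_prefixes_of: "finite {s. prefix s (t :: nat list)}"
  by (rule segments_finite[OF path_segment])

text \<open>A segment meets an antichain in at most one node, so each segment sum is a single
  coefficient or 0.\<close>

lemma norm_antichain_units_le:
  assumes t: "inj_on t I" "antichain (t ` I)" and I: "finite I"
  shows "norm (\<Sum>i\<in>I. a i *\<^sub>R jt_unit (t i)) \<le> L2_set a I"
  unfolding norm_jt_le_iff jt_bounded_L2_set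
proof
  fix F assume F: "F \<in> segment_families"
  have finF: "finite F" "F \<subseteq> segments" "pairwise disjnt F"
    using F by (auto simp: segment_families_def)
  have val: "sum (jt_fun (\<Sum>i\<in>I. a i *\<^sub>R jt_unit (t i))) S = (\<Sum>i\<in>{i\<in>I. t i \<in> S}. a i)" if S: "S \<in> F" for S
  proof -
    have "sum (jt_fun (\<Sum>i\<in>I. a i *\<^sub>R jt_unit (t i))) S = (\<Sum>s\<in>S. \<Sum>i\<in>I. a i * (if s = t i then 1 else 0))"
      by (simp add: jt_fun_sum jt_fun_scaleR jt_fun_unit)
    also have "\<dots> = (\<Sum>i\<in>I. \<Sum>s\<in>S. a i * (if s = t i then 1 else 0))"
      by (rule sum.swap)
    also have "\<dots> = (\<Sum>i\<in>I. if t i \<in> S then a i else 0)"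
      using S finF(2) segments_finite by (intro sum.cong refl) (auto simp: if_distrib sum.delta cong: if_cong)
    finally show ?thesis
      using I by (simp add: sum.inter_filter)
  qed
  have sq: "(\<Sum>i\<in>{i\<in>I. t i \<in> S}. a i)\<^sup>2 = (\<Sum>i\<in>{i\<in>I. t i \<in> S}. (a i)\<^sup>2)" if S: "S \<in> F" for S
  proof (cases "\<exists>i\<in>I. t i \<in> S")
    case True
    then obtain i where i: "i \<in> I" "t i \<in> S"
      by blast
    have "j = i" if j: "j \<in> I" "t j \<in> S" for j
    proof -
      obtain p u where "S = {t. prefix p t \<and> prefix t u}"
        using S finF(2) by (auto simp: segments_def)
      then have "prefix (t i) (t j) \<or> prefix (t j) (t i)"
        using i j prefix_same_cases by blast
      then show ?thesis
        using antichainD[OF t(2)] inj_onD[OF t(1)] i j by (metis imageI)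
    qed
    then have "{i\<in>I. t i \<in> S} = {i}"
      using i by blast
    then show ?thesis
      by simp
  next
    case False
    then have "{i\<in>I. t i \<in> S} = {}"
      by blast
    then show ?thesis
      by (simp only: sum.empty) simp
  qed
  have "(L2_set (sum (jt_fun (\<Sum>i\<in>I. a i *\<^sub>R jt_unit (t i)))) F)\<^sup>2 = (\<Sum>S\<in>F. \<Sum>i\<in>{i\<in>I. t i \<in> S}. (a i)\<^sup>2)"
    using val sq by (simp add: L2_set_def sum_nonneg)
  also have "\<dots> = (\<Sum>i\<in>(\<Union>S\<in>F. {i\<in>I. t i \<in> S}). (a i)\<^sup>2)"
    using finF I by (intro sum.UNION_disjoint[symmetric]) (auto simp: pairwise_def disjnt_def)
  also have "\<dots> \<le> (\<Sum>i\<in>I. (a i)\<^sup>2)"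
    using I by (intro sum_mono2) auto
  also have "\<dots> = (L2_set a I)\<^sup>2"
    by (simp add: L2_set_def sum_nonneg)
  finally show "L2_set (sum (jt_fun (\<Sum>i\<in>I. a i *\<^sub>R jt_unit (t i)))) F \<le> L2_set a I"
    by (rule power2_le_imp_le) simp
qed

text \<open>Every infinite subset of a chain is again an infinite chain; the condition therefore
  says that the coordinates of \<open>z\<close> tend to 0 along every branch. This formulation is
  the one that supplies nodes for the correction.\<close>

definition null_on_chains :: "(jt_inf \<Rightarrow>\<^sub>L real) \<Rightarrow> bool" where
  "null_on_chains z \<longleftrightarrow> (\<forall>C. infinite C \<longrightarrow> (\<forall>s\<in>C. \<forall>t\<in>C. prefix s t \<or> prefix t s) \<longrightarrow>
     (\<forall>\<eta>>0. \<exists>t\<in>C. \<bar>z (jt_unit t)\<bar> < \<eta>))"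

lemma null_on_chainsD:
  assumes "null_on_chains z" "infinite C" "\<And>s t. s \<in> C \<Longrightarrow> t \<in> C \<Longrightarrow> prefix s t \<or> prefix t s" "0 < \<eta>"
  shows "\<exists>t\<in>C. \<bar>z (jt_unit t)\<bar> < \<eta>"
  using assms unfolding null_on_chains_def by simp

text \<open>Induction adds a new least index \<open>l\<close>. If two exceptional indices
  \<open>i < k\<close> are already in use and \<open>a l\<close>, \<open>a i\<close> are nonzero,
  the hypothesis pays for \<open>a k\<close> with \<open>4 * \<epsilon> l\<close>, and
  \<open>l\<close> takes the place of \<open>k\<close>; if \<open>a i\<close> vanishes,
  \<open>l\<close> takes the place of \<open>i\<close>.\<close>

lemma sum_outside_two_le:
  fixes a \<epsilon> :: "nat \<Rightarrow> real"
  assumes "finite I" "\<And>l. 0 \<le> a l" "\<And>l. 0 \<le> \<epsilon> l"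
    and "\<And>l j k. l \<in> I \<Longrightarrow> j \<in> I \<Longrightarrow> k \<in> I \<Longrightarrow> l < j \<Longrightarrow> j < k \<Longrightarrow> a l \<noteq> 0 \<Longrightarrow> a j \<noteq> 0 \<Longrightarrow> a k \<le> 4 * \<epsilon> l"
  shows "\<exists>Q\<subseteq>I. card Q \<le> 2 \<and> (\<Sum>l\<in>I - Q. a l) \<le> 4 * (\<Sum>l\<in>I. \<epsilon> l)"
  using assms(1,4)
proof (induction I rule: finite_linorder_min_induct)
  case empty
  then show ?case
    by simp
next
  case (insert l I)
  have "\<exists>Q\<subseteq>I. card Q \<le> 2 \<and> (\<Sum>l\<in>I - Q. a l) \<le> 4 * (\<Sum>l\<in>I. \<epsilon> l)"
    by (rule insert.IH) (use insert.prems in blast)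
  then obtain Q where Q: "Q \<subseteq> I" "card Q \<le> 2" "(\<Sum>l\<in>I - Q. a l) \<le> 4 * (\<Sum>l\<in>I. \<epsilon> l)"
    by blast
  have l: "l \<notin> I" "finite Q" "l \<notin> Q"
    using insert.hyps Q(1) finite_subset by auto
  have tot: "(\<Sum>l\<in>insert l I. \<epsilon> l) = \<epsilon> l + (\<Sum>l\<in>I. \<epsilon> l)"
    using insert.hyps l by simp
  consider "a l = 0" | "card Q \<le> 1" | i k where "Q = {i, k}" "i < k" "a l \<noteq> 0"
  proof -
    have "card Q = 2 \<Longrightarrow> \<exists>i k. Q = {i, k} \<and> i < k"
      by (metis card_2_iff insert_commute linorder_neqE_nat)
    then show thesis
      using that Q(2) by (cases "card Q \<le> 1") (auto simp: le_Suc_eq numeral_2_eq_2)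
  qed
  then show ?case
  proof cases
    case 1
    have "insert l I - Q = insert l (I - Q)"
      using l by blast
    then have "(\<Sum>l\<in>insert l I - Q. a l) = (\<Sum>l\<in>I - Q. a l)"
      using 1 insert.hyps l by simp
    then show ?thesis
      using Q assms(3)[of l] tot by (intro exI[of _ Q]) auto
  next
    case 2
    have "insert l I - insert l Q = I - Q"
      using l by blast
    then show ?thesis
      using Q assms(3)[of l] tot 2 l by (intro exI[of _ "insert l Q"]) auto
  next
    case 3
    show ?thesis
    proof (cases "a i = 0")
      case True
      have "insert l I - {l, k} = insert i (I - Q)" "i \<notin> I - Q"
        using l 3 Q(1) by auto
      then have "(\<Sum>l\<in>insert l I - {l, k}. a l) = (\<Sum>l\<in>I - Q. a l)"
        using True insert.hyps by simp
      then show ?thesis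
        using Q assms(3)[of l] tot 3 card_insert_le_m1[of 2 "{k}" l]
        by (intro exI[of _ "{l, k}"]) (auto simp: card_insert_if)
    next
      case False
      have "insert l I - {l, i} = insert k (I - Q)" "k \<notin> I - Q"
        using l 3 Q(1) by auto
      then have "(\<Sum>l\<in>insert l I - {l, i}. a l) = a k + (\<Sum>l\<in>I - Q. a l)"
        using insert.hyps by simp
      moreover have "a k \<le> 4 * \<epsilon> l"
        using insert.prems[of l i k] insert.hyps Q(1) 3 False by auto
      ultimately show ?thesis
        using Q tot 3 by (intro exI[of _ "{l, i}"]) (auto simp: card_insert_if)
    qed
  qed
qed

text \<open>Disjoint segments meeting \<^term>\<open>tbox b\<close> number at most \<^term>\<open>card (tbox b)\<close>, so that errors of this size on
  each of them have a summable total.\<close>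

definition mesh :: "nat \<Rightarrow> real" where
  "mesh b = (1 / 2 ^ b) * (1 / (1 + real (card (tbox b))))"

lemma mesh_pos: "0 < mesh b"
  unfolding mesh_def by (intro mult_pos_pos divide_pos_pos add_pos_nonneg) auto

lemma mesh_antimono:
  assumes "b \<le> c"
  shows "mesh c \<le> mesh b"
proof -
  have "card (tbox b) \<le> card (tbox c)"
    by (intro card_mono finite_box box_mono assms)
  then show ?thesis
    unfolding mesh_def using assms by (intro mult_mono frac_le power_increasing) auto
qed

lemma mesh_card_le: "mesh b * card (tbox b) \<le> 1 / 2 ^ b"
proof -
  have "mesh b * card (tbox b) = (1 / 2 ^ b) * (card (tbox b) / (1 + card (tbox b)))"
    by (simp add: mesh_def)
  also have "\<dots> \<le> (1 / 2 ^ b) * 1"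
    by (intro mult_left_mono) auto
  finally show ?thesis
    by simp
qed

text \<open>Let the segment meet the support of \<open>y j\<close> in \<open>r\<close>. Within the
  shell of \<open>y l\<close> it coincides with the whole path to \<open>r\<close>, so that a
  nonzero sum there contradicts \<open>null\<close> unless \<open>\<mu> r < mesh (q l)\<close>. Its
  part in the support of \<open>y k\<close> lies in the cone of \<open>r\<close>, whose mass in
  \<open>y k\<close> is then small.\<close>

lemma segment_sum_triple:
  fixes y :: "nat \<Rightarrow> jt_inf"
  assumes q: "strict_mono q"
    and supp: "\<And>l t. jt_fun (y l) t \<noteq> 0 \<Longrightarrow> t \<in> tbox (q (Suc l)) - tbox (q l)"
    and mass: "\<And>l r. r \<in> tbox (q l) \<Longrightarrow> norm (jcut (tcone r) (y l)) \<le> 2 * (\<mu> r + mesh (q l))"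
    and null: "\<And>l r. mesh (q l) \<le> \<mu> r \<Longrightarrow> r \<notin> tbox (q (Suc l)) \<Longrightarrow> path_functional r (y l) = 0"
    and S: "S = {t. prefix p t \<and> prefix t u}" and p: "p \<in> tbox (q l)" and lt: "l < j" "j < k"
    and nz: "sum (jt_fun (y l)) S \<noteq> 0" "sum (jt_fun (y j)) S \<noteq> 0"
  shows "\<bar>sum (jt_fun (y k)) S\<bar> \<le> 4 * mesh (q l)"
proof -
  have qm: "tbox (q a) \<subseteq> tbox (q b)" if "a \<le> b" for a b
    using that q by (intro box_mono) (simp add: strict_mono_less_eq)
  have finS: "finite S"
    unfolding S by (rule finite_subset[OF _ finite_prefixes_of[of u]]) auto
  obtain r where r: "r \<in> S" "jt_fun (y j) r \<noteq> 0"
    using nz(2) by (metis sum.neutral)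
  have r': "r \<in> tbox (q (Suc j))" "r \<notin> tbox (q j)" "prefix r u"
    using supp[OF r(2)] r(1) by (auto simp: S)
  then have rl: "r \<notin> tbox (q (Suc l))" and rk: "r \<in> tbox (q k)"
    using qm[of "Suc l" j] qm[of "Suc j" k] lt by auto
  have "sum (jt_fun (y l)) S = path_functional r (y l)"
    unfolding path_functional_apply
  proof (rule sum_eq_on_support[OF finS finite_prefixes_of])
    fix s assume s: "jt_fun (y l) s \<noteq> 0"
    then have "\<not> prefix r s" "\<not> prefix s p"
      using supp[OF s] rl p prefix_box by blast+
    then show "s \<in> S \<longleftrightarrow> s \<in> {s. prefix s r}"
      using r' r(1) prefix_same_cases[of s u r] prefix_same_cases[of s r p] prefix_order.trans[of s r u] by (auto simp: S)
  qed
  then have \<mu>: "\<mu> r < mesh (q l)"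
    using nz(1) null[of l r] rl by force
  have "sum (jt_fun (y k)) S = sum (jt_fun (jcut (tcone r) (y k))) {s. prefix s u}"
  proof -
    have "sum (jt_fun (y k)) S = sum (jt_fun (y k)) {s. prefix r s \<and> prefix s u}"
    proof (rule sum_eq_on_support[OF finS])
      show "finite {s. prefix r s \<and> prefix s u}"
        by (rule finite_subset[OF _ finite_prefixes_of[of u]]) auto
      fix s assume s: "jt_fun (y k) s \<noteq> 0"
      then have "\<not> prefix s r"
        using supp[OF s] rk prefix_box by blast
      then show "s \<in> S \<longleftrightarrow> s \<in> {s. prefix r s \<and> prefix s u}"
        using r'(3) r(1) prefix_same_cases[of s u r] prefix_order.trans[of p r s] by (auto simp: S)
    qed
    also have "\<dots> = (\<Sum>s\<in>{s. prefix s u}. if prefix r s then jt_fun (y k) s else 0)"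
      using finite_prefixes_of[of u] by (simp add: sum.inter_filter conj_commute flip: sum.inter_filter)
    finally show ?thesis
      by (simp only: jt_fun_cut') (simp add: tcone_def)
  qed
  then have "\<bar>sum (jt_fun (y k)) S\<bar> \<le> norm (jcut (tcone r) (y k))"
    by (simp only: jt_segment_le path_segment)
  also have "\<dots> \<le> 2 * (\<mu> r + mesh (q k))"
    by (rule mass[OF rk])
  also have "\<dots> \<le> 4 * mesh (q l)"
    using \<mu> mesh_antimono[of "q l" "q k"] q lt by (simp add: strict_mono_less_eq)
  finally show ?thesis .
qed

section \<open>Upper 2-estimates for corrected blocks\<close>

lemma square_sum_card_le: "(\<Sum>i\<in>A. f i)\<^sup>2 \<le> real (card A) * (\<Sum>i\<in>A. (f i)\<^sup>2)" for f :: "'a \<Rightarrow> real"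
  using Cauchy_Schwarz_ineq_sum[of "\<lambda>_. 1" f A] by simp

lemma linear_not_le_sqrt:
  fixes a b :: real
  assumes "0 < a"
  shows "\<exists>N::nat. b * sqrt N < N * a"
proof -
  obtain N :: nat where N: "(b / a)\<^sup>2 + 1 \<le> N"
    using real_arch_simple by blast
  have pos: "0 < real N"
    using N zero_le_power2[of "b / a"] by linarith
  have "b / a < sqrt N"
    using N by (intro real_less_rsqrt) simp
  then have "b / a * a * sqrt N < sqrt N * a * sqrt N"
    using pos assms by (intro mult_strict_right_mono) auto
  also have "\<dots> = N * a"
    by simp
  finally show ?thesis
    using assms by auto
qed

text \<open>On each segment all but three blocks contribute a negligible amount: the block in which the segment starts
  and the two blocks provided by \<open>sum_outside_two_le\<close>. The remaining three are estimated in \<open>l2\<close>.\<close>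

lemma corrected_sequence_upper_2:
  fixes y :: "nat \<Rightarrow> jt_inf"
  assumes q: "strict_mono q" "q 0 = 0"
    and supp: "\<And>l t. jt_fun (y l) t \<noteq> 0 \<Longrightarrow> t \<in> tbox (q (Suc l)) - tbox (q l)"
    and y: "\<And>l. norm (y l) \<le> 2"
    and mass: "\<And>l r. r \<in> tbox (q l) \<Longrightarrow> norm (jcut (tcone r) (y l)) \<le> 2 * (\<mu> r + mesh (q l))"
    and null: "\<And>l r. mesh (q l) \<le> \<mu> r \<Longrightarrow> r \<notin> tbox (q (Suc l)) \<Longrightarrow> path_functional r (y l) = 0"
  shows "norm (\<Sum>l<N. \<alpha> l *\<^sub>R y l) \<le> 12 * L2_set \<alpha> {..<N}"
  unfolding norm_jt_le_iff jt_bounded_L2_set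
proof
  fix F assume F: "F \<in> segment_families"
  have finF: "finite F" "F \<subseteq> segments" "pairwise disjnt F"
    using F by (auto simp: segment_families_def)
  define A where "A = L2_set \<alpha> {..<N}"
  have A: "\<bar>\<alpha> l\<bar> \<le> A" if "l < N" for l
    using that member_le_L2_set[of "{..<N}" l "\<lambda>l. \<bar>\<alpha> l\<bar>"] by (simp add: A_def L2_set_def)
  have A0: "0 \<le> A"
    by (simp add: A_def)
  have "\<forall>S\<in>F. \<exists>p u. S = {t. prefix p t \<and> prefix t u} \<and> prefix p u"
    using finF(2) by (auto simp: segments_def)
  then obtain p u where pu: "\<And>S. S \<in> F \<Longrightarrow> S = {t. prefix (p S) t \<and> prefix t (u S)}" "\<And>S. S \<in> F \<Longrightarrow> prefix (p S) (u S)"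
    by metis
  define v where "v S l = sum (jt_fun (y l)) S" for S l
  \<comment> \<open>The blocks are sorted by the node \<open>p S\<close> where the segment starts:
    those in \<open>I S\<close> lie in shells beyond it, the at most one in \<open>J S\<close> has
    it in its shell, and all others are not met.\<close>
  define I where "I S = {l. l < N \<and> p S \<in> tbox (q l)}" for S
  define J where "J S = {l. l < N \<and> p S \<in> tbox (q (Suc l)) - tbox (q l)}" for S
  have qm: "tbox (q a) \<subseteq> tbox (q b)" if "a \<le> b" for a b
    using that q by (intro box_mono) (simp add: strict_mono_less_eq)
  have Jcard: "card (J S) \<le> 1" for S
  proof -
    have "l = l'" if "l \<in> J S" "l' \<in> J S" for l l'
      using disjoint_shells[OF q(1)] that unfolding J_def disjoint_family_on_def by blast
    then show ?thesis
      by (simp add: card_le_Suc0_iff_eq J_def)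
  qed
  have vzero: "v S l = 0" if S: "S \<in> F" and l: "l < N" "l \<notin> I S" "l \<notin> J S" for S l
    unfolding v_def
  proof (rule sum.neutral, rule ballI)
    fix t assume t: "t \<in> S"
    then have "prefix (p S) t"
      using pu(1)[OF S] by blast
    moreover have "p S \<notin> tbox (q (Suc l))"
      using l by (auto simp: I_def J_def)
    ultimately show "jt_fun (y l) t = 0"
      using supp[of l t] prefix_box by blast
  qed
  have "\<exists>Q\<subseteq>I S. card Q \<le> 2 \<and> (\<Sum>l\<in>I S - Q. \<bar>v S l\<bar>) \<le> 4 * (\<Sum>l\<in>I S. mesh (q l))" if S: "S \<in> F" for S
  proof (rule sum_outside_two_le)
    show "finite (I S)"
      by (simp add: I_def)
    fix l j k assume "l \<in> I S" "l < j" "j < k" "\<bar>v S l\<bar> \<noteq> 0" "\<bar>v S j\<bar> \<noteq> 0"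
    then show "\<bar>v S k\<bar> \<le> 4 * mesh (q l)"
      unfolding v_def
      by (intro segment_sum_triple[OF q(1) supp mass null pu(1)[OF S], of l j k]) (auto simp: I_def)
  qed (auto intro: less_imp_le mesh_pos)
  then obtain Q where Q: "\<And>S. S \<in> F \<Longrightarrow> Q S \<subseteq> I S" "\<And>S. S \<in> F \<Longrightarrow> card (Q S) \<le> 2"
    "\<And>S. S \<in> F \<Longrightarrow> (\<Sum>l\<in>I S - Q S. \<bar>v S l\<bar>) \<le> 4 * (\<Sum>l\<in>I S. mesh (q l))"
    by metis
  \<comment> \<open>\<open>g\<close> accounts for the at most three exceptional blocks, whose number
    is rounded up to 4 under the square root; \<open>h\<close> accounts for the rest, with every
    coefficient estimated by \<open>A\<close>. Their l2 norms over \<open>F\<close> are at most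
    \<open>4 * A\<close> and \<open>8 * A\<close>, which makes up the constant 12.\<close>
  define g where "g S = 2 * sqrt (\<Sum>l<N. (\<alpha> l * v S l)\<^sup>2)" for S
  define h where "h S = A * (4 * (\<Sum>l\<in>I S. mesh (q l)))" for S
  have h0: "0 \<le> h S" for S
    using A0 by (auto simp: h_def intro!: mult_nonneg_nonneg sum_nonneg less_imp_le[OF mesh_pos])
  have pointwise: "\<bar>\<Sum>l<N. \<alpha> l * v S l\<bar> \<le> g S + h S" if S: "S \<in> F" for S
  proof -
    let ?E = "Q S \<union> J S"
    have fin: "finite (I S)" "finite (J S)" "finite ?E" "?E \<subseteq> {..<N}"
      using Q(1)[OF S] by (auto simp: I_def J_def intro: finite_subset)
    have dis: "I S \<inter> J S = {}"
      by (auto simp: I_def J_def)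
    have cE: "card ?E \<le> 3"
      using card_Un_le[of "Q S" "J S"] Q(2)[OF S] Jcard[of S] by simp
    have "(\<Sum>l<N. \<bar>\<alpha> l * v S l\<bar>) = (\<Sum>l\<in>I S \<union> J S. \<bar>\<alpha> l * v S l\<bar>)"
      using vzero[OF S] by (intro sum.mono_neutral_right) (auto simp: I_def J_def)
    also have "I S \<union> J S = ?E \<union> (I S - Q S)"
      using Q(1)[OF S] by blast
    also have "(\<Sum>l\<in>?E \<union> (I S - Q S). \<bar>\<alpha> l * v S l\<bar>) = (\<Sum>l\<in>?E. \<bar>\<alpha> l * v S l\<bar>) + (\<Sum>l\<in>I S - Q S. \<bar>\<alpha> l * v S l\<bar>)"
      using fin dis Q(1)[OF S] by (intro sum.union_disjoint) auto
    finally have split: "(\<Sum>l<N. \<bar>\<alpha> l * v S l\<bar>) = (\<Sum>l\<in>?E. \<bar>\<alpha> l * v S l\<bar>) + (\<Sum>l\<in>I S - Q S. \<bar>\<alpha> l * v S l\<bar>)" .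
    have "(\<Sum>l\<in>?E. \<bar>\<alpha> l * v S l\<bar>)\<^sup>2 \<le> real (card ?E) * (\<Sum>l\<in>?E. \<bar>\<alpha> l * v S l\<bar>\<^sup>2)"
      by (rule square_sum_card_le)
    also have "\<dots> \<le> 4 * (\<Sum>l<N. (\<alpha> l * v S l)\<^sup>2)"
      using cE fin by (intro mult_mono) (auto intro!: sum_mono2 sum_nonneg)
    also have "\<dots> = (g S)\<^sup>2"
      by (simp add: g_def power_mult_distrib sum_nonneg)
    finally have 1: "(\<Sum>l\<in>?E. \<bar>\<alpha> l * v S l\<bar>) \<le> g S"
      by (rule power2_le_imp_le) (simp add: g_def sum_nonneg)
    have "(\<Sum>l\<in>I S - Q S. \<bar>\<alpha> l * v S l\<bar>) \<le> (\<Sum>l\<in>I S - Q S. A * \<bar>v S l\<bar>)"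
      unfolding abs_mult by (intro sum_mono mult_right_mono A) (auto simp: I_def)
    also have "\<dots> \<le> h S"
      unfolding h_def sum_distrib_left[symmetric] by (intro mult_left_mono Q(3)[OF S] A0)
    finally have 2: "(\<Sum>l\<in>I S - Q S. \<bar>\<alpha> l * v S l\<bar>) \<le> h S" .
    show ?thesis
      using sum_abs[of "\<lambda>l. \<alpha> l * v S l" "{..<N}"] split 1 2 by linarith
  qed
  have sumS: "sum (jt_fun (\<Sum>l<N. \<alpha> l *\<^sub>R y l)) S = (\<Sum>l<N. \<alpha> l * v S l)" for S
  proof -
    have "sum (jt_fun (\<Sum>l<N. \<alpha> l *\<^sub>R y l)) S = (\<Sum>s\<in>S. \<Sum>l<N. \<alpha> l * jt_fun (y l) s)"
      by (simp add: jt_fun_sum jt_fun_scaleR)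
    also have "\<dots> = (\<Sum>l<N. \<Sum>s\<in>S. \<alpha> l * jt_fun (y l) s)"
      by (rule sum.swap)
    finally show ?thesis
      by (simp add: v_def sum_distrib_left)
  qed
  have "(L2_set g F)\<^sup>2 \<le> (4 * A)\<^sup>2"
  proof -
    have "(L2_set g F)\<^sup>2 = 4 * (\<Sum>S\<in>F. \<Sum>l<N. (\<alpha> l * v S l)\<^sup>2)"
      by (simp add: L2_set_def g_def power_mult_distrib sum_nonneg sum_distrib_left)
    also have "(\<Sum>S\<in>F. \<Sum>l<N. (\<alpha> l * v S l)\<^sup>2) = (\<Sum>l<N. (\<alpha> l)\<^sup>2 * (\<Sum>S\<in>F. (v S l)\<^sup>2))"
      by (subst sum.swap) (simp add: power_mult_distrib sum_distrib_left)
    also have "\<dots> \<le> (\<Sum>l<N. (\<alpha> l)\<^sup>2 * 4)"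
    proof (intro sum_mono mult_left_mono)
      fix l
      have "(L2_set (sum (jt_fun (y l))) F)\<^sup>2 \<le> 2\<^sup>2"
        by (intro power_mono order_trans[OF jt_family_le[OF F] y]) auto
      then show "(\<Sum>S\<in>F. (v S l)\<^sup>2) \<le> 4"
        by (simp add: L2_set_def sum_nonneg v_def)
    qed simp
    also have "\<dots> = 4 * A\<^sup>2"
      by (simp add: A_def L2_set_def sum_nonneg sum_distrib_right[symmetric])
    finally show ?thesis
      by (simp add: power_mult_distrib)
  qed
  then have gF: "L2_set g F \<le> 4 * A"
    by (rule power2_le_imp_le) (use A0 in simp)
  have "L2_set h F \<le> (\<Sum>S\<in>F. h S)"
    using h0 by (rule L2_set_le_sum)
  also have "\<dots> = 4 * A * (\<Sum>S\<in>F. \<Sum>l<N. if p S \<in> tbox (q l) then mesh (q l) else 0)"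
  proof -
    have "(\<Sum>l\<in>I S. mesh (q l)) = (\<Sum>l<N. if p S \<in> tbox (q l) then mesh (q l) else 0)" for S
      unfolding I_def by (subst sum.inter_filter[symmetric]) (auto intro!: sum.cong)
    then show ?thesis
      by (simp add: h_def sum_distrib_left mult_ac)
  qed
  also have "(\<Sum>S\<in>F. \<Sum>l<N. if p S \<in> tbox (q l) then mesh (q l) else 0) \<le> (\<Sum>l<N. 1 / 2 ^ l)"
  proof (subst sum.swap, rule sum_mono)
    fix l
    have "inj_on p F"
    proof (rule inj_onI)
      fix S S' assume S: "S \<in> F" "S' \<in> F" "p S = p S'"
      have "p S \<in> S \<inter> S'"
        using S pu prefix_order.refl by (metis (mono_tags, lifting) IntI mem_Collect_eq)
      then show "S = S'"
        using finF(3) S unfolding pairwise_def disjnt_def by blast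
    qed
    then have "card {S\<in>F. p S \<in> tbox (q l)} \<le> card (tbox (q l))"
      by (intro card_inj_on_le[of p] finite_box) (auto simp: inj_on_def)
    then have "card {S\<in>F. p S \<in> tbox (q l)} * mesh (q l) \<le> card (tbox (q l)) * mesh (q l)"
      by (intro mult_right_mono less_imp_le[OF mesh_pos]) simp
    also have "\<dots> \<le> 1 / 2 ^ q l"
      using mesh_card_le by (simp add: mult.commute)
    also have "\<dots> \<le> 1 / 2 ^ l"
      using strict_mono_imp_increasing[OF q(1), of l] by (intro divide_left_mono power_increasing) auto
    finally show "(\<Sum>S\<in>F. if p S \<in> tbox (q l) then mesh (q l) else 0) \<le> 1 / 2 ^ l"
      using finF(1) by (simp add: sum.inter_filter[symmetric])
  qed
  finally have "L2_set h F \<le> 4 * A * (\<Sum>l<N. 1 / 2 ^ l)"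
    using A0 by (simp add: mult_left_mono)
  also have "\<dots> \<le> 4 * A * 2"
    using sum_half_powers_le[of 1 N] A0 by (intro mult_left_mono) auto
  finally have hF: "L2_set h F \<le> 8 * A"
    by simp
  have "L2_set (sum (jt_fun (\<Sum>l<N. \<alpha> l *\<^sub>R y l))) F = L2_set (\<lambda>S. \<bar>\<Sum>l<N. \<alpha> l * v S l\<bar>) F"
    by (simp add: L2_set_def sumS)
  also have "\<dots> \<le> L2_set (\<lambda>S. g S + h S) F"
    using pointwise by (intro L2_set_mono) auto
  also have "\<dots> \<le> L2_set g F + L2_set h F"
    by (rule L2_set_triangle_ineq)
  finally show "L2_set (sum (jt_fun (\<Sum>l<N. \<alpha> l *\<^sub>R y l))) F \<le> 12 * L2_set \<alpha> {..<N}"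
    using gF hF by (simp add: A_def)
qed

text \<open>The vector \<^term>\<open>x n\<close> is corrected by a combination \<^term>\<open>c\<close> of unit vectors further out in the tree,
  so that the sum along every path that reaches a node carrying at least mass \<^term>\<open>\<epsilon>\<close> of the
  tail of the sequence vanishes. Only boundedly many branches carry that much mass.\<close>

lemma path_correction:
  fixes x :: "nat \<Rightarrow> jt_inf" and \<mu> :: "nat list \<Rightarrow> real"
  assumes x: "\<And>n. norm (x n) \<le> 1" and low: "\<And>n t. jt_fun (x n) t \<noteq> 0 \<Longrightarrow> t \<notin> tbox n"
    and high: "\<And>n t. jt_fun (x n) t \<noteq> 0 \<Longrightarrow> t \<in> tbox (B n)"
    and \<mu>: "\<And>r. (\<lambda>n. norm (jcut (tcone r) (x n))) \<longlonglongrightarrow> \<mu> r"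
    and z: "null_on_chains z" and \<epsilon>: "0 < \<epsilon>" and \<eta>: "0 < \<eta>"
  obtains n b c where "m \<le> n" "n < b" "B n < b"
    "\<And>t. jt_fun c t \<noteq> 0 \<Longrightarrow> t \<in> tbox b - tbox (B n)" "\<bar>blinfun_apply z c\<bar> \<le> \<eta>"
    "\<And>t. jt_fun (x n - c) t \<noteq> 0 \<Longrightarrow> t \<in> tbox b - tbox n"
    "\<And>r. r \<in> tbox n \<Longrightarrow> norm (jcut (tcone r) (x n - c)) \<le> 2 * norm (jcut (tcone r) (x n))"
    "\<And>r. r \<in> tbox p \<Longrightarrow> norm (jcut (tcone r) (x n)) \<le> \<mu> r + \<epsilon>"
    "\<And>r. \<epsilon> \<le> \<mu> r \<Longrightarrow> r \<notin> tbox b \<Longrightarrow> path_functional r (x n - c) = 0"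
proof -
  define G where "G = {r. \<epsilon> \<le> \<mu> r}"
  have bound: "card Q \<le> nat \<lceil>1 / \<epsilon>\<^sup>2\<rceil>" if "Q \<subseteq> G" "finite Q" "antichain Q" for Q
  proof -
    have "real (card Q) \<le> 1 / \<epsilon>\<^sup>2"
      by (rule card_antichain_le[OF x \<mu> that(2,3) _ \<epsilon>]) (use that(1) in \<open>auto simp: G_def\<close>)
    then show ?thesis
      using real_nat_ceiling_ge[of "1 / \<epsilon>\<^sup>2"] by linarith
  qed
  obtain R where R: "R \<subseteq> G" "finite R" "antichain R"
    and Rcover: "\<And>k t. R \<subseteq> tbox k \<Longrightarrow> t \<in> G - tbox k \<Longrightarrow> \<exists>r\<in>R. prefix r t"
    and Rchain: "\<And>r s t. r \<in> R \<Longrightarrow> s \<in> G \<Longrightarrow> t \<in> G \<Longrightarrow> prefix r s \<Longrightarrow> prefix r t \<Longrightarrow> prefix s t \<or> prefix t s"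
    by (rule maximal_antichain[of G "nat \<lceil>1 / \<epsilon>\<^sup>2\<rceil>", OF bound], assumption+) (rule that)
  obtain k where k: "R \<subseteq> tbox k"
    using finite_subset_box[OF R(2)] by blast
  have "eventually (\<lambda>n. \<forall>r\<in>tbox p. norm (jcut (tcone r) (x n)) < \<mu> r + \<epsilon>) sequentially"
    using \<epsilon> by (intro eventually_ball_finite finite_box ballI order_tendstoD(2)[OF \<mu>]) simp
  then obtain N where N: "\<forall>n\<ge>N. \<forall>r\<in>tbox p. norm (jcut (tcone r) (x n)) < \<mu> r + \<epsilon>"
    by (auto simp: eventually_sequentially)
  define n where "n = max m (max N k)"
  have n: "m \<le> n" "R \<subseteq> tbox n" "\<And>r. r \<in> tbox p \<Longrightarrow> norm (jcut (tcone r) (x n)) \<le> \<mu> r + \<epsilon>"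
    using N k box_mono[of k n] by (auto simp: n_def le_max_iff_disj intro: less_imp_le)
  define b0 where "b0 = max n (B n)"
  define C where "C r = {t\<in>G. prefix r t}" for r
  \<comment> \<open>Only the nodes of \<open>R\<close> with infinitely many heavy extensions need a
    correction; the heavy extensions of the others are finite in number and disappear in the box
    \<open>tbox b\<close>.\<close>
  define I where "I = {r\<in>R. infinite (C r)}"
  have finI: "finite I"
    using R(2) by (simp add: I_def)
  \<comment> \<open>The nodes are sought beyond the support of \<open>x n\<close>, and the values of
    \<open>z\<close> there are so small that \<open>card I\<close> of them, with coefficients of
    modulus at most 1, add up to at most \<open>\<eta>\<close>.\<close>
  have "\<exists>t\<in>C r - tbox b0. \<bar>z (jt_unit t)\<bar> < \<eta> / (card I + 1)" if r: "r \<in> I" for r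
  proof -
    have inf: "infinite (C r - tbox b0)"
      using r finite_box by (simp add: I_def)
    show ?thesis
    proof (rule null_on_chainsD[OF z inf])
      show "0 < \<eta> / (card I + 1)"
        using \<eta> by simp
      show "prefix s t \<or> prefix t s" if "s \<in> C r - tbox b0" "t \<in> C r - tbox b0" for s t
        using Rchain[of r s t] r that by (auto simp: C_def I_def)
    qed
  qed
  then obtain t where t: "\<And>r. r \<in> I \<Longrightarrow> t r \<in> C r - tbox b0" "\<And>r. r \<in> I \<Longrightarrow> \<bar>z (jt_unit (t r))\<bar> < \<eta> / (card I + 1)"
    by metis
  have "finite (t ` I \<union> (\<Union>r\<in>R - I. C r))"
    using R(2) finI by (auto simp: I_def)
  then obtain b1 where b1: "t ` I \<union> (\<Union>r\<in>R - I. C r) \<subseteq> tbox b1"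
    using finite_subset_box by blast
  define b where "b = max b1 (Suc b0)"
  have "b1 \<le> b" and b0b: "Suc b0 \<le> b"
    unfolding b_def by (rule max.cobounded1, rule max.cobounded2)
  then have "tbox b1 \<subseteq> tbox b" "tbox b0 \<subseteq> tbox b"
    by (auto intro!: box_mono)
  then have b: "t ` I \<union> (\<Union>r\<in>R - I. C r) \<subseteq> tbox b" "b0 < b" "n < b" "tbox b0 \<subseteq> tbox b" "B n < b"
    using subset_trans[OF b1, of "tbox b"] Suc_le_lessD[OF b0b] by (simp_all add: b0_def)
  have tb0: "tbox n \<subseteq> tbox b0" "tbox (B n) \<subseteq> tbox b0"
    by (auto simp: b0_def intro!: box_mono)
  have tpre: "prefix r (t r)" if "r \<in> I" for r
    using t(1)[OF that] by (simp add: C_def)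
  have antiI: "r = s" if "r \<in> I" "s \<in> I" "prefix r u" "prefix s u" for r s u
    using that antichainD[OF R(3)] prefix_same_cases[of r u s] unfolding I_def by (metis (lifting) mem_Collect_eq)
  have inj: "inj_on t I"
    by (rule inj_onI) (metis antiI tpre)
  have anti: "antichain (t ` I)"
    by (rule antichainI) (metis antiI tpre prefix_order.trans image_iff)
  \<comment> \<open>The correcting node \<open>t r\<close> receives the whole path sum of
    \<open>x n\<close> up to it, so that on paths through \<open>t r\<close> the sum is
    cancelled.\<close>
  define a where "a r = path_functional (t r) (x n)" for r
  define c where "c = (\<Sum>r\<in>I. a r *\<^sub>R jt_unit (t r))"
  have cval: "jt_fun c s = (\<Sum>r\<in>I. if s = t r then a r else 0)" for s
    by (simp add: c_def jt_fun_sum jt_fun_scaleR jt_fun_unit if_distrib cong: if_cong)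
  have csupp: "s \<in> t ` I" if "jt_fun c s \<noteq> 0" for s
  proof (rule ccontr)
    assume "s \<notin> t ` I"
    then have "(\<Sum>r\<in>I. if s = t r then a r else 0) = 0"
      by (intro sum.neutral) auto
    then show False
      using that cval by simp
  qed
  have a_le: "\<bar>a r\<bar> \<le> 1" for r
    using jt_segment_le[OF path_segment[of "t r"], of "x n"] x[of n]
    by (simp add: a_def path_functional_apply)
  show thesis
  proof (rule that[OF n(1) b(3,5), of c])
    fix s assume "jt_fun c s \<noteq> 0"
    then obtain r where "r \<in> I" "s = t r"
      using csupp by blast
    then show "s \<in> tbox b - tbox (B n)"
      using t(1)[of r] b(1) tb0 by auto
  next
    have "\<bar>z c\<bar> \<le> (\<Sum>r\<in>I. \<bar>a r\<bar> * \<bar>z (jt_unit (t r))\<bar>)"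
      unfolding c_def by (simp add: blinfun.sum_right blinfun.scaleR_right abs_mult order_trans[OF sum_abs])
    also have "\<dots> \<le> (\<Sum>r\<in>I. 1 * (\<eta> / (card I + 1)))"
      using a_le t(2) by (intro sum_mono mult_mono) (auto intro: less_imp_le)
    also have "\<dots> \<le> \<eta>"
      using \<eta> by (simp add: field_simps)
    finally show "\<bar>z c\<bar> \<le> \<eta>" .
  next
    fix s assume "jt_fun (x n - c) s \<noteq> 0"
    then have "jt_fun (x n) s \<noteq> 0 \<or> jt_fun c s \<noteq> 0"
      by (auto simp: jt_fun_simps)
    then show "s \<in> tbox b - tbox n"
    proof
      assume "jt_fun (x n) s \<noteq> 0"
      then show ?thesis
        using low high tb0 b(4) by blast
    next
      assume "jt_fun c s \<noteq> 0"
      then show ?thesis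
        using csupp t(1) b(1) tb0 by blast
    qed
  next
    fix r assume r: "r \<in> tbox n"
    \<comment> \<open>The coefficients \<open>a i\<close> with \<open>t i\<close> above
      \<open>r\<close> are sums of the cone part of \<open>x n\<close> over the disjoint segments
      \<open>S i\<close>. Their l2 norm is at most the mass of \<open>x n\<close> in the cone, and
      so is the norm of \<open>c\<close> there; this gives the factor 2.\<close>
    define I' where "I' = {i\<in>I. prefix r (t i)}"
    define x' where "x' = jcut (tcone r) (x n)"
    define S where "S i = {s. prefix i s \<and> prefix s (t i)}" for i
    have I': "finite I'" "I' \<subseteq> I"
      using finI by (auto simp: I'_def)
    have aS: "sum (jt_fun x') (S i) = a i" if i: "i \<in> I'" for i
    proof -
      have "a i = sum (jt_fun x') {s. prefix s (t i)}"
        unfolding a_def path_functional_apply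
      proof (rule sum.cong[OF refl])
        fix s assume s: "s \<in> {s. prefix s (t i)}"
        show "jt_fun (x n) s = jt_fun x' s"
        proof (cases "jt_fun (x n) s = 0")
          case False
          then have "s \<notin> tbox n"
            by (rule low)
          then have "\<not> prefix s r"
            using prefix_box r by blast
          then have "prefix r s"
            using i s prefix_same_cases[of r "t i" s] by (auto simp: I'_def)
          then show ?thesis
            by (simp add: x'_def) (simp add: tcone_def)
        qed (simp add: x'_def)
      qed
      also have "\<dots> = sum (jt_fun x') (S i)"
      proof (rule sum_eq_on_support)
        show "finite {s. prefix s (t i)}" "finite (S i)"
          using finite_prefixes_of by (auto simp: S_def)
        fix s assume "jt_fun x' s \<noteq> 0"
        then have "s \<notin> tbox n"
          using low by (auto simp: x'_def split: if_splits)
        moreover have "i \<in> tbox n"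
          using i I'(2) n(2) by (auto simp: I_def)
        ultimately have "\<not> prefix s i"
          using prefix_box by blast
        then show "s \<in> {s. prefix s (t i)} \<longleftrightarrow> s \<in> S i"
          using tpre[of i] i I'(2) prefix_same_cases[of i "t i" s] by (auto simp: S_def)
      qed
      finally show ?thesis ..
    qed
    have Sdis: "S i \<inter> S j = {}" if "i \<in> I'" "j \<in> I'" "i \<noteq> j" for i j
      using antiI that I'(2) by (auto simp: S_def)
    have Sne: "i \<in> S i" if "i \<in> I'" for i
      using that I'(2) tpre by (auto simp: S_def)
    have Sinj: "inj_on S I'"
      using Sdis Sne by (intro inj_onI) (metis Int_absorb empty_iff)
    have "S ` I' \<in> segment_families"
      unfolding segment_families_def
    proof safe
      show "finite (S ` I')"
        using I' by simp
      show "pairwise disjnt (S ` I')"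
        by (rule pairwise_imageI) (simp add: disjnt_def Sdis)
      fix i assume "i \<in> I'"
      then show "S i \<in> segments"
        using tpre I'(2) unfolding segments_def S_def by blast
    qed
    then have "L2_set (sum (jt_fun x')) (S ` I') \<le> norm x'"
      by (rule jt_family_le)
    then have L2a: "L2_set a I' \<le> norm x'"
      using aS by (simp add: L2_set_def sum.reindex[OF Sinj])
    have "jcut (tcone r) c = (\<Sum>i\<in>I'. a i *\<^sub>R jt_unit (t i))"
    proof (rule jt_eqI)
      fix s
      have "jt_fun (jcut (tcone r) c) s = (\<Sum>i\<in>I. if prefix r s \<and> s = t i then a i else 0)"
        by (simp add: cval) (auto simp: tcone_def intro!: sum.cong)
      also have "\<dots> = (\<Sum>i\<in>I. if prefix r (t i) then (if s = t i then a i else 0) else 0)"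
        by (intro sum.cong) auto
      also have "\<dots> = (\<Sum>i\<in>I'. if s = t i then a i else 0)"
        using finI by (simp add: I'_def sum.inter_filter)
      finally show "jt_fun (jcut (tcone r) c) s = jt_fun (\<Sum>i\<in>I'. a i *\<^sub>R jt_unit (t i)) s"
        by (simp add: jt_fun_sum jt_fun_scaleR jt_fun_unit if_distrib cong: if_cong)
    qed
    also have "norm \<dots> \<le> L2_set a I'"
    proof (rule norm_antichain_units_le)
      show "inj_on t I'"
        using inj I'(2) by (rule inj_on_subset)
      show "antichain (t ` I')"
        using antichainD[OF anti] I'(2) by (intro antichainI) (meson image_mono subsetD)
    qed (rule I'(1))
    finally have "norm (jcut (tcone r) c) \<le> norm x'"
      using L2a by simp
    moreover have "jcut (tcone r) (x n - c) = x' - jcut (tcone r) c"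
      unfolding x'_def by (intro jt_eqI) (simp add: jt_fun_simps)
    ultimately show "norm (jcut (tcone r) (x n - c)) \<le> 2 * norm (jcut (tcone r) (x n))"
      using norm_triangle_ineq4[of x' "jcut (tcone r) c"] by (simp add: x'_def)
  next
    fix r assume "r \<in> tbox p"
    then show "norm (jcut (tcone r) (x n)) \<le> \<mu> r + \<epsilon>"
      by (rule n(3))
  next
    fix u assume u: "\<epsilon> \<le> \<mu> u" "u \<notin> tbox b"
    then have uG: "u \<in> G - tbox n"
      using tb0 b(4) by (auto simp: G_def)
    then obtain r where r: "r \<in> R" "prefix r u"
      using Rcover n(2) by blast
    have rI: "r \<in> I"
    proof (rule ccontr)
      assume "r \<notin> I"
      then have "u \<in> tbox b"
        using b(1) r uG by (auto simp: C_def)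
      then show False
        using u by blast
    qed
    \<comment> \<open>Heavy nodes above \<open>r\<close> are comparable, and \<open>u\<close> lies
      outside a box that contains \<open>t r\<close>.\<close>
    have tu: "prefix (t r) u"
    proof -
      have "prefix (t r) u \<or> prefix u (t r)"
        using Rchain[OF r(1)] t(1)[OF rI] uG r(2) tpre[OF rI] by (auto simp: C_def)
      moreover have "\<not> prefix u (t r)"
        using prefix_box[of u "t r" b] b(1) rI u(2) by blast
      ultimately show ?thesis
        by blast
    qed
    have "path_functional u (x n) = a r"
      unfolding a_def path_functional_apply
    proof (rule sum_eq_on_support)
      fix s assume "jt_fun (x n) s \<noteq> 0"
      then have "s \<in> tbox b0"
        using high tb0 by blast
      then have "\<not> prefix (t r) s"
        using prefix_box[of "t r" s b0] t(1)[OF rI] by blast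
      then show "s \<in> {s. prefix s u} \<longleftrightarrow> s \<in> {s. prefix s (t r)}"
        using tu prefix_same_cases[of s u "t r"] prefix_order.trans[of s "t r" u] by blast
    qed (rule finite_prefixes_of)+
    moreover have "path_functional u c = a r"
    proof -
      have "path_functional u c = (\<Sum>i\<in>I. a i * (if prefix (t i) u then 1 else 0))"
        by (simp add: c_def blinfun.sum_right blinfun.scaleR_right path_functional_unit)
      also have "\<dots> = (\<Sum>i\<in>I. if i = r then a i else 0)"
      proof (rule sum.cong[OF refl])
        fix i assume i: "i \<in> I"
        have "prefix (t i) u \<longleftrightarrow> i = r"
          using antiI[of i r u] i rI r(2) tu tpre[OF i] prefix_order.trans[of i "t i" u] by blast
        then show "a i * (if prefix (t i) u then 1 else 0) = (if i = r then a i else 0)"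
          by simp
      qed
      finally show ?thesis
        using finI rI by simp
    qed
    ultimately show "path_functional u (x n - c) = 0"
      by (simp add: blinfun.diff_right)
  qed
qed

text \<open>The limit masses \<open>\<mu>\<close> exist along a subsequence by a second diagonal
  argument. Afterwards \<open>path_correction\<close> is applied repeatedly with tolerance
  \<open>mesh p\<close>, where \<open>p\<close> is the box reached so far, which yields the
  hypotheses of \<open>corrected_sequence_upper_2\<close>.\<close>

lemma corrected_subsequence:
  fixes x :: "nat \<Rightarrow> jt_inf"
  assumes x: "\<And>n. norm (x n) \<le> 1" and low: "\<And>n t. jt_fun (x n) t \<noteq> 0 \<Longrightarrow> t \<notin> tbox n"
    and high: "\<And>n t. jt_fun (x n) t \<noteq> 0 \<Longrightarrow> t \<in> tbox (B n)"
    and z: "null_on_chains z" and \<eta>: "0 < \<eta>"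
  obtains r :: "nat \<Rightarrow> nat" and q :: "nat \<Rightarrow> nat" and c :: "nat \<Rightarrow> jt_inf" where "strict_mono r" "strict_mono q"
    "\<And>l. q l \<le> r l" "\<And>l. B (r l) < q (Suc l)"
    "\<And>l t. jt_fun (c l) t \<noteq> 0 \<Longrightarrow> t \<in> tbox (q (Suc l)) - tbox (B (r l))"
    "\<And>l. \<bar>blinfun_apply z (c l)\<bar> \<le> \<eta>"
    "\<And>l t. jt_fun (x (r l) - c l) t \<noteq> 0 \<Longrightarrow> t \<in> tbox (q (Suc l)) - tbox (q l)"
    "\<And>N \<alpha>. norm (\<Sum>l<N. \<alpha> l *\<^sub>R (x (r l) - c l)) \<le> 12 * L2_set \<alpha> {..<N}"
proof -
  have cone_bound: "norm (norm (jcut (tcone t) (x n))) \<le> 1" for n t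
    using norm_cut_le[of "tcone t" "x n"] x[of n] by simp
  obtain s where s: "strict_mono (s :: nat \<Rightarrow> nat)"
    and conv: "\<And>t. t \<in> UNIV \<Longrightarrow> \<exists>l. (\<lambda>n. norm (jcut (tcone t) (x (s n)))) \<longlonglongrightarrow> l"
    by (rule function_convergent_subsequence[of UNIV "\<lambda>n t. norm (jcut (tcone t) (x n))" 1,
      OF countableI_type cone_bound]) (rule that)
  obtain \<mu> where \<mu>: "\<And>t. (\<lambda>n. norm (jcut (tcone t) (x (s n)))) \<longlonglongrightarrow> \<mu> t"
    using conv[OF UNIV_I] by metis
  have low': "t \<notin> tbox n" if "jt_fun (x (s n)) t \<noteq> 0" for n t
    using low[OF that] box_mono[OF strict_mono_imp_increasing[OF s, of n]] by blast
  define P where "P p m = (\<lambda>(n, b, c). p \<le> n \<and> m < n \<and> n < b \<and> B (s n) < b \<and>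
    (\<forall>t. jt_fun c t \<noteq> 0 \<longrightarrow> t \<in> tbox b - tbox (B (s n))) \<and> \<bar>z c\<bar> \<le> \<eta> \<and>
    (\<forall>t. jt_fun (x (s n) - c) t \<noteq> 0 \<longrightarrow> t \<in> tbox b - tbox p) \<and>
    (\<forall>r\<in>tbox p. norm (jcut (tcone r) (x (s n) - c)) \<le> 2 * (\<mu> r + mesh p)) \<and>
    norm (x (s n) - c) \<le> 2 \<and>
    (\<forall>r. mesh p \<le> \<mu> r \<longrightarrow> r \<notin> tbox b \<longrightarrow> path_functional r (x (s n) - c) = 0))"
    for p m :: nat
  have ex: "\<exists>n b c. P p m (n, b, c)" for p m
  proof -
    obtain n b c where nbc: "max p (Suc m) \<le> n" "n < b" "B (s n) < b"
      "\<And>t. jt_fun c t \<noteq> 0 \<Longrightarrow> t \<in> tbox b - tbox (B (s n))" "\<bar>blinfun_apply z c\<bar> \<le> \<eta>"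
      "\<And>t. jt_fun (x (s n) - c) t \<noteq> 0 \<Longrightarrow> t \<in> tbox b - tbox n"
      "\<And>r. r \<in> tbox n \<Longrightarrow> norm (jcut (tcone r) (x (s n) - c)) \<le> 2 * norm (jcut (tcone r) (x (s n)))"
      "\<And>r. r \<in> tbox p \<Longrightarrow> norm (jcut (tcone r) (x (s n))) \<le> \<mu> r + mesh p"
      "\<And>r. mesh p \<le> \<mu> r \<Longrightarrow> r \<notin> tbox b \<Longrightarrow> path_functional r (x (s n) - c) = 0"
      by (rule path_correction[of "\<lambda>n. x (s n)" "\<lambda>n. B (s n)" \<mu> z "mesh p" \<eta> "max p (Suc m)" p])
        (use x low' high \<mu> z mesh_pos \<eta> in \<open>assumption | blast\<close>)+
    have pn: "tbox p \<subseteq> tbox n"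
      using nbc(1) by (intro box_mono) simp
    \<comment> \<open>The cone over the root is the whole tree, so the mass estimate at
      \<open>[]\<close> bounds the norm of the corrected vector; the root lies in the box since
      \<open>n\<close> is positive.\<close>
    have "[] \<in> tbox n"
      using nbc(1) by (simp add: tbox_def)
    moreover have "jcut (tcone []) v = v" for v
      by (rule jt_eqI) (simp, simp add: tcone_def)
    ultimately have "norm (x (s n) - c) \<le> 2"
      using nbc(7)[of "[]"] x[of "s n"] by simp
    moreover have "norm (jcut (tcone r) (x (s n) - c)) \<le> 2 * (\<mu> r + mesh p)" if "r \<in> tbox p" for r
      using nbc(7)[of r] nbc(8)[OF that] that pn by force
    moreover have "t \<in> tbox b - tbox p" if "jt_fun (x (s n) - c) t \<noteq> 0" for t
      using nbc(6)[OF that] pn by blast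
    ultimately have "P p m (n, b, c)"
      using nbc(1-5,9) unfolding P_def by simp
    then show ?thesis
      by blast
  qed
  define P0 where "P0 k a \<longleftrightarrow> (k = 0 \<longrightarrow> P 0 0 a)" for k :: nat and a
  have "\<exists>f. \<forall>k. P0 k (f k) \<and> P (fst (snd (f k))) (fst (f k)) (f (Suc k))"
  proof (rule dependent_nat_choice)
    show "\<exists>a. P0 0 a"
      using ex[of 0 0] unfolding P0_def by blast
    show "\<exists>a'. P0 (Suc k) a' \<and> P (fst (snd a)) (fst a) a'" for a k
      using ex[of "fst (snd a)" "fst a"] unfolding P0_def by blast
  qed
  then obtain f where f: "P 0 0 (f 0)" "\<And>k. P (fst (snd (f k))) (fst (f k)) (f (Suc k))"
    unfolding P0_def by blast
  define n where "n k = fst (f k)" for k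
  define c where "c k = snd (snd (f k))" for k
  define q where "q k = (case k of 0 \<Rightarrow> 0 | Suc j \<Rightarrow> fst (snd (f j)))" for k
  define m where "m k = (case k of 0 \<Rightarrow> 0 | Suc j \<Rightarrow> n j)" for k
  have "P (q k) (m k) (n k, q (Suc k), c k)" for k
    using f by (cases k) (simp_all add: q_def m_def n_def c_def)
  then have k: "q k \<le> n k" "m k < n k" "B (s (n k)) < q (Suc k)" "n k < q (Suc k)"
    "\<And>t. jt_fun (c k) t \<noteq> 0 \<Longrightarrow> t \<in> tbox (q (Suc k)) - tbox (B (s (n k)))" "\<bar>z (c k)\<bar> \<le> \<eta>"
    "\<And>t. jt_fun (x (s (n k)) - c k) t \<noteq> 0 \<Longrightarrow> t \<in> tbox (q (Suc k)) - tbox (q k)"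
    "\<And>r. r \<in> tbox (q k) \<Longrightarrow> norm (jcut (tcone r) (x (s (n k)) - c k)) \<le> 2 * (\<mu> r + mesh (q k))"
    "norm (x (s (n k)) - c k) \<le> 2"
    "\<And>r. mesh (q k) \<le> \<mu> r \<Longrightarrow> r \<notin> tbox (q (Suc k)) \<Longrightarrow> path_functional r (x (s (n k)) - c k) = 0" for k
    unfolding P_def prod.case by blast+
  have "strict_mono n"
    unfolding strict_mono_Suc_iff using k(2)[of "Suc _"] by (simp add: m_def)
  then have sn: "strict_mono (\<lambda>k. s (n k))"
    using strict_mono_o[OF s] by (simp add: o_def)
  have sq: "strict_mono q"
    unfolding strict_mono_Suc_iff using k(1,4) le_less_trans by blast
  show thesis
  proof (rule that[OF sn sq])
    show "q l \<le> s (n l)" for l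
      using k(1) strict_mono_imp_increasing[OF s] le_trans by blast
    show "B (s (n l)) < q (Suc l)" for l
      by (rule k(3))
    show "t \<in> tbox (q (Suc l)) - tbox (B (s (n l)))" if "jt_fun (c l) t \<noteq> 0" for l t
      by (rule k(5)[OF that])
    show "\<bar>z (c l)\<bar> \<le> \<eta>" for l
      by (rule k(6))
    show "t \<in> tbox (q (Suc l)) - tbox (q l)" if "jt_fun (x (s (n l)) - c l) t \<noteq> 0" for l t
      by (rule k(7)[OF that])
    show "norm (\<Sum>l<N. \<alpha> l *\<^sub>R (x (s (n l)) - c l)) \<le> 12 * L2_set \<alpha> {..<N}" for N \<alpha>
      by (rule corrected_sequence_upper_2[OF sq _ k(7) k(9) k(8) k(10)]) (simp add: q_def)
  qed
qed

section \<open>Lower estimates by norming vectors\<close>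

lemma norming_vector:
  assumes D: "order_convex D" and \<theta>: "0 \<le> \<theta>" "\<theta> < norm (fcut f D)"
  obtains x b where "norm x \<le> 1" "\<And>t. jt_fun x t \<noteq> 0 \<Longrightarrow> t \<in> D \<inter> tbox b" "\<theta> < blinfun_apply f x"
proof -
  have "\<not> (\<forall>x. norm (fcut f D x) \<le> \<theta> * norm x)"
    using norm_blinfun_bound[OF \<theta>(1), of "fcut f D"] \<theta>(2) by force
  then obtain x where x: "\<theta> * norm x < \<bar>fcut f D x\<bar>"
    by (auto simp: not_le)
  then have "x \<noteq> 0"
    by auto
  define y where "y = (sgn (fcut f D x) / norm x) *\<^sub>R x"
  have y1: "norm y \<le> 1"
    using \<open>x \<noteq> 0\<close> by (simp add: y_def sgn_if)
  have "fcut f D y = \<bar>fcut f D x\<bar> / norm x"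
    by (simp add: y_def blinfun.scaleR_right abs_sgn)
  then have "\<theta> < fcut f D y"
    using x \<open>x \<noteq> 0\<close> by (simp add: pos_less_divide_eq)
  moreover have "(\<lambda>k. fcut f D (jcut (tbox k) y)) \<longlonglongrightarrow> fcut f D y"
    by (intro tendsto_intros cut_box_tendsto)
  ultimately have "\<forall>\<^sub>F k in sequentially. \<theta> < fcut f D (jcut (tbox k) y)"
    by (intro order_tendstoD(1))
  then obtain b where b: "\<theta> < fcut f D (jcut (tbox b) y)"
    using eventually_happens'[OF sequentially_bot] by blast
  show thesis
  proof (rule that)
    show "norm (jcut D (jcut (tbox b) y)) \<le> 1"
      by (intro order_trans[OF norm_cut_le[OF D]] order_trans[OF norm_cut_le y1]) simp
    show "t \<in> D \<inter> tbox b" if "jt_fun (jcut D (jcut (tbox b) y)) t \<noteq> 0" for t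
      using that D by (auto simp: jt_fun_cut split: if_splits)
    show "\<theta> < f (jcut D (jcut (tbox b) y))"
      using b by (simp add: fcut_apply D)
  qed
qed

text \<open>Vectors norming the tails of \<open>z\<close> can be corrected at small cost if
  \<open>z\<close> is null on chains. Then \<open>z\<close> is at least \<open>\<delta> / 4\<close>
  on each corrected vector, while sums of \<open>N\<close> of them have norm at most
  \<open>12 * sqrt N\<close>; for large \<open>N\<close> this contradicts the boundedness of
  \<open>z\<close>.\<close>

lemma not_null_on_chains:
  assumes "z \<notin> B_inf"
  shows "\<not> null_on_chains z"
proof
  assume null: "null_on_chains z"
  obtain \<delta> where \<delta>: "0 < \<delta>" "\<And>n. \<delta> \<le> norm (fcut z (- tbox n))"
    using not_B_inf_tail[OF assms] by blast
  have "\<exists>x b. norm x \<le> 1 \<and> (\<forall>t. jt_fun x t \<noteq> 0 \<longrightarrow> t \<in> - tbox n \<inter> tbox b) \<and> \<delta> / 2 < z x" for n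
    by (rule norming_vector[of "- tbox n" "\<delta> / 2" z]) (use \<delta>(1) \<delta>(2)[of n] in auto)
  then obtain x B where x: "\<And>n. norm (x n) \<le> 1" "\<And>n t. jt_fun (x n) t \<noteq> 0 \<Longrightarrow> t \<in> - tbox n \<inter> tbox (B n)"
    "\<And>n. \<delta> / 2 < z (x n)"
    by metis
  have low: "t \<notin> tbox n" and high: "t \<in> tbox (B n)" if "jt_fun (x n) t \<noteq> 0" for n t
    using x(2)[OF that] by auto
  have \<delta>4: "0 < \<delta> / 4"
    using \<delta>(1) by simp
  obtain r :: "nat \<Rightarrow> nat" and c where rc: "\<And>l. \<bar>blinfun_apply z (c l)\<bar> \<le> \<delta> / 4"
    "\<And>N \<alpha>. norm (\<Sum>l<N. \<alpha> l *\<^sub>R (x (r l) - c l)) \<le> 12 * L2_set \<alpha> {..<N}"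
    by (rule corrected_subsequence[of x B z "\<delta> / 4", OF x(1) low high null \<delta>4], assumption+) (rule that)
  have "N * (\<delta> / 4) \<le> norm z * 12 * sqrt N" for N :: nat
  proof -
    have "N * (\<delta> / 4) = (\<Sum>l<N. \<delta> / 4)"
      by simp
    also have "\<dots> \<le> (\<Sum>l<N. z (x (r l) - c l))"
    proof (rule sum_mono)
      fix l
      show "\<delta> / 4 \<le> z (x (r l) - c l)"
        using x(3)[of "r l"] rc(1)[of l] by (simp add: blinfun.diff_right)
    qed
    also have "\<dots> = z (\<Sum>l<N. 1 *\<^sub>R (x (r l) - c l))"
      by (simp add: blinfun.sum_right)
    also have "\<dots> \<le> norm z * norm (\<Sum>l<N. 1 *\<^sub>R (x (r l) - c l))"
      using norm_blinfun_le abs_le_D1 by blast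
    also have "\<dots> \<le> norm z * (12 * L2_set (\<lambda>_. 1) {..<N})"
      by (intro mult_left_mono rc(2)) auto
    finally show ?thesis
      by (simp add: L2_set_def)
  qed
  then show False
    using linear_not_le_sqrt[OF \<delta>4, of "norm z * 12"] by (meson not_le)
qed

text \<open>Vectors norming \<open>w n\<close> are corrected with respect to the functional 0, since
  the corrections lie outside the support of every \<open>w (r j)\<close>. The corrected vectors are
  biorthogonal to the \<open>w (r k)\<close> up to factors of at least \<open>\<delta> / 2\<close>;
  pairing both sums with the same coefficients turns their upper 2-estimate into the lower
  one.\<close>

lemma weakly_null_lower_2:
  assumes w: "\<And>n. fcut (w n) (tbox (B n) - tbox n) = w n" and \<delta>: "0 < \<delta>" "\<And>n. \<delta> \<le> norm (w n)"
  obtains r :: "nat \<Rightarrow> nat" where "strict_mono r"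
    "\<And>N a. L2_set a {..<N} \<le> 24 / \<delta> * norm (\<Sum>k<N. a k *\<^sub>R w (r k))"
proof -
  have "\<exists>x b. norm x \<le> 1 \<and> (\<forall>t. jt_fun x t \<noteq> 0 \<longrightarrow> t \<in> (tbox (B n) - tbox n) \<inter> tbox b) \<and> \<delta> / 2 < w n x" for n
    by (rule norming_vector[of "tbox (B n) - tbox n" "\<delta> / 2" "w n"]) (use \<delta>(1) \<delta>(2)[of n] w[of n] in auto)
  then obtain x where x: "\<And>n. norm (x n) \<le> 1" "\<And>n t. jt_fun (x n) t \<noteq> 0 \<Longrightarrow> t \<in> tbox (B n) - tbox n"
    "\<And>n. \<delta> / 2 < w n (x n)"
    by (metis IntD1)
  have low: "t \<notin> tbox n" and high: "t \<in> tbox (B n)" if "jt_fun (x n) t \<noteq> 0" for n t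
    using x(2)[OF that] by auto
  have null: "null_on_chains 0"
    unfolding null_on_chains_def by (auto dest!: infinite_imp_nonempty)
  obtain r q c where r: "strict_mono r" and q: "strict_mono q" "\<And>l. q l \<le> r l" "\<And>l. B (r l) < q (Suc l)"
    and c: "\<And>l t. jt_fun (c l) t \<noteq> 0 \<Longrightarrow> t \<in> tbox (q (Suc l)) - tbox (B (r l))"
    and y: "\<And>l t. jt_fun (x (r l) - c l) t \<noteq> 0 \<Longrightarrow> t \<in> tbox (q (Suc l)) - tbox (q l)"
    and up: "\<And>N \<alpha>. norm (\<Sum>l<N. \<alpha> l *\<^sub>R (x (r l) - c l)) \<le> 12 * L2_set \<alpha> {..<N}"
    by (rule corrected_subsequence[of x B 0 1, OF x(1) low high null zero_less_one], assumption+) (rule that)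
  have vanish: "w n v = 0" if "\<And>t. t \<in> tbox (B n) - tbox n \<Longrightarrow> jt_fun v t = 0" for n v
  proof -
    have "jcut (tbox (B n) - tbox n) v = 0"
      by (rule jt_eqI) (use that in \<open>auto simp: jt_fun_zero\<close>)
    then show ?thesis
      using w[of n] by (metis blinfun.zero_right fcut_apply order_convex_shell)
  qed
  have off: "w (r k) (x (r j) - c j) = 0" if "k \<noteq> j" for k j
  proof (rule vanish)
    fix t assume t: "t \<in> tbox (B (r k)) - tbox (r k)"
    show "jt_fun (x (r j) - c j) t = 0"
    proof (rule ccontr)
      assume "jt_fun (x (r j) - c j) t \<noteq> 0"
      then have t': "t \<in> tbox (q (Suc j))" "t \<notin> tbox (q j)"
        using y by blast+
      show False
      proof (cases "k < j")
        case True
        then have "B (r k) \<le> q j"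
          using q(3)[of k] q(1) strict_mono_less_eq[of q "Suc k" j] by simp
        then show False
          using t t' box_mono by blast
      next
        case False
        then have "q (Suc j) \<le> r k"
          using q(2)[of k] q(1) strict_mono_less_eq[of q "Suc j" k] that by simp
        then show False
          using t t' box_mono by blast
      qed
    qed
  qed
  have diag: "\<delta> / 2 < w (r k) (x (r k) - c k)" for k
  proof -
    have "w (r k) (c k) = 0"
      by (rule vanish) (use c in blast)
    then show ?thesis
      using x(3)[of "r k"] by (simp add: blinfun.diff_right)
  qed
  have "L2_set a {..<N} \<le> 24 / \<delta> * norm (\<Sum>k<N. a k *\<^sub>R w (r k))" for N a
  proof -
    let ?L = "L2_set a {..<N}" and ?W = "\<Sum>k<N. a k *\<^sub>R w (r k)" and ?Y = "\<Sum>j<N. a j *\<^sub>R (x (r j) - c j)"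
    have "?W ?Y = (\<Sum>k<N. \<Sum>j<N. a k * (a j * w (r k) (x (r j) - c j)))"
      by (simp add: blinfun.sum_left blinfun.sum_right blinfun.scaleR_left blinfun.scaleR_right sum_distrib_left)
        (subst sum.swap, simp add: mult.left_commute)
    also have "\<dots> = (\<Sum>k<N. \<Sum>j<N. if j = k then a k * (a k * w (r k) (x (r k) - c k)) else 0)"
      using off by (intro sum.cong refl) auto
    also have "\<dots> = (\<Sum>k<N. (a k)\<^sup>2 * w (r k) (x (r k) - c k))"
      by (simp add: power2_eq_square mult.assoc)
    finally have W: "?W ?Y = (\<Sum>k<N. (a k)\<^sup>2 * w (r k) (x (r k) - c k))" .
    have "?L * ?L = (\<Sum>k<N. (a k)\<^sup>2)"
      by (simp add: L2_set_def sum_nonneg)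
    then have "\<delta> / 2 * (?L * ?L) = (\<Sum>k<N. (a k)\<^sup>2 * (\<delta> / 2))"
      by (simp add: sum_distrib_left mult.commute)
    also have "\<dots> \<le> ?W ?Y"
      unfolding W by (intro sum_mono mult_left_mono less_imp_le[OF diag]) auto
    also have "\<dots> \<le> norm ?W * norm ?Y"
      using norm_blinfun_le abs_le_D1 by blast
    also have "\<dots> \<le> norm ?W * (12 * ?L)"
      by (intro mult_left_mono up) auto
    finally have *: "(\<delta> / 2 * ?L) * ?L \<le> (12 * norm ?W) * ?L"
      by (simp add: mult_ac)
    have "\<delta> / 2 * ?L \<le> 12 * norm ?W"
    proof (cases "?L = 0")
      case False
      then have "0 < ?L"
        using L2_set_nonneg[of a "{..<N}"] by linarith
      then show ?thesis
        using * mult_right_le_imp_le by blast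
    qed simp
    then show ?thesis
      using \<delta>(1) by (simp add: field_simps)
  qed
  then show thesis
    using that r by blast
qed

section \<open>Schauder bases\<close>

lemma closed_span_subspace: "subspace (closed_span e)"
  and closed_span_closed: "closed (closed_span e)"
  by (simp_all add: closed_span_def subspace_closure)

lemma in_closed_span: "e n \<in> closed_span e"
  unfolding closed_span_def by (intro subsetD[OF closure_subset] span_base) auto

lemma partial_sum_in_closed_span: "(\<Sum>n\<in>A. a n *\<^sub>R e n) \<in> closed_span e"
  by (intro subspace_sum subspace_scale closed_span_subspace in_closed_span)

lemma sums_in_closed_span:
  assumes "(\<lambda>n. a n *\<^sub>R e n) sums x"
  shows "x \<in> closed_span e"
  by (rule closed_sequentially[OF closed_span_closed _ assms[unfolded sums_def]])
    (rule partial_sum_in_closed_span)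

lemma basic_sequence_unique:
  assumes "basic_sequence e" "(\<lambda>n. a n *\<^sub>R e n) sums x" "(\<lambda>n. b n *\<^sub>R e n) sums x"
  shows "a = b"
  using assms sums_in_closed_span[OF assms(2)] unfolding basic_sequence_def by blast

lemma basic_sequence_nonzero:
  assumes "basic_sequence e"
  shows "e n \<noteq> 0"
proof
  assume "e n = 0"
  then have "(\<lambda>k. (if k = n then 1 else 0 :: real) *\<^sub>R e k) = (\<lambda>k. 0)"
    by auto
  then have "(\<lambda>k. (if k = n then 1 else 0 :: real) *\<^sub>R e k) sums 0"
    by simp
  moreover have "(\<lambda>k. 0 *\<^sub>R e k) sums 0"
    by simp
  ultimately have "(\<lambda>k. if k = n then 1 else 0 :: real) = (\<lambda>k. 0)"
    by (rule basic_sequence_unique[OF assms])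
  from fun_cong[OF this, of n] show False
    by simp
qed

text \<open>The vectors whose expansions have partial sums bounded by \<open>m\<close> cover the
  closed span, so by Baire's theorem the closure of one of these sets \<open>E m\<close> has an
  interior point. Half differences of members of \<open>E m\<close> stay in \<open>E m\<close>,
  hence a ball around 0 lies in the closure, and scaling transfers this to all vectors.\<close>

lemma basic_sequence_approximation:
  fixes e :: "nat \<Rightarrow> 'a::banach"
  assumes basic: "basic_sequence e"
  shows "\<exists>K\<ge>0. \<forall>x\<in>closed_span e. \<exists>w a. (\<lambda>n. a n *\<^sub>R e n) sums w \<and>
    (\<forall>N. norm (\<Sum>n<N. a n *\<^sub>R e n) \<le> K * norm x) \<and> norm (x - w) \<le> norm x / 2"
proof -
  let ?Y = "closed_span e"
  define E where "E M = {w. \<exists>a. (\<lambda>n. a n *\<^sub>R e n) sums w \<and> (\<forall>N. norm (\<Sum>n<N. a n *\<^sub>R e n) \<le> M)}" for M :: real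
  have EY: "E M \<subseteq> ?Y" for M
    unfolding E_def by (auto intro: sums_in_closed_span)
  have cover: "\<exists>m::nat. w \<in> E m" if w: "w \<in> ?Y" for w
  proof -
    obtain a where a: "(\<lambda>n. a n *\<^sub>R e n) sums w"
      using basic[unfolded basic_sequence_def, rule_format, OF w] by (rule ex1E)
    then have "Bseq (\<lambda>N. \<Sum>n<N. a n *\<^sub>R e n)"
      unfolding sums_def by (intro convergent_imp_Bseq convergentI)
    then obtain M where M: "\<forall>N. norm (\<Sum>n<N. a n *\<^sub>R e n) \<le> M"
      unfolding Bseq_def by blast
    obtain m :: nat where "M \<le> m"
      using real_arch_simple by blast
    then have "\<forall>N. norm (\<Sum>n<N. a n *\<^sub>R e n) \<le> m"
      using M order_trans by blast
    then show ?thesis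
      using a unfolding E_def by blast
  qed
  have "\<exists>m::nat. top_of_set ?Y interior_of closure (E m) \<noteq> {}"
  proof (rule ccontr)
    assume no: "\<not> ?thesis"
    have "top_of_set ?Y interior_of \<Union>(range (\<lambda>m::nat. closure (E m))) = {}"
    proof (rule Baire_category_alt)
      show "completely_metrizable_space (top_of_set ?Y) \<or>
          locally_compact_space (top_of_set ?Y) \<and> regular_space (top_of_set ?Y)"
        using completely_metrizable_space_closedin[OF completely_metrizable_space_euclidean, of ?Y]
          closed_span_closed[of e] by simp
      show "closedin (top_of_set ?Y) T \<and> top_of_set ?Y interior_of T = {}"
        if T: "T \<in> range (\<lambda>m::nat. closure (E m))" for T
      proof -
        obtain m :: nat where m: "T = closure (E m)"
          using T by blast
        moreover have "closure (E m) \<subseteq> ?Y"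
          by (rule closure_minimal[OF EY closed_span_closed])
        ultimately show ?thesis
          using no by (simp add: closed_subset)
      qed
    qed simp
    moreover have "\<Union>(range (\<lambda>m::nat. closure (E m))) = ?Y"
    proof (intro equalityI UN_least closure_minimal[OF EY closed_span_closed] subsetI)
      fix w assume "w \<in> ?Y"
      then obtain m :: nat where "w \<in> E m"
        using cover by blast
      then show "w \<in> (\<Union>m::nat. closure (E m))"
        using closure_subset by fastforce
    qed
    moreover have "top_of_set ?Y interior_of ?Y = ?Y"
      using interior_of_topspace[of "top_of_set ?Y"] by simp
    ultimately have "?Y = {}"
      by simp
    then show False
      using in_closed_span[of e] by simp
  qed
  then obtain m :: nat and x0 where "x0 \<in> top_of_set ?Y interior_of closure (E m)"
    by blast
  then obtain U where U: "openin (top_of_set ?Y) U" "x0 \<in> U" "U \<subseteq> closure (E m)"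
    unfolding interior_of_def by (auto simp: mem_Collect_eq)
  then obtain \<rho> where \<rho>: "0 < \<rho>" "ball x0 \<rho> \<inter> ?Y \<subseteq> U" and x0: "x0 \<in> ?Y"
    using openin_contains_ball[of ?Y U] by (auto simp: subset_iff)
  have mid: "(1/2) *\<^sub>R (u - v) \<in> E m" if "u \<in> E m" "v \<in> E m" for u v
  proof -
    obtain a b where a: "(\<lambda>n. a n *\<^sub>R e n) sums u" "\<forall>N. norm (\<Sum>n<N. a n *\<^sub>R e n) \<le> m"
      and b: "(\<lambda>n. b n *\<^sub>R e n) sums v" "\<forall>N. norm (\<Sum>n<N. b n *\<^sub>R e n) \<le> m"
      using \<open>u \<in> E m\<close> \<open>v \<in> E m\<close> unfolding E_def by blast
    have eq: "(1/2) *\<^sub>R (a n *\<^sub>R e n - b n *\<^sub>R e n) = ((a n - b n) / 2) *\<^sub>R e n" for n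
      by (simp add: scaleR_diff_left diff_divide_distrib scaleR_diff_right)
    have "(\<lambda>n. ((a n - b n) / 2) *\<^sub>R e n) sums ((1/2) *\<^sub>R (u - v))"
      using sums_scaleR_right[OF sums_diff[OF a(1) b(1)], of "1/2"] by (simp only: eq)
    moreover have "norm (\<Sum>n<N. ((a n - b n) / 2) *\<^sub>R e n) \<le> m" for N
    proof -
      have "(\<Sum>n<N. ((a n - b n) / 2) *\<^sub>R e n) = (1/2) *\<^sub>R ((\<Sum>n<N. a n *\<^sub>R e n) - (\<Sum>n<N. b n *\<^sub>R e n))"
        unfolding eq[symmetric] scaleR_sum_right[symmetric] sum_subtractf ..
      then have "norm (\<Sum>n<N. ((a n - b n) / 2) *\<^sub>R e n) = norm ((\<Sum>n<N. a n *\<^sub>R e n) - (\<Sum>n<N. b n *\<^sub>R e n)) / 2"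
        by simp
      also have "\<dots> \<le> (m + m) / 2"
        using a(2)[rule_format, of N] b(2)[rule_format, of N]
          norm_triangle_ineq4[of "\<Sum>n<N. a n *\<^sub>R e n" "\<Sum>n<N. b n *\<^sub>R e n"] by (intro divide_right_mono) linarith+
      finally show ?thesis
        by simp
    qed
    ultimately show ?thesis
      unfolding E_def by (intro CollectI exI[of _ "\<lambda>n. (a n - b n) / 2"]) simp
  qed
  have near: "\<exists>w\<in>E m. norm (y - w) < \<epsilon>" if y: "y \<in> ?Y" "norm y < \<rho>" and \<epsilon>: "0 < \<epsilon>" for y \<epsilon>
  proof -
    have "x0 + y \<in> closure (E m)" "x0 - y \<in> closure (E m)"
      using y x0 \<rho> U(3) subspace_add[OF closed_span_subspace x0 y(1)] subspace_diff[OF closed_span_subspace x0 y(1)]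
      by (auto simp: dist_norm subset_iff)
    then obtain u v where uv: "u \<in> E m" "dist u (x0 + y) < \<epsilon>" "v \<in> E m" "dist v (x0 - y) < \<epsilon>"
      using \<epsilon> unfolding closure_approachable by blast
    have "y - (1/2) *\<^sub>R (u - v) = (1/2) *\<^sub>R ((x0 + y - u) - (x0 - y - v))"
      by (simp add: algebra_simps flip: scaleR_left_distrib)
    then have "norm (y - (1/2) *\<^sub>R (u - v)) \<le> (norm (x0 + y - u) + norm (x0 - y - v)) / 2"
      using norm_triangle_ineq4[of "x0 + y - u" "x0 - y - v"] by simp
    also have "\<dots> < \<epsilon>"
      using uv by (simp add: dist_norm norm_minus_commute)
    finally show ?thesis
      using mid[OF uv(1,3)] by blast
  qed
  \<comment> \<open>With the scaling \<open>c = \<rho> / (2 * norm x)\<close> below, the bound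
    \<open>m\<close> on partial sums becomes \<open>m / c = K * norm x\<close>.\<close>
  define K where "K = 2 * m / \<rho>"
  have "\<exists>w a. (\<lambda>n. a n *\<^sub>R e n) sums w \<and> (\<forall>N. norm (\<Sum>n<N. a n *\<^sub>R e n) \<le> K * norm x) \<and> norm (x - w) \<le> norm x / 2"
    if x: "x \<in> ?Y" for x
  proof (cases "x = 0")
    case True
    have "(\<lambda>n. 0 *\<^sub>R e n) sums 0"
      by simp
    then show ?thesis
      using True by (intro exI[of _ 0] exI[of _ "\<lambda>_. 0"]) simp
  next
    case False
    define c where "c = \<rho> / (2 * norm x)"
    have c: "0 < c"
      using False \<rho>(1) by (simp add: c_def)
    have "norm (c *\<^sub>R x) < \<rho>"
      using False \<rho>(1) by (simp add: c_def)
    moreover have "c *\<^sub>R x \<in> ?Y"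
      by (intro subspace_scale closed_span_subspace x)
    ultimately obtain w where w: "w \<in> E m" "norm (c *\<^sub>R x - w) < c * norm x / 2"
      using near[of "c *\<^sub>R x" "c * norm x / 2"] c False by auto
    then obtain a where a: "(\<lambda>n. a n *\<^sub>R e n) sums w" "\<forall>N. norm (\<Sum>n<N. a n *\<^sub>R e n) \<le> m"
      unfolding E_def by blast
    have "(\<lambda>n. (a n / c) *\<^sub>R e n) sums ((1 / c) *\<^sub>R w)"
      using sums_scaleR_right[OF a(1), of "1 / c"] by simp
    moreover have "norm (\<Sum>n<N. (a n / c) *\<^sub>R e n) \<le> K * norm x" for N
    proof -
      have "(\<Sum>n<N. (a n / c) *\<^sub>R e n) = (1 / c) *\<^sub>R (\<Sum>n<N. a n *\<^sub>R e n)"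
        by (simp add: scaleR_sum_right)
      then have "norm (\<Sum>n<N. (a n / c) *\<^sub>R e n) = norm (\<Sum>n<N. a n *\<^sub>R e n) / c"
        using c by simp
      also have "\<dots> \<le> m / c"
        using a(2) c by (intro divide_right_mono) auto
      finally show ?thesis
        by (simp add: c_def K_def mult_ac)
    qed
    moreover have "norm (x - (1 / c) *\<^sub>R w) \<le> norm x / 2"
    proof -
      have "x - (1 / c) *\<^sub>R w = (1 / c) *\<^sub>R (c *\<^sub>R x - w)"
        using c by (simp add: scaleR_diff_right)
      then have "norm (x - (1 / c) *\<^sub>R w) = norm (c *\<^sub>R x - w) / c"
        using c by simp
      also have "\<dots> \<le> (c * norm x / 2) / c"
        using w(2) c by (intro divide_right_mono) auto
      finally show ?thesis
        using c by simp
    qed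
    ultimately show ?thesis
      by (intro exI[of _ "(1 / c) *\<^sub>R w"] exI[of _ "\<lambda>n. a n / c"]) simp
  qed
  moreover have "0 \<le> K"
    using \<rho>(1) by (simp add: K_def)
  ultimately show ?thesis
    by blast
qed

text \<open>Banach's theorem on the continuity of the basis projections. The approximation provided by Baire's
  theorem is iterated; uniqueness identifies the sum of the resulting coefficients.\<close>

lemma basic_sequence_projection_bound:
  fixes e :: "nat \<Rightarrow> 'a::banach"
  assumes basic: "basic_sequence e"
  shows "\<exists>K. \<forall>x a. (\<lambda>n. a n *\<^sub>R e n) sums x \<longrightarrow> (\<forall>N. norm (\<Sum>n<N. a n *\<^sub>R e n) \<le> K * norm x)"
proof -
  let ?Y = "closed_span e"
  obtain K where K: "0 \<le> K" and ap: "\<forall>x\<in>?Y. \<exists>w a. (\<lambda>n. a n *\<^sub>R e n) sums w \<and>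
    (\<forall>N. norm (\<Sum>n<N. a n *\<^sub>R e n) \<le> K * norm x) \<and> norm (x - w) \<le> norm x / 2"
    using basic_sequence_approximation[OF basic] by blast
  obtain W where W: "\<forall>x\<in>?Y. \<exists>a. (\<lambda>n. a n *\<^sub>R e n) sums W x \<and>
    (\<forall>N. norm (\<Sum>n<N. a n *\<^sub>R e n) \<le> K * norm x) \<and> norm (x - W x) \<le> norm x / 2"
    using bchoice[OF ap] by blast
  obtain A where "\<forall>x\<in>?Y. (\<lambda>n. A x n *\<^sub>R e n) sums W x \<and>
    (\<forall>N. norm (\<Sum>n<N. A x n *\<^sub>R e n) \<le> K * norm x) \<and> norm (x - W x) \<le> norm x / 2"
    using bchoice[OF W] by blast
  then have WA: "(\<lambda>n. A x n *\<^sub>R e n) sums W x"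
    "norm (\<Sum>n<N. A x n *\<^sub>R e n) \<le> K * norm x" "norm (x - W x) \<le> norm x / 2" if "x \<in> ?Y" for x N
    using that by auto
  have "norm (\<Sum>n<N. a n *\<^sub>R e n) \<le> 2 * K * norm x" if a: "(\<lambda>n. a n *\<^sub>R e n) sums x" for x a N
  proof -
    \<comment> \<open>\<open>X j\<close> is the remainder after \<open>j\<close> approximations. Its
      norm is at least halved at every step, so the coefficients \<open>\<alpha> j\<close> obtained
      from the remainders are summable over \<open>j\<close>.\<close>
    define X where "X j = ((\<lambda>x. x - W x) ^^ j) x" for j
    define \<alpha> where "\<alpha> j = A (X j)" for j
    define S where "S j N = (\<Sum>n<N. \<alpha> j n *\<^sub>R e n)" for j N
    have X: "X 0 = x" "X (Suc j) = X j - W (X j)" for j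
      by (simp_all add: X_def)
    have XY: "X j \<in> ?Y" for j
    proof (induction j)
      case 0
      then show ?case
        using sums_in_closed_span[OF a] by (simp add: X)
    next
      case (Suc j)
      then show ?case
        using sums_in_closed_span[OF WA(1)[OF Suc]] by (simp add: X subspace_diff closed_span_subspace)
    qed
    have Xn: "norm (X j) \<le> norm x / 2 ^ j" for j
    proof (induction j)
      case 0
      then show ?case
        by (simp add: X)
    next
      case (Suc j)
      then show ?case
        using WA(3)[OF XY, of j] by (simp add: X)
    qed
    have Sb: "norm (S j N) \<le> (K * norm x) / 2 ^ j" for j N
      using order_trans[OF WA(2)[OF XY, of j N] mult_left_mono[OF Xn K]] by (simp add: S_def \<alpha>_def)
    have Ssum: "(\<lambda>N. S j N) \<longlonglongrightarrow> W (X j)" for j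
      using WA(1)[OF XY] by (simp add: sums_def S_def \<alpha>_def)
    have coef: "summable (\<lambda>j. \<alpha> j n)" for n
    proof (rule summable_comparison_test)
      have "0 < norm (e n)"
        using basic_sequence_nonzero[OF basic] by simp
      have "norm (\<alpha> j n) \<le> (2 * (K * norm x) / norm (e n)) * (1 / 2) ^ j" for j
      proof -
        have "\<alpha> j n *\<^sub>R e n = S j (Suc n) - S j n"
          by (simp add: S_def)
        then have "\<bar>\<alpha> j n\<bar> * norm (e n) \<le> norm (S j (Suc n)) + norm (S j n)"
          by (metis norm_scaleR norm_triangle_ineq4)
        also have "\<dots> \<le> 2 * ((K * norm x) / 2 ^ j)"
          using Sb[of j n] Sb[of j "Suc n"] by linarith
        finally have "\<bar>\<alpha> j n\<bar> \<le> 2 * ((K * norm x) / 2 ^ j) / norm (e n)"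
          unfolding pos_le_divide_eq[OF \<open>0 < norm (e n)\<close>] .
        also have "\<dots> = (2 * (K * norm x) / norm (e n)) * (1 / 2) ^ j"
          by (simp add: power_divide)
        finally show ?thesis
          by simp
      qed
      then show "\<exists>N. \<forall>j\<ge>N. norm (\<alpha> j n) \<le> (2 * (K * norm x) / norm (e n)) * (1 / 2) ^ j"
        by blast
      show "summable (\<lambda>j. (2 * (K * norm x) / norm (e n)) * (1 / 2) ^ j)"
        by (intro summable_mult summable_geometric) simp
    qed
    define b where "b n = (\<Sum>j. \<alpha> j n)" for n
    define T where "T J N = (\<Sum>j<J. S j N)" for J N
    have Tlim: "(\<lambda>J. T J N) \<longlonglongrightarrow> (\<Sum>n<N. b n *\<^sub>R e n)" for N
    proof -
      have "T J N = (\<Sum>n<N. (\<Sum>j<J. \<alpha> j n) *\<^sub>R e n)" for J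
        unfolding T_def S_def by (subst sum.swap) (simp add: scaleR_sum_left)
      moreover have "(\<lambda>J. \<Sum>n<N. (\<Sum>j<J. \<alpha> j n) *\<^sub>R e n) \<longlonglongrightarrow> (\<Sum>n<N. b n *\<^sub>R e n)"
        unfolding b_def by (intro tendsto_intros summable_LIMSEQ coef)
      ultimately show ?thesis
        by simp
    qed
    have step: "norm (T J' N - T J N) \<le> 2 * (K * norm x) / 2 ^ J - 2 * (K * norm x) / 2 ^ J'"
      if "J \<le> J'" for J J' N
      using that
    proof (induction rule: dec_induct)
      case base
      then show ?case
        by simp
    next
      case (step k)
      have "T (Suc k) N - T J N = (T k N - T J N) + S k N"
        by (simp add: T_def)
      then have "norm (T (Suc k) N - T J N) \<le> norm (T k N - T J N) + norm (S k N)"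
        by (metis norm_triangle_ineq)
      then show ?case
        using step.IH Sb[of k N] by simp
    qed
    have Ttail: "norm (T J' N - T J N) \<le> 2 * (K * norm x) / 2 ^ J" if "J \<le> J'" for J J' N
    proof -
      have "0 \<le> 2 * (K * norm x) / 2 ^ J'"
        using K by simp
      then show ?thesis
        using step[OF that, of N] by linarith
    qed
    \<comment> \<open>The estimate is uniform in the number \<open>N\<close> of terms, which permits
      interchanging the limits in \<open>J\<close> and \<open>N\<close>; for \<open>J = 0\<close> it
      is the projection bound itself.\<close>
    have btail: "norm ((\<Sum>n<N. b n *\<^sub>R e n) - T J N) \<le> 2 * (K * norm x) / 2 ^ J" for J N
      by (rule Lim_bounded[where M = J, OF tendsto_norm[OF tendsto_diff[OF Tlim tendsto_const]]])
        (use Ttail in blast)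
    have "(\<lambda>n. b n *\<^sub>R e n) sums x"
      unfolding sums_def
    proof (rule metric_LIMSEQ_I)
      fix \<epsilon> :: real assume \<epsilon>: "0 < \<epsilon>"
      have "(\<lambda>J. (2 * (K * norm x) + norm x) * (1 / 2) ^ J) \<longlonglongrightarrow> (2 * (K * norm x) + norm x) * 0"
        by (intro tendsto_intros LIMSEQ_power_zero) simp
      then have "(\<lambda>J. (2 * (K * norm x) + norm x) / 2 ^ J) \<longlonglongrightarrow> 0"
        by (simp add: power_divide)
      then obtain J where J: "(2 * (K * norm x) + norm x) / 2 ^ J < \<epsilon> / 2"
        using order_tendstoD(2)[of _ 0 sequentially "\<epsilon> / 2"] \<epsilon> eventually_happens'[OF sequentially_bot] by (metis half_gt_zero)
      have "(\<lambda>N. T J N) \<longlonglongrightarrow> (\<Sum>j<J. W (X j))"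
        unfolding T_def by (intro tendsto_intros Ssum)
      moreover have "(\<Sum>j<J. W (X j)) = x - X J"
        by (induction J) (simp_all add: X)
      ultimately have "(\<lambda>N. T J N) \<longlonglongrightarrow> x - X J"
        by simp
      then obtain N0 where N0: "\<And>N. N \<ge> N0 \<Longrightarrow> norm (T J N - (x - X J)) < \<epsilon> / 2"
        using \<epsilon> unfolding LIMSEQ_iff by (metis half_gt_zero)
      have "dist (\<Sum>n<N. b n *\<^sub>R e n) x < \<epsilon>" if "N \<ge> N0" for N
      proof -
        have eq: "(\<Sum>n<N. b n *\<^sub>R e n) - x = ((\<Sum>n<N. b n *\<^sub>R e n) - T J N) + (T J N - (x - X J)) - X J"
          by simp
        have "norm ((\<Sum>n<N. b n *\<^sub>R e n) - x)
            \<le> norm ((\<Sum>n<N. b n *\<^sub>R e n) - T J N) + norm (T J N - (x - X J)) + norm (X J)"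
          by (subst eq) (rule order_trans[OF norm_triangle_ineq4 add_right_mono[OF norm_triangle_ineq]])
        also have "\<dots> < 2 * (K * norm x) / 2 ^ J + \<epsilon> / 2 + norm x / 2 ^ J"
          using btail[of N J] N0[OF that] Xn[of J] by linarith
        also have "\<dots> < \<epsilon>"
          using J unfolding add_divide_distrib by linarith
        finally show ?thesis
          by (simp add: dist_norm)
      qed
      then show "\<exists>N0. \<forall>N\<ge>N0. dist (\<Sum>n<N. b n *\<^sub>R e n) x < \<epsilon>"
        by blast
    qed
    then have "a = b"
      by (rule basic_sequence_unique[OF basic a])
    then show ?thesis
      using btail[of N 0] by (simp add: T_def)
  qed
  then show ?thesis
    by blast
qed

text \<open>The \<open>N\<close>-th partial sum projection annihilates \<open>v m\<close> for
  \<open>m \<ge> N\<close> and is continuous, so it annihilates \<open>z\<close> as well.\<close>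

lemma basic_sequence_tail_limit:
  fixes e :: "nat \<Rightarrow> 'a::banach"
  assumes basic: "basic_sequence e" and v: "\<And>m. v m \<in> span (e ` {m..})" and lim: "v \<longlonglongrightarrow> z"
  shows "z = 0"
proof -
  obtain K where K: "\<And>x a N. (\<lambda>n. a n *\<^sub>R e n) sums x \<Longrightarrow> norm (\<Sum>n<N. a n *\<^sub>R e n) \<le> K * norm x"
    using basic_sequence_projection_bound[OF basic] by blast
  have ex: "\<exists>a. (\<lambda>n. a n *\<^sub>R e n) sums x \<and> (\<forall>n<m. a n = 0)" if "x \<in> span (e ` {m..})" for x m
    using that
  proof (induction rule: span_induct_alt)
    case base
    then show ?case
      by (intro exI[of _ "\<lambda>_. 0"]) simp
  next
    case (step c y x)
    then obtain k a where k: "y = e k" "m \<le> k" and a: "(\<lambda>n. a n *\<^sub>R e n) sums x" "\<forall>n<m. a n = 0"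
      by auto
    have "(\<lambda>n. if n = k then c *\<^sub>R e n else 0) sums (c *\<^sub>R e k)"
      by (rule sums_single)
    then have "(\<lambda>n. (if n = k then c *\<^sub>R e n else 0) + a n *\<^sub>R e n) sums (c *\<^sub>R y + x)"
      unfolding k by (intro sums_add a)
    moreover have "(\<lambda>n. (if n = k then c *\<^sub>R e n else 0) + a n *\<^sub>R e n) = (\<lambda>n. ((if n = k then c else 0) + a n) *\<^sub>R e n)"
      by (auto simp: scaleR_add_left)
    ultimately show ?case
      using a(2) k(2) by (intro exI[of _ "\<lambda>n. (if n = k then c else 0) + a n"]) auto
  qed
  have "v m \<in> closed_span e" for m
    unfolding closed_span_def using v[of m] span_mono[of "e ` {m..}" "range e"] closure_subset by blast
  then have "z \<in> closed_span e"
    using closed_sequentially[OF closed_span_closed _ lim] by blast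
  then obtain c where c: "(\<lambda>n. c n *\<^sub>R e n) sums z"
    using basic unfolding basic_sequence_def by blast
  have "(\<Sum>n<N. c n *\<^sub>R e n) = 0" for N
  proof -
    have "norm (\<Sum>n<N. c n *\<^sub>R e n) \<le> K * norm (z - v m)" if m: "N \<le> m" for m
    proof -
      obtain a where a: "(\<lambda>n. a n *\<^sub>R e n) sums v m" "\<forall>n<m. a n = 0"
        using ex[OF v] by blast
      have "(\<lambda>n. (c n - a n) *\<^sub>R e n) sums (z - v m)"
        using sums_diff[OF c a(1)] by (simp add: scaleR_diff_left)
      then have "norm (\<Sum>n<N. (c n - a n) *\<^sub>R e n) \<le> K * norm (z - v m)"
        by (rule K)
      moreover have "(\<Sum>n<N. (c n - a n) *\<^sub>R e n) = (\<Sum>n<N. c n *\<^sub>R e n)"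
        using a(2) m by (intro sum.cong) auto
      ultimately show ?thesis
        by simp
    qed
    moreover have "(\<lambda>m. K * norm (z - v m)) \<longlonglongrightarrow> K * norm (z - z)"
      by (intro tendsto_intros lim)
    ultimately have "norm (\<Sum>n<N. c n *\<^sub>R e n) \<le> K * norm (z - z)"
      by (intro LIMSEQ_le_const) auto
    then show ?thesis
      by simp
  qed
  then show ?thesis
    using c by (simp add: sums_def LIMSEQ_const_iff)
qed

text \<open>The Grunblum criterion. Projection bounds control each coefficient by the norm, so the
  coefficients of approximating finite combinations are Cauchy, and their limits expand
  \<open>x\<close>.\<close>

lemma basic_sequenceI:
  fixes y :: "nat \<Rightarrow> 'a::banach"
  assumes nz: "\<And>n. y n \<noteq> 0"
    and proj: "\<And>M N a. M \<le> N \<Longrightarrow> norm (\<Sum>n<M. a n *\<^sub>R y n) \<le> C * norm (\<Sum>n<N. a n *\<^sub>R y n)"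
  shows "basic_sequence y"
  unfolding basic_sequence_def
proof (intro ballI ex_ex1I)
  have C: "0 \<le> C"
    using proj[of 1 1 "\<lambda>_. 1"] nz[of 0] by (simp add: zero_le_mult_iff le_less)
       (smt (verit) mult_nonneg_nonpos norm_ge_zero norm_le_zero_iff)
  have coef: "\<bar>a n\<bar> * norm (y n) \<le> 2 * C * norm (\<Sum>n<N. a n *\<^sub>R y n)" if "n < N" for a n N
  proof -
    have "a n *\<^sub>R y n = (\<Sum>k<Suc n. a k *\<^sub>R y k) - (\<Sum>k<n. a k *\<^sub>R y k)"
      by simp
    then have "\<bar>a n\<bar> * norm (y n) \<le> norm (\<Sum>k<Suc n. a k *\<^sub>R y k) + norm (\<Sum>k<n. a k *\<^sub>R y k)"
      by (metis norm_scaleR norm_triangle_ineq4)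
    also have "\<dots> \<le> C * norm (\<Sum>n<N. a n *\<^sub>R y n) + C * norm (\<Sum>n<N. a n *\<^sub>R y n)"
      using that by (intro add_mono proj) auto
    finally show ?thesis
      by simp
  qed
  show "a = b" if a: "(\<lambda>n. a n *\<^sub>R y n) sums x" and b: "(\<lambda>n. b n *\<^sub>R y n) sums x" for a b x
  proof
    fix n
    have d: "(\<lambda>N. C * norm (\<Sum>n<N. (a n - b n) *\<^sub>R y n)) \<longlonglongrightarrow> 0"
      using tendsto_mult_right_zero[OF tendsto_norm_zero[OF sums_diff[OF a b, unfolded sums_def diff_self]], of C]
      by (simp add: scaleR_diff_left)
    have "(\<lambda>N. 2 * (C * norm (\<Sum>n<N. (a n - b n) *\<^sub>R y n))) \<longlonglongrightarrow> 2 * 0"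
      by (intro tendsto_intros d)
    then have "\<bar>a n - b n\<bar> * norm (y n) \<le> 2 * 0"
      by (rule LIMSEQ_le_const) (use coef[of n _ "\<lambda>n. a n - b n"] in \<open>auto intro!: exI[of _ "Suc n"] simp: mult.assoc\<close>)
    then show "a n = b n"
      using nz[of n] by (simp add: mult_le_0_iff)
  qed
  show "\<exists>a. (\<lambda>n. a n *\<^sub>R y n) sums x" if x: "x \<in> closed_span y" for x
  proof -
    obtain u where u: "\<And>k. u k \<in> span (range y)" "u \<longlonglongrightarrow> x"
      using x unfolding closed_span_def closure_sequential by blast
    have "\<exists>a N. u k = (\<Sum>n<N. a n *\<^sub>R y n) \<and> (\<forall>n\<ge>N. a n = 0)" for k
      using u(1)[of k]
    proof (induction rule: span_induct_alt)
      case base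
      then show ?case
        by (intro exI[of _ "\<lambda>_. 0"] exI[of _ 0]) simp
    next
      case (step c v w)
      then obtain m a N where m: "v = y m" and w: "w = (\<Sum>n<N. a n *\<^sub>R y n)" "\<forall>n\<ge>N. a n = 0"
        by blast
      let ?N = "max N (Suc m)" and ?b = "\<lambda>n. (if n = m then c else 0) + a n"
      have "w = (\<Sum>n<?N. a n *\<^sub>R y n)"
        unfolding w(1) using w(2) by (intro sum.mono_neutral_left) auto
      moreover have "c *\<^sub>R v = (\<Sum>n<?N. if n = m then c *\<^sub>R y n else 0)"
        by (simp add: m less_max_iff_disj)
      ultimately have "c *\<^sub>R v + w = (\<Sum>n<?N. (if n = m then c *\<^sub>R y n else 0) + a n *\<^sub>R y n)"
        by (simp only: sum.distrib)
      also have "\<dots> = (\<Sum>n<?N. ?b n *\<^sub>R y n)"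
        by (intro sum.cong) (auto simp: scaleR_add_left)
      finally show ?case
        using w(2) by (intro exI[of _ ?b] exI[of _ ?N]) auto
    qed
    then obtain a N where aN: "\<And>k. u k = (\<Sum>n<N k. a k n *\<^sub>R y n)" "\<And>k n. n \<ge> N k \<Longrightarrow> a k n = 0"
      by metis
    have long: "u k = (\<Sum>n<M. a k n *\<^sub>R y n)" if "N k \<le> M" for k M
      unfolding aN(1) using aN(2) that by (intro sum.mono_neutral_left) auto
    have diff: "u k - u l = (\<Sum>n<max M (max (N k) (N l)). (a k n - a l n) *\<^sub>R y n)" for k l M
      by (simp add: long[of k "max M (max (N k) (N l))"] long[of l "max M (max (N k) (N l))"]
        scaleR_diff_left sum_subtractf)
    have pd: "norm (\<Sum>n<M. (a k n - a l n) *\<^sub>R y n) \<le> C * norm (u k - u l)" for k l M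
      unfolding diff[of k l M] by (rule proj) simp
    have Cau: "Cauchy u"
      by (rule LIMSEQ_imp_Cauchy[OF u(2)])
    have "Cauchy (\<lambda>k. a k n)" for n
    proof (rule metric_CauchyI)
      fix e :: real assume e: "0 < e"
      have pos: "0 < e * norm (y n) / (2 * C + 1)"
        using e nz[of n] C by simp
      then obtain K where K: "\<forall>k\<ge>K. \<forall>l\<ge>K. norm (u k - u l) < e * norm (y n) / (2 * C + 1)"
        using Cau unfolding Cauchy_def dist_norm by blast
      have "dist (a k n) (a l n) < e" if "k \<ge> K" "l \<ge> K" for k l
      proof -
        have "\<bar>a k n - a l n\<bar> * norm (y n) \<le> 2 * C * norm (u k - u l)"
          unfolding diff[of k l "Suc n"] by (rule coef[of n _ "\<lambda>n. a k n - a l n"]) simp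
        also have "\<dots> \<le> (2 * C + 1) * norm (u k - u l)"
          by (intro mult_right_mono) auto
        also have "\<dots> < (2 * C + 1) * (e * norm (y n) / (2 * C + 1))"
          using K that C by (intro mult_strict_left_mono) auto
        also have "\<dots> = e * norm (y n)"
          using C by simp
        finally show ?thesis
          using nz[of n] by (simp add: dist_real_def)
      qed
      then show "\<exists>K. \<forall>k\<ge>K. \<forall>l\<ge>K. dist (a k n) (a l n) < e"
        by blast
    qed
    then have "\<exists>l. (\<lambda>k. a k n) \<longlonglongrightarrow> l" for n
      by (simp add: Cauchy_convergent_iff convergent_def)
    then obtain b where b: "\<And>n. (\<lambda>k. a k n) \<longlonglongrightarrow> b n"
      by metis
    have lim: "norm (\<Sum>n<M. (a k n - b n) *\<^sub>R y n) \<le> C * norm (u k - x)" for k M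
    proof (rule LIMSEQ_le)
      show "(\<lambda>l. norm (\<Sum>n<M. (a k n - a l n) *\<^sub>R y n)) \<longlonglongrightarrow> norm (\<Sum>n<M. (a k n - b n) *\<^sub>R y n)"
        by (intro tendsto_intros b)
      show "(\<lambda>l. C * norm (u k - u l)) \<longlonglongrightarrow> C * norm (u k - x)"
        by (intro tendsto_intros u(2))
      show "\<exists>N. \<forall>l\<ge>N. norm (\<Sum>n<M. (a k n - a l n) *\<^sub>R y n) \<le> C * norm (u k - u l)"
        using pd by blast
    qed
    have "(\<lambda>n. b n *\<^sub>R y n) sums x"
      unfolding sums_def
    proof (rule metric_LIMSEQ_I)
      fix e :: real assume e: "0 < e"
      then have "0 < e / (C + 1)"
        using C by simp
      then obtain k where k: "norm (u k - x) < e / (C + 1)"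
        using u(2) unfolding LIMSEQ_iff by blast
      have "dist (\<Sum>n<M. b n *\<^sub>R y n) x < e" if M: "M \<ge> N k" for M
      proof -
        have "(\<Sum>n<M. b n *\<^sub>R y n) - x = (u k - x) - (\<Sum>n<M. (a k n - b n) *\<^sub>R y n)"
          using long[OF M] by (simp add: scaleR_diff_left sum_subtractf)
        then have "norm ((\<Sum>n<M. b n *\<^sub>R y n) - x) \<le> norm (u k - x) + norm (\<Sum>n<M. (a k n - b n) *\<^sub>R y n)"
          by (metis norm_triangle_ineq4)
        also have "\<dots> \<le> (C + 1) * norm (u k - x)"
          using lim[of k M] by (simp add: algebra_simps)
        also have "\<dots> < (C + 1) * (e / (C + 1))"
          using k C by (intro mult_strict_left_mono) auto
        also have "\<dots> = e"
          using C by simp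
        finally show ?thesis
          by (simp add: dist_norm)
      qed
      then show "\<exists>N0. \<forall>M\<ge>N0. dist (\<Sum>n<M. b n *\<^sub>R y n) x < e"
        by blast
    qed
    then show ?thesis
      by blast
  qed
qed

section \<open>Duals and biduals\<close>

lemma dual_norm_le:
  assumes "subspace Y" "\<And>v. v \<in> Y \<Longrightarrow> \<bar>f v\<bar> \<le> c * norm v"
  shows "dual_norm Y f \<le> \<bar>c\<bar>"
  unfolding dual_norm_def
proof (rule cSUP_least)
  show "{v\<in>Y. norm v \<le> 1} \<noteq> {}"
    using subspace_0[OF assms(1)] by force
  fix v assume v: "v \<in> {v\<in>Y. norm v \<le> 1}"
  then have "\<bar>f v\<bar> \<le> c * norm v"
    using assms(2) by blast
  also have "\<dots> \<le> \<bar>c\<bar> * 1"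
    using v by (intro mult_mono) auto
  finally show "\<bar>f v\<bar> \<le> \<bar>c\<bar>"
    by simp
qed

lemma dual_on_bdd_above:
  assumes "f \<in> dual_on Y"
  shows "bdd_above ((\<lambda>v. \<bar>f v\<bar>) ` {v\<in>Y. norm v \<le> 1})"
proof -
  obtain C where C: "\<forall>v\<in>Y. \<bar>f v\<bar> \<le> C * norm v"
    using assms unfolding dual_on_def by blast
  have "\<bar>f v\<bar> \<le> \<bar>C\<bar>" if v: "v \<in> Y" "norm v \<le> 1" for v
  proof -
    have "\<bar>f v\<bar> \<le> \<bar>C\<bar> * norm v"
      using C v(1) mult_right_mono[OF abs_ge_self, of "norm v" C] by force
    also have "\<dots> \<le> \<bar>C\<bar> * 1"
      using v(2) by (intro mult_left_mono) auto
    finally show ?thesis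
      by simp
  qed
  then show ?thesis
    unfolding bdd_above_def by blast
qed

lemma dual_norm_nonneg:
  assumes "subspace Y" "f \<in> dual_on Y"
  shows "0 \<le> dual_norm Y f"
proof -
  have "\<bar>f 0\<bar> \<le> dual_norm Y f"
    unfolding dual_norm_def using subspace_0[OF assms(1)]
    by (intro cSUP_upper dual_on_bdd_above assms(2)) auto
  then show ?thesis
    by linarith
qed

lemma dual_norm_apply:
  assumes Y: "subspace Y" and f: "f \<in> dual_on Y" and v: "v \<in> Y"
  shows "\<bar>f v\<bar> \<le> norm v * dual_norm Y f"
proof (cases "v = 0")
  case True
  have "f (0 *\<^sub>R v) = 0 * f v"
    using f v unfolding dual_on_def by blast
  then show ?thesis
    using True by simp
next
  case False
  have "\<bar>f ((1 / norm v) *\<^sub>R v)\<bar> \<le> dual_norm Y f"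
    unfolding dual_norm_def using False Y v by (intro cSUP_upper dual_on_bdd_above f) (auto intro: subspace_scale)
  moreover have "f ((1 / norm v) *\<^sub>R v) = (1 / norm v) * f v"
    using f v unfolding dual_on_def by blast
  ultimately show ?thesis
    using False by (simp add: abs_mult field_simps)
qed

lemma dual_on_add: "subspace Y \<Longrightarrow> f \<in> dual_on Y \<Longrightarrow> g \<in> dual_on Y \<Longrightarrow> (\<lambda>x. f x + g x) \<in> dual_on Y"
  unfolding dual_on_def
proof (safe, goal_cases)
  case (1 x y)
  then show ?case by simp
next
  case (2 c x)
  then show ?case by (simp add: algebra_simps)
next
  case (3 C C')
  have "\<forall>x\<in>Y. \<bar>f x + g x\<bar> \<le> (C + C') * norm x"
  proof
    fix x assume "x \<in> Y"
    then have "\<bar>f x\<bar> \<le> C * norm x" "\<bar>g x\<bar> \<le> C' * norm x"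
      using 3 by blast+
    then show "\<bar>f x + g x\<bar> \<le> (C + C') * norm x"
      unfolding distrib_right by linarith
  qed
  then show ?case by blast
qed simp

lemma dual_on_scale: "f \<in> dual_on Y \<Longrightarrow> (\<lambda>x. c * f x) \<in> dual_on Y"
  unfolding dual_on_def
proof (safe, goal_cases)
  case (1 C x y)
  then show ?case by (simp add: algebra_simps)
next
  case (2 C a x)
  then show ?case by simp
next
  case (3 C)
  have "\<forall>x\<in>Y. \<bar>c * f x\<bar> \<le> (\<bar>c\<bar> * C) * norm x"
  proof
    fix x assume "x \<in> Y"
    then have "\<bar>f x\<bar> \<le> C * norm x"
      using 3 by blast
    then show "\<bar>c * f x\<bar> \<le> (\<bar>c\<bar> * C) * norm x"
      by (simp add: abs_mult mult_left_mono mult.assoc)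
  qed
  then show ?case by blast
qed simp

lemma dual_on_zero: "(\<lambda>x. 0) \<in> dual_on Y"
  unfolding dual_on_def by (auto intro: exI[of _ 0])

lemma canonical_in_bidual:
  assumes "subspace Y" "y \<in> Y"
  shows "canonical Y y \<in> bidual_on Y"
  unfolding bidual_on_def
proof (safe, goal_cases)
  case (1 f g)
  then show ?case
    using dual_on_add[OF assms(1) 1] by (simp add: canonical_def)
next
  case (2 c f)
  then show ?case
    using dual_on_scale[OF 2] by (simp add: canonical_def)
next
  case 3
  show ?case
    using dual_norm_apply[OF assms(1) _ assms(2)] by (auto simp: canonical_def)
next
  case (4 f)
  then show ?case
    by (simp add: canonical_def)
qed

lemma bidual_onD:
  assumes "\<phi> \<in> bidual_on Y" "f \<in> dual_on Y"
  shows "g \<in> dual_on Y \<Longrightarrow> \<phi> (\<lambda>x. f x + g x) = \<phi> f + \<phi> g" "\<phi> (\<lambda>x. c * f x) = c * \<phi> f"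
  using assms by (simp_all add: bidual_on_def)

lemma dual_onD:
  assumes "f \<in> dual_on Y" "x \<in> Y"
  shows "y \<in> Y \<Longrightarrow> f (x + y) = f x + f y" "f (c *\<^sub>R x) = c * f x"
  using assms by (simp_all add: dual_on_def)

lemma bidual_on_sum:
  fixes N :: nat
  assumes Y: "subspace Y" and \<phi>: "\<phi> \<in> bidual_on Y" and f: "\<And>n. f n \<in> dual_on Y"
  shows "(\<lambda>v. \<Sum>n<N. a n * f n v) \<in> dual_on Y \<and> \<phi> (\<lambda>v. \<Sum>n<N. a n * f n v) = (\<Sum>n<N. a n * \<phi> (f n))"
proof (induction N)
  case 0
  show ?case
    using bidual_onD(2)[OF \<phi> f, of 0] by (simp add: dual_on_zero)
next
  case (Suc N)
  have "\<phi> (\<lambda>v. (\<Sum>n<N. a n * f n v) + a N * f N v) = \<phi> (\<lambda>v. \<Sum>n<N. a n * f n v) + \<phi> (\<lambda>v. a N * f N v)"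
    by (rule bidual_onD(1)[OF \<phi> conjunct1[OF Suc] dual_on_scale[OF f]])
  moreover have "\<phi> (\<lambda>v. a N * f N v) = a N * \<phi> (f N)"
    by (rule bidual_onD(2)[OF \<phi> f])
  ultimately show ?case
    using Suc dual_on_add[OF Y _ dual_on_scale[OF f], of "\<lambda>v. \<Sum>n<N. a n * f n v"] by simp
qed

section \<open>Bases compared with test sequences\<close>

text \<open>The set \<^term>\<open>X\<close> consists of sequences of coordinates of test functionals; a basis is compared
  with the norm on the coefficient sequences that these induce.\<close>

locale test_sequences =
  fixes X :: "(nat \<Rightarrow> real) set"
  assumes bounded: "x \<in> X \<Longrightarrow> \<bar>x n\<bar> \<le> 1"
    and uminus: "x \<in> X \<Longrightarrow> (\<lambda>n. - x n) \<in> X"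
    and square_summable: "(\<And>N. (\<Sum>n<N. (x n)\<^sup>2) \<le> 1/4) \<Longrightarrow> x \<in> X"
    and truncate: "x \<in> X \<Longrightarrow> (\<lambda>n. if n < M then x n / 2 else 0) \<in> X"
    and blocks: "(\<And>j. z j \<in> X) \<Longrightarrow> (\<And>j. p j \<le> q j) \<Longrightarrow> (\<And>j. q j \<le> p (Suc j)) \<Longrightarrow> 0 < k \<Longrightarrow>
      (\<lambda>n. (\<Sum>j<k. if p j \<le> n \<and> n < q j then z j n else 0) / (3 * sqrt (real k))) \<in> X"
begin

lemma half_delta: "(\<lambda>k. if k = n then 1 / 2 else 0) \<in> X"
proof (rule square_summable)
  fix N :: nat
  have "(\<Sum>k<N. (if k = n then 1 / 2 else 0 :: real)\<^sup>2) = (\<Sum>k<N. if k = n then 1 / 4 else 0)"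
    by (intro sum.cong) (auto simp: power2_eq_square)
  then show "(\<Sum>k<N. (if k = n then 1 / 2 else 0 :: real)\<^sup>2) \<le> 1 / 4"
    by simp
qed

lemma zero_mem: "(\<lambda>n. 0) \<in> X"
  by (rule square_summable) simp

end

text \<open>The norm on finite combinations is equivalent, up to the factor \<open>K\<close>, to the
  supremum of the pairings with test sequences; the bound \<open>B\<close> stands in for this
  supremum.\<close>

locale test_basis = test_sequences X for X +
  fixes y :: "nat \<Rightarrow> 'a::banach" and K :: real
  assumes K_pos: "0 < K"
    and lower: "x \<in> X \<Longrightarrow> \<bar>\<Sum>n<N. a n * x n\<bar> \<le> K * norm (\<Sum>n<N. a n *\<^sub>R y n)"
    and upper: "(\<And>x. x \<in> X \<Longrightarrow> \<bar>\<Sum>n<N. a n * x n\<bar> \<le> B) \<Longrightarrow> norm (\<Sum>n<N. a n *\<^sub>R y n) \<le> K * B"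
begin

abbreviation "Y \<equiv> closed_span y"

lemmas subspace_Y = closed_span_subspace[of y]

lemma truncated_sum:
  fixes a :: "nat \<Rightarrow> real"
  assumes "M \<le> N"
  shows "(\<Sum>n<N. a n * (if n < M then x n / 2 else 0)) = (\<Sum>n<M. a n * x n) / 2"
proof -
  have "(\<Sum>n<N. a n * (if n < M then x n / 2 else 0)) = (\<Sum>n<M. a n * (if n < M then x n / 2 else 0))"
    using assms by (intro sum.mono_neutral_right) auto
  then show ?thesis
    by (simp add: sum_divide_distrib)
qed

lemma basis_nonzero: "y n \<noteq> 0"
proof
  assume "y n = 0"
  then have "(\<Sum>k<Suc n. (if k = n then 1 else 0 :: real) *\<^sub>R y k) = 0"
    by (intro sum.neutral) auto
  then have "\<bar>\<Sum>k<Suc n. (if k = n then 1 else 0) * (if k = n then 1 / 2 else 0 :: real)\<bar> \<le> 0"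
    using lower[OF half_delta[of n], of "\<lambda>k. if k = n then 1 else 0" "Suc n"] by simp
  moreover have "(\<Sum>k<Suc n. (if k = n then 1 else 0) * (if k = n then 1 / 2 else 0 :: real)) = 1 / 2"
    by simp
  ultimately show False
    by simp
qed

text \<open>Partial sums are dual to truncations of test sequences; the factor 2 undoes the halving
  in \<open>truncate\<close>.\<close>

lemma projection_bound:
  assumes "M \<le> N"
  shows "norm (\<Sum>n<M. a n *\<^sub>R y n) \<le> (2 * K\<^sup>2) * norm (\<Sum>n<N. a n *\<^sub>R y n)"
proof -
  have "norm (\<Sum>n<M. a n *\<^sub>R y n) \<le> K * (2 * K * norm (\<Sum>n<N. a n *\<^sub>R y n))"
  proof (rule upper)
    fix x assume x: "x \<in> X"
    show "\<bar>\<Sum>n<M. a n * x n\<bar> \<le> 2 * K * norm (\<Sum>n<N. a n *\<^sub>R y n)"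
      using lower[OF truncate[where M = M, OF x], where N = N and a = a] truncated_sum[OF assms, of a x] by simp
  qed
  then show ?thesis
    by (simp add: power2_eq_square mult_ac)
qed

lemma basic: "basic_sequence y"
  using basis_nonzero projection_bound by (rule basic_sequenceI)

text \<open>The value 0 off the span matches the convention that members of \<open>dual_on\<close>
  vanish outside the subspace.\<close>

definition coef :: "nat \<Rightarrow> 'a \<Rightarrow> real" where
  "coef n v = (if v \<in> Y then (SOME a. (\<lambda>n. a n *\<^sub>R y n) sums v) n else 0)"

lemma coef_sums:
  assumes "v \<in> Y"
  shows "(\<lambda>n. coef n v *\<^sub>R y n) sums v"
proof -
  obtain a where "(\<lambda>n. a n *\<^sub>R y n) sums v"
    using basic assms unfolding basic_sequence_def by blast
  then have "(\<lambda>n. (SOME a. (\<lambda>n. a n *\<^sub>R y n) sums v) n *\<^sub>R y n) sums v"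
    by (rule someI[of "\<lambda>a. (\<lambda>n. a n *\<^sub>R y n) sums v"])
  then show ?thesis
    using assms by (simp add: coef_def)
qed

lemma coef_unique:
  assumes "(\<lambda>n. a n *\<^sub>R y n) sums v"
  shows "coef n v = a n"
  using basic_sequence_unique[OF basic coef_sums[OF sums_in_closed_span[OF assms]] assms]
  by (rule fun_cong)

lemma coef_basis: "coef n (y m) = (if n = m then 1 else 0)"
proof (rule coef_unique)
  show "(\<lambda>n. (if n = m then 1 else 0) *\<^sub>R y n) sums y m"
    using sums_single[of m y] by (simp add: if_distrib[of "\<lambda>c. c *\<^sub>R y _"] cong: if_cong)
qed

lemma coef_linear:
  assumes "u \<in> Y" "v \<in> Y"
  shows "coef n (u + v) = coef n u + coef n v" "coef n (c *\<^sub>R u) = c * coef n u"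
proof -
  show "coef n (u + v) = coef n u + coef n v"
    by (rule coef_unique)
      (use sums_add[OF coef_sums[OF assms(1)] coef_sums[OF assms(2)]] in \<open>simp add: scaleR_add_left\<close>)
  show "coef n (c *\<^sub>R u) = c * coef n u"
    by (rule coef_unique) (use sums_scaleR_right[OF coef_sums[OF assms(1)], of c] in simp)
qed

lemma coef_partial_sums: "v \<in> Y \<Longrightarrow> (\<lambda>N. \<Sum>n<N. coef n v *\<^sub>R y n) \<longlonglongrightarrow> v"
  using coef_sums by (simp add: sums_def)

text \<open>A truncated test sequence applied to later partial sums sees the first \<open>N\<close>
  coefficients only; the norms of these partial sums converge to that of \<open>v\<close>, and the
  halving costs the factor 2.\<close>

lemma coef_test_le:
  assumes v: "v \<in> Y" and x: "x \<in> X"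
  shows "\<bar>\<Sum>n<N. coef n v * x n\<bar> \<le> 2 * K * norm v"
proof -
  have "(\<lambda>M. K * norm (\<Sum>n<M. coef n v *\<^sub>R y n)) \<longlonglongrightarrow> K * norm v"
    by (intro tendsto_intros coef_partial_sums v)
  moreover have "\<bar>(\<Sum>n<N. coef n v * x n) / 2\<bar> \<le> K * norm (\<Sum>n<M. coef n v *\<^sub>R y n)" if "N \<le> M" for M
    using lower[OF truncate[OF x, of N], of "\<lambda>n. coef n v" M]
    unfolding truncated_sum[OF that, of "\<lambda>n. coef n v" x] .
  ultimately have "\<bar>(\<Sum>n<N. coef n v * x n) / 2\<bar> \<le> K * norm v"
    by (intro LIMSEQ_le_const) auto
  then show ?thesis
    by simp
qed

lemma tail_test_vector:
  assumes "e \<le> norm (\<Sum>i=m..<n. a i *\<^sub>R y i)" "0 < e"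
  shows "\<exists>z\<in>X. e / (2 * K) \<le> (\<Sum>i=m..<n. a i * z i)"
proof (rule ccontr)
  assume no: "\<not> ?thesis"
  have restrict: "(\<Sum>i<n. (if m \<le> i then a i else 0) * x i) = (\<Sum>i=m..<n. a i * x i)" for x
    by (rule sum.mono_neutral_cong_right) auto
  have restrict': "(\<Sum>i<n. (if m \<le> i then a i else 0) *\<^sub>R y i) = (\<Sum>i=m..<n. a i *\<^sub>R y i)"
    by (rule sum.mono_neutral_cong_right) auto
  have "norm (\<Sum>i<n. (if m \<le> i then a i else 0) *\<^sub>R y i) \<le> K * (e / (2 * K))"
  proof (rule upper)
    fix x assume x: "x \<in> X"
    have small: "(\<Sum>i=m..<n. a i * z i) < e / (2 * K)" if "z \<in> X" for z
      using no that by (meson not_le)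
    show "\<bar>\<Sum>i<n. (if m \<le> i then a i else 0) * x i\<bar> \<le> e / (2 * K)"
      using small[OF x] small[OF uminus[OF x]] unfolding restrict by (simp add: sum_negf abs_le_iff)
  qed
  then show False
    using assms K_pos by (simp add: restrict')
qed

text \<open>If the series diverged, infinitely many successive blocks would be detected by test
  sequences with a fixed value \<open>\<theta>\<close>. By \<open>blocks\<close>, \<open>k\<close>
  of these glue to one test sequence at the price of \<open>3 * sqrt k\<close>, while the total
  value grows like \<open>k\<close>; bounded partial sums forbid this.\<close>

lemma boundedly_complete_basis: "boundedly_complete y"
  unfolding boundedly_complete_def
proof (intro conjI allI impI basic)
  fix a assume "bdd_above (range (\<lambda>n. norm (\<Sum>i<n. a i *\<^sub>R y i)))"
  then obtain B where B: "\<And>n. norm (\<Sum>i<n. a i *\<^sub>R y i) \<le> B"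
    by (auto simp: bdd_above_def)
  have test: "\<bar>\<Sum>n<N. a n * x n\<bar> \<le> K * B" if "x \<in> X" for x N
    using lower[OF that, of a N] mult_left_mono[OF B[of N], of K] K_pos by linarith
  show "summable (\<lambda>n. a n *\<^sub>R y n)"
  proof (rule ccontr)
    assume "\<not> summable (\<lambda>n. a n *\<^sub>R y n)"
    then obtain e where e: "0 < e" and ns: "\<And>N. \<exists>m\<ge>N. \<exists>n. \<not> norm (\<Sum>i=m..<n. a i *\<^sub>R y i) < e"
      unfolding summable_Cauchy by blast
    define \<theta> where "\<theta> = e / (2 * K)"
    have "\<exists>m n z. N \<le> m \<and> m \<le> n \<and> z \<in> X \<and> \<theta> \<le> (\<Sum>i=m..<n. a i * z i)" for N
    proof -
      obtain m n where mn: "N \<le> m" "e \<le> norm (\<Sum>i=m..<n. a i *\<^sub>R y i)"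
        using ns[of N] by (auto simp: not_less)
      then have "m \<le> n"
        using e by (cases "m \<le> n") auto
      then show ?thesis
        using tail_test_vector[OF mn(2) e] mn(1) unfolding \<theta>_def by blast
    qed
    then obtain fm fn fz where f: "\<And>N. N \<le> fm N" "\<And>N. fm N \<le> fn N" "\<And>N. fz N \<in> X"
      "\<And>N. \<theta> \<le> (\<Sum>i=fm N..<fn N. a i * fz N i)"
      by metis
    \<comment> \<open>Each block is sought beyond the end of the preceding one.\<close>
    define P where "P j = (fn ^^ j) 0" for j
    have P: "P (Suc j) = fn (P j)" for j
      by (simp add: P_def)
    have Pmono: "P i \<le> P j" if "i \<le> j" for i j
      by (rule lift_Suc_mono_le[OF _ that]) (use P f le_trans in metis)
    have "k * (\<theta> / 3) \<le> K * B * sqrt k" if k: "0 < k" for k :: nat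
    proof -
      define w where "w n = (\<Sum>j<k. if fm (P j) \<le> n \<and> n < fn (P j) then fz (P j) n else 0) / (3 * sqrt k)" for n
      have w: "w \<in> X"
        unfolding w_def by (rule blocks[OF f(3) f(2) _ k]) (metis P f(1))
      have "k * \<theta> = (\<Sum>j<k. \<theta>)"
        by simp
      also have "\<dots> \<le> (\<Sum>j<k. \<Sum>i=fm (P j)..<fn (P j). a i * fz (P j) i)"
        by (intro sum_mono f)
      also have "\<dots> = (\<Sum>j<k. \<Sum>i<P k. if fm (P j) \<le> i \<and> i < fn (P j) then a i * fz (P j) i else 0)"
      proof (rule sum.cong[OF refl])
        fix j assume "j \<in> {..<k}"
        then have "fn (P j) \<le> P k"
          using Pmono[of "Suc j" k] by (simp add: P)
        then show "(\<Sum>i=fm (P j)..<fn (P j). a i * fz (P j) i)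
            = (\<Sum>i<P k. if fm (P j) \<le> i \<and> i < fn (P j) then a i * fz (P j) i else 0)"
          by (intro sum.mono_neutral_cong_left) auto
      qed
      also have "\<dots> = (\<Sum>i<P k. a i * (\<Sum>j<k. if fm (P j) \<le> i \<and> i < fn (P j) then fz (P j) i else 0))"
        by (subst sum.swap) (simp add: sum_distrib_left if_distrib cong: if_cong)
      also have "\<dots> = (\<Sum>i<P k. 3 * sqrt k * (a i * w i))"
        by (intro sum.cong refl) (use k in \<open>simp add: w_def\<close>)
      also have "\<dots> = 3 * sqrt k * (\<Sum>i<P k. a i * w i)"
        by (rule sum_distrib_left[symmetric])
      also have "\<dots> \<le> 3 * sqrt k * (K * B)"
        using test[OF w, of "P k"] by (intro mult_left_mono) auto
      finally show ?thesis
        by (simp add: mult_ac)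
    qed
    moreover have "0 < \<theta> / 3"
      using e K_pos by (simp add: \<theta>_def)
    ultimately have "\<And>k::nat. k * (\<theta> / 3) \<le> K * B * sqrt k"
      by (metis linorder_not_le mult_zero_left mult_zero_right of_nat_0 order_refl real_sqrt_zero gr0I)
    then show False
      using linear_not_le_sqrt[OF \<open>0 < \<theta> / 3\<close>, of "K * B"] by (meson not_le)
  qed
qed

lemma coef_in_dual: "coef n \<in> dual_on Y"
  unfolding dual_on_def
proof (intro CollectI conjI ballI allI impI)
  show "\<exists>C. \<forall>v\<in>Y. \<bar>coef n v\<bar> \<le> C * norm v"
  proof (intro exI[of _ "4 * K"] ballI)
    fix v assume v: "v \<in> Y"
    have "(\<Sum>k<Suc n. coef k v * (if k = n then 1 / 2 else 0)) = coef n v / 2"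
      by simp
    then show "\<bar>coef n v\<bar> \<le> 4 * K * norm v"
      using coef_test_le[OF v half_delta[of n], of "Suc n"] by simp
  qed
qed (simp_all add: coef_linear, simp add: coef_def)

lemma coef_combination:
  shows "(\<lambda>v. \<Sum>n<N. x n * coef n v) \<in> dual_on Y"
    and "x \<in> X \<Longrightarrow> dual_norm Y (\<lambda>v. \<Sum>n<N. x n * coef n v) \<le> 2 * K"
proof -
  show "(\<lambda>v. \<Sum>n<N. x n * coef n v) \<in> dual_on Y"
  proof (induction N)
    case (Suc N)
    then show ?case
      using dual_on_add[OF subspace_Y Suc dual_on_scale[OF coef_in_dual]] by simp
  qed (simp add: dual_on_zero)
next
  assume x: "x \<in> X"
  have "dual_norm Y (\<lambda>v. \<Sum>n<N. x n * coef n v) \<le> \<bar>2 * K\<bar>"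
    by (rule dual_norm_le[OF subspace_Y]) (use coef_test_le[OF _ x, of _ N] in \<open>simp add: mult.commute\<close>)
  then show "dual_norm Y (\<lambda>v. \<Sum>n<N. x n * coef n v) \<le> 2 * K"
    using K_pos by simp
qed

text \<open>Combinations of coefficient functionals along a test sequence are bounded, so the series
  with coefficients \<open>\<phi> (coef n)\<close> has bounded partial sums, and bounded
  completeness sums it to a vector. Any further part of the bidual annihilates all the
  \<open>coef n\<close>.\<close>

lemma bidual_representative:
  assumes \<phi>: "\<phi> \<in> bidual_on Y"
  shows "\<exists>v\<in>Y. \<forall>n. coef n v = \<phi> (coef n)"
proof -
  obtain C where C: "\<forall>f\<in>dual_on Y. \<bar>\<phi> f\<bar> \<le> C * dual_norm Y f"
    using \<phi> unfolding bidual_on_def by blast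
  have "norm (\<Sum>n<N. \<phi> (coef n) *\<^sub>R y n) \<le> K * (\<bar>C\<bar> * (2 * K))" for N
  proof (rule upper)
    fix x assume x: "x \<in> X"
    have "\<bar>\<Sum>n<N. x n * \<phi> (coef n)\<bar> = \<bar>\<phi> (\<lambda>v. \<Sum>n<N. x n * coef n v)\<bar>"
      using bidual_on_sum[where f = coef and a = x and N = N, OF subspace_Y \<phi> coef_in_dual] by simp
    also have "\<dots> \<le> C * dual_norm Y (\<lambda>v. \<Sum>n<N. x n * coef n v)"
      using C coef_combination(1) by blast
    also have "\<dots> \<le> \<bar>C\<bar> * (2 * K)"
      using dual_norm_nonneg[OF subspace_Y coef_combination(1), of x N] coef_combination(2)[OF x, of N]
      by (intro mult_mono) auto
    finally show "\<bar>\<Sum>n<N. \<phi> (coef n) * x n\<bar> \<le> \<bar>C\<bar> * (2 * K)"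
      by (simp add: mult.commute)
  qed
  then have "bdd_above (range (\<lambda>n. norm (\<Sum>i<n. \<phi> (coef i) *\<^sub>R y i)))"
    unfolding bdd_above_def by blast
  then have "summable (\<lambda>n. \<phi> (coef n) *\<^sub>R y n)"
    by (rule boundedly_complete_basis[unfolded boundedly_complete_def, THEN conjunct2, rule_format])
  then have s: "(\<lambda>n. \<phi> (coef n) *\<^sub>R y n) sums (\<Sum>n. \<phi> (coef n) *\<^sub>R y n)"
    by (rule summable_sums)
  show ?thesis
    using sums_in_closed_span[OF s] coef_unique[OF s] by blast
qed

text \<open>A functional whose tail is small in the sense of the test sequences is a norm limit of combinations of
  the coefficient functionals, so that it cannot distinguish elements of the bidual with equal coefficients.\<close>

lemma bidual_eq_on_small_tail:
  assumes \<phi>: "\<phi> \<in> bidual_on Y" and v: "v \<in> Y" "\<And>n. coef n v = \<phi> (coef n)" and g: "g \<in> dual_on Y"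
    and tail: "\<And>\<epsilon>. 0 < \<epsilon> \<Longrightarrow> \<exists>N. \<exists>x\<in>X. \<forall>n. (if n < N then 0 else g (y n)) = \<epsilon> * x n"
  shows "\<phi> g = g v"
proof -
  obtain C where C: "\<forall>f\<in>dual_on Y. \<bar>\<phi> f\<bar> \<le> C * dual_norm Y f"
    using \<phi> unfolding bidual_on_def by blast
  have main: "\<bar>\<phi> g - g v\<bar> \<le> (\<bar>C\<bar> + norm v) * (2 * K) * \<epsilon>" if \<epsilon>: "0 < \<epsilon>" for \<epsilon>
  proof -
    obtain N x where x: "x \<in> X" "\<And>n. (if n < N then 0 else g (y n)) = \<epsilon> * x n"
      using tail[OF \<epsilon>] by blast
    \<comment> \<open>\<open>h\<close> is the finite part of \<open>g\<close>, on which
      \<open>\<phi>\<close> agrees with \<open>v\<close>. The difference \<open>g - h\<close> acts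
      on expansions through \<open>\<epsilon> * x n\<close>, which bounds its norm by
      \<open>2 * K * \<epsilon>\<close>.\<close>
    define h where "h u = (\<Sum>n<N. g (y n) * coef n u)" for u
    have h: "h \<in> dual_on Y" "\<phi> h = (\<Sum>n<N. g (y n) * \<phi> (coef n))"
      using bidual_on_sum[where f = coef and a = "\<lambda>n. g (y n)" and N = N, OF subspace_Y \<phi> coef_in_dual] by (simp_all add: h_def[abs_def])
    have hv: "h v = \<phi> h"
      by (simp add: h(2)) (simp add: h_def v(2))
    have dh: "(\<lambda>u. g u + (- 1) * h u) \<in> dual_on Y"
      by (intro dual_on_add[OF subspace_Y g] dual_on_scale h)
    have dn: "\<bar>g u + (- 1) * h u\<bar> \<le> (2 * K * \<epsilon>) * norm u" if u: "u \<in> Y" for u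
    proof -
      obtain Cg where Cg: "\<forall>u\<in>Y. \<bar>g u\<bar> \<le> Cg * norm u"
        using g unfolding dual_on_def by blast
      have "(\<lambda>M. g (\<Sum>n<M. coef n u *\<^sub>R y n)) \<longlonglongrightarrow> g u"
      proof (rule LIM_zero_cancel, rule Lim_null_comparison)
        show "\<forall>\<^sub>F M in sequentially. norm (g (\<Sum>n<M. coef n u *\<^sub>R y n) - g u)
            \<le> Cg * norm ((\<Sum>n<M. coef n u *\<^sub>R y n) - u)"
        proof (intro always_eventually allI)
          fix M
          let ?s = "\<Sum>n<M. coef n u *\<^sub>R y n"
          have s: "?s \<in> Y"
            by (rule partial_sum_in_closed_span)
          have "g (?s + (- 1) *\<^sub>R u) = g ?s + g ((- 1) *\<^sub>R u)"
            by (rule dual_onD(1)[OF g s subspace_scale[OF subspace_Y u]])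
          then have "g ?s - g u = g (?s - u)"
            using dual_onD(2)[OF g u, of "- 1"] by simp
          then show "norm (g ?s - g u) \<le> Cg * norm (?s - u)"
            using Cg subspace_diff[OF subspace_Y s u] by simp
        qed
        show "(\<lambda>M. Cg * norm ((\<Sum>n<M. coef n u *\<^sub>R y n) - u)) \<longlonglongrightarrow> 0"
          using tendsto_mult_right_zero[OF tendsto_norm_zero[OF LIM_zero[OF coef_partial_sums[OF u]]]] .
      qed
      then have lim: "(\<lambda>M. \<bar>g (\<Sum>n<M. coef n u *\<^sub>R y n) - h u\<bar>) \<longlonglongrightarrow> \<bar>g u - h u\<bar>"
        by (intro tendsto_intros)
      have "\<bar>g (\<Sum>n<M. coef n u *\<^sub>R y n) - h u\<bar> \<le> (2 * K * \<epsilon>) * norm u" if M: "N \<le> M" for M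
      proof -
        have "g (\<Sum>n<M. coef n u *\<^sub>R y n) = (\<Sum>n<M. coef n u * g (y n))"
          by (rule dual_on_sum[OF subspace_Y g in_closed_span])
        also have "\<dots> = (\<Sum>n<M. coef n u * (if n < N then 0 else g (y n))) + (\<Sum>n<M. if n < N then coef n u * g (y n) else 0)"
          unfolding sum.distrib[symmetric] by (intro sum.cong) auto
        also have "(\<Sum>n<M. if n < N then coef n u * g (y n) else 0) = h u"
          unfolding h_def using M by (intro sum.mono_neutral_cong_right) auto
        also have "(\<Sum>n<M. coef n u * (if n < N then 0 else g (y n))) = \<epsilon> * (\<Sum>n<M. coef n u * x n)"
          unfolding x(2) by (simp add: sum_distrib_left mult_ac)
        finally have "\<bar>g (\<Sum>n<M. coef n u *\<^sub>R y n) - h u\<bar> = \<epsilon> * \<bar>\<Sum>n<M. coef n u * x n\<bar>"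
          using \<epsilon> by (simp add: abs_mult)
        also have "\<dots> \<le> \<epsilon> * (2 * K * norm u)"
          using coef_test_le[OF u x(1), of M] \<epsilon> by (intro mult_left_mono) auto
        finally show ?thesis
          by (simp add: mult_ac)
      qed
      then have "\<bar>g u - h u\<bar> \<le> (2 * K * \<epsilon>) * norm u"
        using LIMSEQ_le_const2[OF lim] by blast
      then show ?thesis
        by simp
    qed
    then have "dual_norm Y (\<lambda>u. g u + (- 1) * h u) \<le> \<bar>2 * K * \<epsilon>\<bar>"
      by (rule dual_norm_le[OF subspace_Y])
    then have norm_le: "dual_norm Y (\<lambda>u. g u + (- 1) * h u) \<le> 2 * K * \<epsilon>"
      using K_pos \<epsilon> by simp
    have "\<phi> g - \<phi> h = \<phi> (\<lambda>u. g u + (- 1) * h u)"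
      using bidual_onD(1)[OF \<phi> g dual_on_scale[OF h(1), of "- 1"]] bidual_onD(2)[OF \<phi> h(1), of "- 1"] by simp
    then have "\<bar>\<phi> g - \<phi> h\<bar> \<le> C * dual_norm Y (\<lambda>u. g u + (- 1) * h u)"
      using C dh by simp
    also have "\<dots> \<le> \<bar>C\<bar> * (2 * K * \<epsilon>)"
      using dual_norm_nonneg[OF subspace_Y dh] norm_le by (intro mult_mono) auto
    finally have "\<bar>\<phi> g - \<phi> h\<bar> \<le> \<bar>C\<bar> * (2 * K * \<epsilon>)" .
    then show ?thesis
      using dn[OF v(1)] hv by (simp add: algebra_simps)
  qed
  have "\<bar>\<phi> g - g v\<bar> \<le> 0 + e" if "0 < e" for e
  proof -
    define c where "c = (\<bar>C\<bar> + norm v) * (2 * K) + 1"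
    have c: "0 < c"
      using K_pos by (auto simp: c_def intro!: add_nonneg_pos mult_nonneg_nonneg)
    have "\<bar>\<phi> g - g v\<bar> \<le> (\<bar>C\<bar> + norm v) * (2 * K) * (e / c)"
      using that c by (intro main) simp
    also have "\<dots> \<le> c * (e / c)"
      using that c by (intro mult_right_mono) (auto simp: c_def)
    finally show ?thesis
      using c by simp
  qed
  then have "\<bar>\<phi> g - g v\<bar> \<le> 0"
    by (rule field_le_epsilon)
  then show ?thesis
    by simp
qed

end

lemma square_sum_support_le:
  fixes f :: "'a \<Rightarrow> real"
  assumes "finite I" "card {i\<in>I. f i \<noteq> 0} \<le> c"
  shows "(\<Sum>i\<in>I. f i)\<^sup>2 \<le> c * (\<Sum>i\<in>I. (f i)\<^sup>2)"
proof -
  have "(\<Sum>i\<in>I. f i) = (\<Sum>i\<in>{i\<in>I. f i \<noteq> 0}. f i)"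
    using assms(1) by (intro sum.mono_neutral_right) auto
  then have "(\<Sum>i\<in>I. f i)\<^sup>2 \<le> card {i\<in>I. f i \<noteq> 0} * (\<Sum>i\<in>{i\<in>I. f i \<noteq> 0}. (f i)\<^sup>2)"
    by (simp only: square_sum_card_le)
  also have "\<dots> \<le> c * (\<Sum>i\<in>I. (f i)\<^sup>2)"
    using assms by (intro mult_mono sum_mono2) (auto intro: sum_nonneg)
  finally show ?thesis .
qed

lemma consecutive_le:
  fixes p q :: "nat \<Rightarrow> nat"
  assumes "\<And>j. p j \<le> q j" "\<And>j. q j \<le> p (Suc j)" "i < j"
  shows "q i \<le> p j"
proof -
  have "p i' \<le> p j'" if "i' \<le> j'" for i' j'
    by (rule lift_Suc_mono_le[OF _ that]) (use assms(1,2) le_trans in blast)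
  then have "p (Suc i) \<le> p j"
    using assms(3) by simp
  then show ?thesis
    using assms(2)[of i] by simp
qed

section \<open>Square summable test sequences\<close>

definition l2_tests :: "(nat \<Rightarrow> real) set" where
  "l2_tests = {x. \<forall>N. (\<Sum>n<N. (x n)\<^sup>2) \<le> 1}"

lemma l2_test_sequences: "test_sequences l2_tests"
proof
  fix x :: "nat \<Rightarrow> real" and n M
  assume x: "x \<in> l2_tests"
  have "(x n)\<^sup>2 \<le> (\<Sum>k<Suc n. (x k)\<^sup>2)"
    by (intro member_le_sum) auto
  also have "\<dots> \<le> 1"
    using x unfolding l2_tests_def by blast
  finally have "(x n)\<^sup>2 \<le> 1" .
  then show "\<bar>x n\<bar> \<le> 1"
    by (simp add: abs_square_le_1)
  show "(\<lambda>n. - x n) \<in> l2_tests"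
    using x by (simp add: l2_tests_def)
  have "(\<Sum>n<N. (if n < M then x n / 2 else 0)\<^sup>2) \<le> 1" for N
  proof -
    have "(\<Sum>n<N. (if n < M then x n / 2 else 0)\<^sup>2) \<le> (\<Sum>n<N. (x n)\<^sup>2)"
      by (intro sum_mono) (auto simp: power_divide)
    also have "\<dots> \<le> 1"
      using x by (simp add: l2_tests_def)
    finally show ?thesis .
  qed
  then show "(\<lambda>n. if n < M then x n / 2 else 0) \<in> l2_tests"
    by (simp add: l2_tests_def)
next
  fix x :: "nat \<Rightarrow> real" assume x: "\<And>N. (\<Sum>n<N. (x n)\<^sup>2) \<le> 1/4"
  have "(\<Sum>n<N. (x n)\<^sup>2) \<le> 1" for N
    using x[of N] by linarith
  then show "x \<in> l2_tests"
    by (simp add: l2_tests_def)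
next
  fix z :: "nat \<Rightarrow> nat \<Rightarrow> real" and p q :: "nat \<Rightarrow> nat" and k :: nat
  assume z: "\<And>j. z j \<in> l2_tests" and pq: "\<And>j. p j \<le> q j" "\<And>j. q j \<le> p (Suc j)" and k: "0 < k"
  define t where "t j n = (if p j \<le> n \<and> n < q j then z j n else 0)" for j n
  have "(\<Sum>n<N. ((\<Sum>j<k. t j n) / (3 * sqrt k))\<^sup>2) \<le> 1" for N
  proof -
    have one: "card {j\<in>{..<k}. t j n \<noteq> 0} \<le> 1" for n
    proof -
      have "i = j" if "t i n \<noteq> 0" "t j n \<noteq> 0" for i j
        using that consecutive_le[where p = p and q = q, OF pq, of i j] consecutive_le[where p = p and q = q, OF pq, of j i]
        by (cases i j rule: linorder_cases) (auto simp: t_def split: if_splits)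
      then show ?thesis
        by (simp add: card_le_Suc0_iff_eq)
    qed
    have "(\<Sum>n<N. (\<Sum>j<k. t j n)\<^sup>2) \<le> (\<Sum>n<N. \<Sum>j<k. (t j n)\<^sup>2)"
      using square_sum_support_le[OF finite_lessThan one] by (intro sum_mono) simp
    also have "\<dots> = (\<Sum>j<k. \<Sum>n<N. (t j n)\<^sup>2)"
      by (rule sum.swap)
    also have "\<dots> \<le> (\<Sum>j<k. 1)"
    proof (rule sum_mono)
      fix j
      have "(\<Sum>n<N. (t j n)\<^sup>2) \<le> (\<Sum>n<N. (z j n)\<^sup>2)"
        by (intro sum_mono) (auto simp: t_def)
      also have "\<dots> \<le> 1"
        using z[of j] by (simp add: l2_tests_def)
      finally show "(\<Sum>n<N. (t j n)\<^sup>2) \<le> 1" .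
    qed
    finally have "(\<Sum>n<N. (\<Sum>j<k. t j n)\<^sup>2) / (9 * k) \<le> k / (9 * k)"
      by (intro divide_right_mono) auto
    also have "k / (9 * k) \<le> (1::real)"
      using k by simp
    also have "(\<Sum>n<N. (\<Sum>j<k. t j n)\<^sup>2) / (9 * k) = (\<Sum>n<N. ((\<Sum>j<k. t j n) / (3 * sqrt k))\<^sup>2)"
      by (simp add: power_divide power_mult_distrib flip: sum_divide_distrib)
    finally show ?thesis .
  qed
  then show "(\<lambda>n. (\<Sum>j<k. if p j \<le> n \<and> n < q j then z j n else 0) / (3 * sqrt (real k))) \<in> l2_tests"
    by (simp add: l2_tests_def t_def)
qed

text \<open>Every functional on the span has square summable values on the basis, so its tails are
  small multiples of test sequences and \<open>bidual_eq_on_small_tail\<close> applies to all of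
  them.\<close>

theorem l2_basis_reflexive:
  assumes "test_basis l2_tests y K"
  shows "reflexive_space (closed_span y)"
proof -
  interpret test_basis l2_tests y K
    by (rule assms)
  have up: "norm (\<Sum>n<N. a n *\<^sub>R y n) \<le> K * L2_set a {..<N}" for N a
  proof (rule upper)
    fix x assume x: "x \<in> l2_tests"
    have "\<bar>\<Sum>n<N. a n * x n\<bar> \<le> (\<Sum>n<N. \<bar>a n\<bar> * \<bar>x n\<bar>)"
      using sum_abs[of "\<lambda>n. a n * x n" "{..<N}"] by (simp add: abs_mult)
    also have "\<dots> \<le> L2_set a {..<N} * L2_set x {..<N}"
      by (rule L2_set_mult_ineq)
    also have "\<dots> \<le> L2_set a {..<N} * 1"
    proof (intro mult_left_mono)
      show "L2_set x {..<N} \<le> 1"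
        using x by (simp add: l2_tests_def L2_set_def)
    qed simp
    finally show "\<bar>\<Sum>n<N. a n * x n\<bar> \<le> L2_set a {..<N}"
      by simp
  qed
  have "\<phi> \<in> canonical Y ` Y" if \<phi>: "\<phi> \<in> bidual_on Y" for \<phi>
  proof -
    obtain v where v: "v \<in> Y" "\<And>n. coef n v = \<phi> (coef n)"
      using bidual_representative[OF \<phi>] by blast
    have "\<phi> g = canonical Y v g" for g
    proof (cases "g \<in> dual_on Y")
      case True
      have summ: "summable (\<lambda>n. (g (y n))\<^sup>2)"
        by (rule dual_on_upper_2_summable[OF subspace_Y in_closed_span True up]) (use K_pos in simp)
      have "\<phi> g = g v"
      proof (rule bidual_eq_on_small_tail[OF \<phi> v True])
        fix \<epsilon> :: real assume \<epsilon>: "0 < \<epsilon>"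
        then obtain N where N: "\<forall>m\<ge>N. \<forall>n. norm (\<Sum>i=m..<n. (g (y i))\<^sup>2) < \<epsilon>\<^sup>2"
          using summ unfolding summable_Cauchy by (metis zero_less_power)
        define x where "x n = (if n < N then 0 else g (y n)) / \<epsilon>" for n
        have "(\<Sum>n<M. (x n)\<^sup>2) \<le> 1" for M
        proof -
          have "(\<Sum>n<M. (x n)\<^sup>2) = (\<Sum>n=N..<M. (x n)\<^sup>2)"
            by (rule sum.mono_neutral_right) (auto simp: x_def)
          also have "\<dots> = (\<Sum>n=N..<M. (g (y n))\<^sup>2) / \<epsilon>\<^sup>2"
            by (simp add: x_def power_divide sum_divide_distrib)
          also have "\<dots> \<le> \<epsilon>\<^sup>2 / \<epsilon>\<^sup>2"
            using N by (intro divide_right_mono) (auto simp: abs_less_iff intro: less_imp_le)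
          finally show ?thesis
            using \<epsilon> by simp
        qed
        then have "x \<in> l2_tests"
          by (simp add: l2_tests_def)
        moreover have "\<forall>n. (if n < N then 0 else g (y n)) = \<epsilon> * x n"
          using \<epsilon> by (simp add: x_def)
        ultimately show "\<exists>N. \<exists>x\<in>l2_tests. \<forall>n. (if n < N then 0 else g (y n)) = \<epsilon> * x n"
          by blast
      qed
      then show ?thesis
        using True by (simp add: canonical_def)
    next
      case False
      then show ?thesis
        using \<phi> by (simp add: canonical_def bidual_on_def)
    qed
    then show ?thesis
      using v(1) by blast
  qed
  then show ?thesis
    unfolding reflexive_space_def using canonical_in_bidual[OF subspace_Y] by blast
qed

section \<open>Test sequences of bounded quadratic variation\<close>

text \<open>A pair \<^term>\<open>(m, n)\<close> stands for the interval \<^term>\<open>{m..<n}\<close>.\<close>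

definition interval_family :: "(nat \<times> nat) set \<Rightarrow> bool" where
  "interval_family \<pi> \<longleftrightarrow> finite \<pi> \<and> (\<forall>p\<in>\<pi>. fst p < snd p) \<and>
    (\<forall>p\<in>\<pi>. \<forall>p'\<in>\<pi>. p \<noteq> p' \<longrightarrow> {fst p..<snd p} \<inter> {fst p'..<snd p'} = {})"

definition quad_var :: "(nat \<times> nat) set \<Rightarrow> (nat \<Rightarrow> real) \<Rightarrow> real" where
  "quad_var \<pi> x = (\<Sum>p\<in>\<pi>. (x (snd p) - x (fst p))\<^sup>2)"

text \<open>The prepended 0 makes the first value count as a jump, so that the variation also bounds
  the values themselves. Disjointness of half-open intervals lets consecutive ones share an
  endpoint, as in the James norm.\<close>

definition james_tests :: "(nat \<Rightarrow> real) set" where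
  "james_tests = {x. \<forall>\<pi>. interval_family \<pi> \<longrightarrow> quad_var \<pi> (case_nat 0 x) \<le> 1}"

lemma interval_family_subset: "interval_family \<pi> \<Longrightarrow> \<rho> \<subseteq> \<pi> \<Longrightarrow> interval_family \<rho>"
  unfolding interval_family_def by (meson finite_subset subsetD)

lemma interval_familyD:
  assumes "interval_family \<pi>"
  shows "finite \<pi>" "p \<in> \<pi> \<Longrightarrow> fst p < snd p"
    "p \<in> \<pi> \<Longrightarrow> p' \<in> \<pi> \<Longrightarrow> i \<in> {fst p..<snd p} \<Longrightarrow> i \<in> {fst p'..<snd p'} \<Longrightarrow> p = p'"
  using assms unfolding interval_family_def by blast+

lemma interval_family_inj:
  assumes "interval_family \<pi>"
  shows "inj_on fst \<pi>" "inj_on snd \<pi>"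
proof -
  show "inj_on fst \<pi>"
  proof (rule inj_onI)
    fix p p' assume "p \<in> \<pi>" "p' \<in> \<pi>" "fst p = fst p'"
    then show "p = p'"
      using interval_familyD(2,3)[OF assms, of p] interval_familyD(2)[OF assms, of p'] interval_familyD(3)[OF assms, of p p' "fst p"] by simp
  qed
  show "inj_on snd \<pi>"
  proof (rule inj_onI)
    fix p p' assume "p \<in> \<pi>" "p' \<in> \<pi>" "snd p = snd p'"
    then show "p = p'"
      using interval_familyD(2)[OF assms, of p] interval_familyD(2)[OF assms, of p'] interval_familyD(3)[OF assms, of p p' "snd p - 1"] by simp
  qed
qed

lemma card_crossing_le:
  assumes "interval_family \<pi>"
  shows "card {p\<in>\<pi>. fst p \<le> i \<and> i < snd p} \<le> 1"
  using interval_familyD(1)[OF assms] interval_familyD(3)[OF assms, of _ _ i]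
  by (auto simp: card_le_Suc0_iff_eq)

lemma quad_var_nonneg: "0 \<le> quad_var \<pi> x"
  by (simp add: quad_var_def sum_nonneg)

lemma quad_var_scale: "quad_var \<pi> (\<lambda>n. c * x n) = c\<^sup>2 * quad_var \<pi> x"
  by (simp add: quad_var_def sum_distrib_left power_mult_distrib flip: right_diff_distrib)

text \<open>Intervals inside the window contribute at most 1 altogether. The cut-off creates jumps
  only across its two ends; at most one interval crosses each end, and such a jump is at most
  1.\<close>

lemma quad_var_window:
  assumes w: "\<And>k. \<bar>w k\<bar> \<le> 1" "\<And>\<pi>. interval_family \<pi> \<Longrightarrow> quad_var \<pi> w \<le> 1" and \<pi>: "interval_family \<pi>"
  shows "quad_var \<pi> (\<lambda>k. if a < k \<and> k \<le> b then w k else 0) \<le> 3"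
proof -
  let ?g = "\<lambda>k. if a < k \<and> k \<le> b then w k else 0"
  let ?A = "{p\<in>\<pi>. a < fst p \<and> snd p \<le> b}" and ?B = "{p\<in>\<pi>. fst p \<le> a \<and> a < snd p}" and ?C = "{p\<in>\<pi>. fst p \<le> b \<and> b < snd p}"
  have fin: "finite \<pi>"
    using \<pi> by (simp add: interval_family_def)
  have w2: "(w k)\<^sup>2 \<le> 1" for k
    using w(1)[of k] by (simp add: abs_square_le_1)
  have "quad_var \<pi> ?g \<le> (\<Sum>p\<in>\<pi>. (if a < fst p \<and> snd p \<le> b then (w (snd p) - w (fst p))\<^sup>2 else 0)
    + (if fst p \<le> a \<and> a < snd p then 1 else 0) + (if fst p \<le> b \<and> b < snd p then 1 else 0))"
    unfolding quad_var_def
  proof (rule sum_mono)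
    fix p assume "p \<in> \<pi>"
    then have "fst p < snd p"
      using \<pi> by (simp add: interval_family_def)
    then show "(?g (snd p) - ?g (fst p))\<^sup>2 \<le> (if a < fst p \<and> snd p \<le> b then (w (snd p) - w (fst p))\<^sup>2 else 0)
      + (if fst p \<le> a \<and> a < snd p then 1 else 0) + (if fst p \<le> b \<and> b < snd p then 1 else 0)"
      using w2[of "fst p"] w2[of "snd p"] by auto
  qed
  also have "\<dots> = quad_var ?A w + card ?B + card ?C"
    using fin by (simp add: sum.distrib quad_var_def sum.inter_filter[symmetric])
  also have "\<dots> \<le> 1 + 1 + 1"
    using w(2)[OF interval_family_subset[OF \<pi>, of ?A]] card_crossing_le[OF \<pi>, of a] card_crossing_le[OF \<pi>, of b] by force
  finally show ?thesis
    by simp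
qed

lemma james_tests_bounded:
  assumes "x \<in> james_tests"
  shows "\<bar>case_nat 0 x k\<bar> \<le> 1"
proof (cases k)
  case (Suc n)
  have "interval_family {(0, k)}"
    by (simp add: interval_family_def Suc)
  then have "quad_var {(0, k)} (case_nat 0 x) \<le> 1"
    using assms unfolding james_tests_def by blast
  then show ?thesis
    by (simp add: quad_var_def abs_square_le_1 Suc)
qed simp

text \<open>The constants of \<open>test_sequences\<close> fit this example. Halving a window turns
  the bound 3 into 3/4; the inequality
  \<open>(u - v)\<^sup>2 \<le> 2 * u\<^sup>2 + 2 * v\<^sup>2\<close>, with each index occurring at
  most once as a left and once as a right end, explains 1/4; and at most two of \<open>k\<close>
  blocks contribute to a jump, which gives \<open>6 * k\<close> against
  \<open>9 * k\<close>.\<close>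

lemma james_test_sequences: "test_sequences james_tests"
proof
  fix x :: "nat \<Rightarrow> real" and n M
  assume x: "x \<in> james_tests"
  then have xv: "quad_var \<pi> (case_nat 0 x) \<le> 1" if "interval_family \<pi>" for \<pi>
    using that by (simp add: james_tests_def)
  show "\<bar>x n\<bar> \<le> 1"
    using james_tests_bounded[OF x, of "Suc n"] by simp
  have "case_nat 0 (\<lambda>n. - x n) = (\<lambda>k. - 1 * case_nat 0 x k)"
    by (auto split: nat.splits)
  then show "(\<lambda>n. - x n) \<in> james_tests"
    using xv by (simp only: james_tests_def mem_Collect_eq quad_var_scale) simp
  have eq: "case_nat 0 (\<lambda>n. if n < M then x n / 2 else 0) = (\<lambda>k. (1 / 2) * (if 0 < k \<and> k \<le> M then case_nat 0 x k else 0))"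
    by (auto split: nat.splits)
  show "(\<lambda>n. if n < M then x n / 2 else 0) \<in> james_tests"
    unfolding james_tests_def mem_Collect_eq eq quad_var_scale
    using quad_var_window[OF james_tests_bounded[OF x] xv, of _ 0 M] by (force simp: power2_eq_square)
next
  fix x :: "nat \<Rightarrow> real" assume x: "\<And>N. (\<Sum>n<N. (x n)\<^sup>2) \<le> 1/4"
  let ?x = "case_nat 0 x"
  have fin: "(\<Sum>k\<in>A. (?x k)\<^sup>2) \<le> 1/4" if A: "finite A" for A
  proof -
    obtain N where N: "A \<subseteq> {..<N}"
      using A finite_nat_iff_bounded by blast
    have "(\<Sum>k\<in>A. (?x k)\<^sup>2) \<le> (\<Sum>k<Suc N. (?x k)\<^sup>2)"
      using N by (intro sum_mono2) auto
    also have "\<dots> = (\<Sum>n<N. (x n)\<^sup>2)"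
      by (subst sum.lessThan_Suc_shift) simp
    finally show ?thesis
      using x[of N] by simp
  qed
  have "quad_var \<pi> ?x \<le> 1" if \<pi>: "interval_family \<pi>" for \<pi>
  proof -
    have f: "finite \<pi>"
      using \<pi> by (simp add: interval_family_def)
    have "(u - v)\<^sup>2 \<le> 2 * u\<^sup>2 + 2 * v\<^sup>2" for u v :: real
      using zero_le_power2[of "u + v"] by (simp add: power2_eq_square algebra_simps)
    then have "quad_var \<pi> ?x \<le> (\<Sum>p\<in>\<pi>. 2 * (?x (snd p))\<^sup>2 + 2 * (?x (fst p))\<^sup>2)"
      unfolding quad_var_def by (intro sum_mono)
    also have "\<dots> = 2 * (\<Sum>k\<in>snd ` \<pi>. (?x k)\<^sup>2) + 2 * (\<Sum>k\<in>fst ` \<pi>. (?x k)\<^sup>2)"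
      by (simp add: sum.distrib sum_distrib_left sum.reindex[OF interval_family_inj(1)[OF \<pi>]] sum.reindex[OF interval_family_inj(2)[OF \<pi>]])
    finally show ?thesis
      using fin[of "snd ` \<pi>"] fin[of "fst ` \<pi>"] f by simp
  qed
  then show "x \<in> james_tests"
    by (simp add: james_tests_def)
next
  fix z :: "nat \<Rightarrow> nat \<Rightarrow> real" and p q :: "nat \<Rightarrow> nat" and k :: nat
  assume z: "\<And>j. z j \<in> james_tests" and pq: "\<And>j. p j \<le> q j" "\<And>j. q j \<le> p (Suc j)" and k: "0 < k"
  define g where "g j i = (if p j < i \<and> i \<le> q j then case_nat 0 (z j) i else 0)" for j i
  have one: "card {j\<in>{..<k}. p j < i \<and> i \<le> q j} \<le> 1" for i
  proof -
    have "j = j'" if "p j < i" "i \<le> q j" "p j' < i" "i \<le> q j'" for j j'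
      using that consecutive_le[where p = p and q = q, OF pq, of j j'] consecutive_le[where p = p and q = q, OF pq, of j' j]
      by (cases j j' rule: linorder_cases) auto
    then show ?thesis
      by (simp add: card_le_Suc0_iff_eq)
  qed
  have g3: "quad_var \<pi> (g j) \<le> 3" if "interval_family \<pi>" for \<pi> j
    unfolding g_def[abs_def]
    using z[of j] that by (intro quad_var_window james_tests_bounded) (auto simp: james_tests_def)
  have two: "card {j\<in>{..<k}. g j i - g j i' \<noteq> 0} \<le> 2" for i i'
  proof -
    have "card {j\<in>{..<k}. g j i - g j i' \<noteq> 0} \<le> card ({j\<in>{..<k}. p j < i \<and> i \<le> q j} \<union> {j\<in>{..<k}. p j < i' \<and> i' \<le> q j})"
      by (intro card_mono) (auto simp: g_def split: if_splits)
    also have "\<dots> \<le> 1 + 1"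
      by (rule order_trans[OF card_Un_le add_mono[OF one one]])
    finally show ?thesis
      by simp
  qed
  have qv: "quad_var \<pi> (\<lambda>i. \<Sum>j<k. g j i) \<le> 6 * k" if \<pi>: "interval_family \<pi>" for \<pi>
  proof -
    have "quad_var \<pi> (\<lambda>i. \<Sum>j<k. g j i) = (\<Sum>p\<in>\<pi>. (\<Sum>j<k. g j (snd p) - g j (fst p))\<^sup>2)"
      by (simp add: quad_var_def sum_subtractf)
    also have "\<dots> \<le> (\<Sum>p\<in>\<pi>. 2 * (\<Sum>j<k. (g j (snd p) - g j (fst p))\<^sup>2))"
      using square_sum_support_le[OF finite_lessThan two] by (intro sum_mono) simp
    also have "\<dots> = 2 * (\<Sum>j<k. quad_var \<pi> (g j))"
      unfolding quad_var_def sum_distrib_left[symmetric] by (subst sum.swap) simp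
    also have "\<dots> \<le> 2 * (\<Sum>j<k. 3)"
      by (intro mult_left_mono sum_mono g3 \<pi>) auto
    finally show ?thesis
      by simp
  qed
  have eq: "case_nat 0 (\<lambda>n. (\<Sum>j<k. if p j \<le> n \<and> n < q j then z j n else 0) / (3 * sqrt (real k)))
      = (\<lambda>i. (1 / (3 * sqrt k)) * (\<Sum>j<k. g j i))"
  proof
    fix i
    show "case_nat 0 (\<lambda>n. (\<Sum>j<k. if p j \<le> n \<and> n < q j then z j n else 0) / (3 * sqrt (real k))) i
        = (1 / (3 * sqrt k)) * (\<Sum>j<k. g j i)"
      by (cases i) (auto simp: g_def less_Suc_eq_le Suc_le_eq cong: if_cong)
  qed
  show "(\<lambda>n. (\<Sum>j<k. if p j \<le> n \<and> n < q j then z j n else 0) / (3 * sqrt (real k))) \<in> james_tests"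
    unfolding james_tests_def mem_Collect_eq eq quad_var_scale
  proof (intro allI impI)
    fix \<pi> assume "interval_family \<pi>"
    then have "(1 / (3 * sqrt k))\<^sup>2 * quad_var \<pi> (\<lambda>i. \<Sum>j<k. g j i) \<le> (1 / (3 * sqrt k))\<^sup>2 * (6 * k)"
      by (intro mult_left_mono qv) auto
    also have "\<dots> \<le> 1"
      using k by (simp add: power_divide power_mult_distrib)
    finally show "(1 / (3 * sqrt k))\<^sup>2 * quad_var \<pi> (\<lambda>i. \<Sum>j<k. g j i) \<le> 1" .
  qed
qed

lemma bidual_on_combination:
  assumes Y: "subspace Y" and \<phi>: "\<phi> \<in> bidual_on Y" and \<psi>: "\<psi> \<in> bidual_on Y"
  shows "(\<lambda>f. \<phi> f + c * \<psi> f) \<in> bidual_on Y"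
proof -
  obtain C D where C: "\<forall>f\<in>dual_on Y. \<bar>\<phi> f\<bar> \<le> C * dual_norm Y f" and D: "\<forall>f\<in>dual_on Y. \<bar>\<psi> f\<bar> \<le> D * dual_norm Y f"
    using \<phi> \<psi> unfolding bidual_on_def by blast
  have "\<bar>\<phi> f + c * \<psi> f\<bar> \<le> (C + \<bar>c\<bar> * D) * dual_norm Y f" if "f \<in> dual_on Y" for f
  proof -
    have "\<bar>\<phi> f + c * \<psi> f\<bar> \<le> \<bar>\<phi> f\<bar> + \<bar>c\<bar> * \<bar>\<psi> f\<bar>"
      using abs_triangle_ineq[of "\<phi> f" "c * \<psi> f"] by (simp add: abs_mult)
    also have "\<dots> \<le> C * dual_norm Y f + \<bar>c\<bar> * (D * dual_norm Y f)"
      using C D that by (intro add_mono mult_left_mono) auto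
    finally show ?thesis
      by (simp add: algebra_simps)
  qed
  then have "\<exists>E. \<forall>f\<in>dual_on Y. \<bar>\<phi> f + c * \<psi> f\<bar> \<le> E * dual_norm Y f"
    by blast
  moreover have "\<forall>f. f \<notin> dual_on Y \<longrightarrow> \<phi> f + c * \<psi> f = 0"
    using \<phi> \<psi> by (simp add: bidual_on_def)
  ultimately show ?thesis
    unfolding bidual_on_def
    using bidual_onD[OF \<phi>] bidual_onD[OF \<psi>] by (simp add: algebra_simps)
qed

text \<open>A family that nearly realises the supremum of the quadratic variation leaves little for families further
  out.\<close>

lemma quad_var_tail:
  assumes bound: "\<And>\<pi>. interval_family \<pi> \<Longrightarrow> quad_var \<pi> G \<le> c" and \<epsilon>: "0 < \<epsilon>"
  shows "\<exists>N. \<forall>\<pi>. interval_family \<pi> \<longrightarrow> (\<forall>p\<in>\<pi>. N \<le> fst p) \<longrightarrow> quad_var \<pi> G \<le> \<epsilon>"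
proof -
  let ?Q = "(\<lambda>\<pi>. quad_var \<pi> G) ` {\<pi>. interval_family \<pi>}"
  have emp: "interval_family {}"
    by (simp add: interval_family_def)
  have bdd: "bdd_above ?Q" and ne: "?Q \<noteq> {}"
    using bound emp by (auto simp: bdd_above_def)
  have "Sup ?Q - \<epsilon> < Sup ?Q"
    using \<epsilon> by simp
  then obtain \<pi>0 where \<pi>0: "interval_family \<pi>0" "Sup ?Q - \<epsilon> < quad_var \<pi>0 G"
    using less_cSup_iff[OF ne bdd] by auto
  obtain N where N: "snd ` \<pi>0 \<subseteq> {..<N}"
    using \<pi>0(1) finite_nat_iff_bounded by (metis finite_imageI interval_familyD(1))
  have "quad_var \<pi> G \<le> \<epsilon>" if \<pi>: "interval_family \<pi>" "\<forall>p\<in>\<pi>. N \<le> fst p" for \<pi>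
  proof -
    have lt: "snd p < fst p'" if "p \<in> \<pi>0" "p' \<in> \<pi>" for p p'
      using N \<pi>(2) that by (fastforce simp: image_subset_iff)
    have dis: "\<pi>0 \<inter> \<pi> = {}"
      using lt interval_familyD(2)[OF \<pi>(1)] by fastforce
    have "interval_family (\<pi>0 \<union> \<pi>)"
      unfolding interval_family_def
    proof (intro conjI ballI impI)
      show "finite (\<pi>0 \<union> \<pi>)"
        using \<pi>0(1) \<pi>(1) by (simp add: interval_family_def)
      show "fst p < snd p" if "p \<in> \<pi>0 \<union> \<pi>" for p
        using that interval_familyD(2)[OF \<pi>0(1)] interval_familyD(2)[OF \<pi>(1)] by blast
      show "{fst p..<snd p} \<inter> {fst p'..<snd p'} = {}" if p: "p \<in> \<pi>0 \<union> \<pi>" "p' \<in> \<pi>0 \<union> \<pi>" "p \<noteq> p'" for p p'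
      proof (rule ccontr)
        assume "{fst p..<snd p} \<inter> {fst p'..<snd p'} \<noteq> {}"
        then obtain i where i: "i \<in> {fst p..<snd p}" "i \<in> {fst p'..<snd p'}"
          by blast
        show False
          using p i interval_familyD(3)[OF \<pi>0(1) _ _ i] interval_familyD(3)[OF \<pi>(1) _ _ i] lt[of p p'] lt[of p' p]
          by fastforce
      qed
    qed
    then have "quad_var (\<pi>0 \<union> \<pi>) G \<le> Sup ?Q"
      by (intro cSup_upper bdd) blast
    moreover have "quad_var (\<pi>0 \<union> \<pi>) G = quad_var \<pi>0 G + quad_var \<pi> G"
      unfolding quad_var_def using dis \<pi>0(1) \<pi>(1) by (intro sum.union_disjoint) (auto simp: interval_family_def)
    ultimately show ?thesis
      using \<pi>0(2) by linarith
  qed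
  then show ?thesis
    by blast
qed

lemma interval_family_shift:
  assumes \<pi>: "interval_family \<pi>"
  shows "interval_family (map_prod Suc Suc ` \<pi>)" "quad_var (map_prod Suc Suc ` \<pi>) x = quad_var \<pi> (\<lambda>n. x (Suc n))"
proof -
  have inj: "inj_on (map_prod Suc Suc) \<pi>"
    by (auto simp: inj_on_def)
  show "interval_family (map_prod Suc Suc ` \<pi>)"
    unfolding interval_family_def
  proof (intro conjI ballI impI)
    show "finite (map_prod Suc Suc ` \<pi>)"
      using \<pi> by (simp add: interval_family_def)
    show "fst p < snd p" if "p \<in> map_prod Suc Suc ` \<pi>" for p
      using that interval_familyD(2)[OF \<pi>] by auto
    show "{fst p..<snd p} \<inter> {fst p'..<snd p'} = {}"
      if p: "p \<in> map_prod Suc Suc ` \<pi>" "p' \<in> map_prod Suc Suc ` \<pi>" "p \<noteq> p'" for p p'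
    proof (rule ccontr)
      assume "{fst p..<snd p} \<inter> {fst p'..<snd p'} \<noteq> {}"
      then obtain i where i: "i \<in> {fst p..<snd p}" "i \<in> {fst p'..<snd p'}"
        by blast
      obtain a where a: "p = map_prod Suc Suc a" "a \<in> \<pi>"
        using p(1) by (rule imageE)
      obtain a' where a': "p' = map_prod Suc Suc a'" "a' \<in> \<pi>"
        using p(2) by (rule imageE)
      then have "i - 1 \<in> {fst a..<snd a}" "i - 1 \<in> {fst a'..<snd a'}"
        using i by (auto simp: a a')
      then show False
        using interval_familyD(3)[OF \<pi> a(2) a'(2)] a(1) a'(1) p(3) by blast
    qed
  qed
  show "quad_var (map_prod Suc Suc ` \<pi>) x = quad_var \<pi> (\<lambda>n. x (Suc n))"
    by (simp add: quad_var_def sum.reindex[OF inj])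
qed

section \<open>Spaces with a basis of James type\<close>

locale james_basis = test_basis james_tests y K for y :: "nat \<Rightarrow> 'a::banach" and K :: real
begin

lemma norm_basis_le: "norm (y m) \<le> K"
proof -
  have "norm (\<Sum>n<Suc m. (if n = m then 1 else 0) *\<^sub>R y n) \<le> K * 1"
  proof (rule upper)
    fix x :: "nat \<Rightarrow> real" assume x: "x \<in> james_tests"
    have "(\<Sum>n<Suc m. (if n = m then 1 else 0) * x n) = x m"
      by simp
    then show "\<bar>\<Sum>n<Suc m. (if n = m then 1 else 0) * x n\<bar> \<le> 1"
      using bounded[OF x] by simp
  qed
  moreover have "(\<Sum>n<Suc m. (if n = m then 1 else 0) *\<^sub>R y n) = y m"
    by (simp add: if_distrib[of "\<lambda>c. c *\<^sub>R y _"] cong: if_cong)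
  ultimately show ?thesis
    by simp
qed

text \<open>For a family \<open>\<pi>\<close> the functional is tested on the sum of the differences
  \<open>y (snd p) - y (fst p)\<close>, weighted by the jumps of \<open>g\<close> itself. By
  Cauchy-Schwarz against the test sequences this vector has norm at most \<open>K * Q\<close>, while
  \<open>g\<close> takes the value \<open>Q * Q\<close> there.\<close>

lemma dual_quad_var_bounded:
  assumes g: "g \<in> dual_on Y"
  shows "\<exists>c. \<forall>\<pi>. interval_family \<pi> \<longrightarrow> quad_var \<pi> (\<lambda>n. g (y n)) \<le> c"
proof -
  obtain C where C: "\<forall>v\<in>Y. \<bar>g v\<bar> \<le> C * norm v"
    using g unfolding dual_on_def by blast
  have "quad_var \<pi> (\<lambda>n. g (y n)) \<le> (\<bar>C\<bar> * K)\<^sup>2" if \<pi>: "interval_family \<pi>" for \<pi>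
  proof -
    have fin: "finite \<pi>"
      by (rule interval_familyD(1)[OF \<pi>])
    obtain N where N: "fst ` \<pi> \<union> snd ` \<pi> \<subseteq> {..<N}"
      using fin finite_nat_iff_bounded by (metis finite_UnI finite_imageI)
    define b where "b p = g (y (snd p)) - g (y (fst p))" for p
    define a where "a n = (\<Sum>p\<in>\<pi>. b p * ((if n = snd p then 1 else 0) - (if n = fst p then 1 else 0)))" for n
    define Q where "Q = sqrt (quad_var \<pi> (\<lambda>n. g (y n)))"
    have Q: "Q * Q = quad_var \<pi> (\<lambda>n. g (y n))" "0 \<le> Q"
      by (simp_all add: Q_def quad_var_nonneg)
    have QL2: "Q = L2_set b \<pi>"
      by (simp add: Q_def b_def quad_var_def L2_set_def)
    have pick: "(\<Sum>n<N. a n * x n) = (\<Sum>p\<in>\<pi>. b p * (x (snd p) - x (fst p)))" for x :: "nat \<Rightarrow> real"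
    proof -
      have "(\<Sum>n<N. a n * x n) = (\<Sum>n<N. \<Sum>p\<in>\<pi>. b p * ((if n = snd p then x n else 0) - (if n = fst p then x n else 0)))"
        unfolding a_def sum_distrib_right by (intro sum.cong refl) auto
      also have "\<dots> = (\<Sum>p\<in>\<pi>. b p * ((\<Sum>n<N. if n = snd p then x n else 0) - (\<Sum>n<N. if n = fst p then x n else 0)))"
        by (subst sum.swap) (simp add: sum_distrib_left[symmetric] sum_subtractf)
      also have "\<dots> = (\<Sum>p\<in>\<pi>. b p * (x (snd p) - x (fst p)))"
        using N by (intro sum.cong refl) (auto simp: image_subset_iff)
      finally show ?thesis .
    qed
    have "norm (\<Sum>n<N. a n *\<^sub>R y n) \<le> K * Q"
    proof (rule upper)
      fix x :: "nat \<Rightarrow> real" assume x: "x \<in> james_tests"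
      have "\<bar>\<Sum>n<N. a n * x n\<bar> \<le> (\<Sum>p\<in>\<pi>. \<bar>b p\<bar> * \<bar>x (snd p) - x (fst p)\<bar>)"
        unfolding pick using sum_abs[of "\<lambda>p. b p * (x (snd p) - x (fst p))" \<pi>] by (simp add: abs_mult)
      also have "\<dots> \<le> L2_set b \<pi> * L2_set (\<lambda>p. x (snd p) - x (fst p)) \<pi>"
        by (rule L2_set_mult_ineq)
      also have "\<dots> \<le> L2_set b \<pi> * 1"
      proof (intro mult_left_mono)
        have "quad_var (map_prod Suc Suc ` \<pi>) (case_nat 0 x) \<le> 1"
          using x interval_family_shift(1)[OF \<pi>] unfolding james_tests_def by blast
        then have "quad_var \<pi> x \<le> 1"
          by (simp add: interval_family_shift(2)[OF \<pi>])
        then show "L2_set (\<lambda>p. x (snd p) - x (fst p)) \<pi> \<le> 1"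
          by (simp add: L2_set_def quad_var_def)
      qed simp
      finally show "\<bar>\<Sum>n<N. a n * x n\<bar> \<le> Q"
        by (simp add: QL2)
    qed
    then have "\<bar>C\<bar> * norm (\<Sum>n<N. a n *\<^sub>R y n) \<le> \<bar>C\<bar> * (K * Q)"
      by (intro mult_left_mono) auto
    moreover have "g (\<Sum>n<N. a n *\<^sub>R y n) \<le> \<bar>C\<bar> * norm (\<Sum>n<N. a n *\<^sub>R y n)"
    proof -
      have "g (\<Sum>n<N. a n *\<^sub>R y n) \<le> C * norm (\<Sum>n<N. a n *\<^sub>R y n)"
        using C partial_sum_in_closed_span[of a y "{..<N}"] by force
      also have "\<dots> \<le> \<bar>C\<bar> * norm (\<Sum>n<N. a n *\<^sub>R y n)"
        by (intro mult_right_mono) auto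
      finally show ?thesis .
    qed
    moreover have "g (\<Sum>n<N. a n *\<^sub>R y n) = Q * Q"
      using pick[of "\<lambda>n. g (y n)"] dual_on_sum[where x = y and a = a and I = "{..<N}", OF subspace_Y g in_closed_span]
      by (simp add: Q(1) quad_var_def b_def power2_eq_square)
    ultimately have "Q * Q \<le> (\<bar>C\<bar> * K) * Q"
      by simp
    then have "Q \<le> \<bar>C\<bar> * K"
      using Q(2) K_pos by (cases "Q = 0") (auto simp: mult_le_cancel_right)
    then show ?thesis
      using Q(1,2) power_mono[of Q "\<bar>C\<bar> * K" 2] by (simp add: power2_eq_square)
  qed
  then show ?thesis
    by blast
qed

lemma dual_limit:
  assumes g: "g \<in> dual_on Y"
  shows "convergent (\<lambda>n. g (y n))"
proof -
  obtain c where c: "\<And>\<pi>. interval_family \<pi> \<Longrightarrow> quad_var \<pi> (\<lambda>n. g (y n)) \<le> c"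
    using dual_quad_var_bounded[OF g] by blast
  have "Cauchy (\<lambda>n. g (y n))"
  proof (rule CauchyI')
    fix e :: real assume e: "0 < e"
    then have "0 < e\<^sup>2 / 2"
      by simp
    then obtain N where N: "\<And>\<pi>. interval_family \<pi> \<Longrightarrow> (\<forall>p\<in>\<pi>. N \<le> fst p) \<Longrightarrow> quad_var \<pi> (\<lambda>n. g (y n)) \<le> e\<^sup>2 / 2"
      using quad_var_tail[of "\<lambda>n. g (y n)" c] c by blast
    have "dist (g (y m)) (g (y n)) < e" if "N \<le> m" "m < n" for m n
    proof -
      have "quad_var {(m, n)} (\<lambda>n. g (y n)) \<le> e\<^sup>2 / 2"
        using that by (intro N) (auto simp: interval_family_def)
      also have "\<dots> < e\<^sup>2"
        using e by simp
      finally have "\<bar>g (y n) - g (y m)\<bar>\<^sup>2 < e\<^sup>2"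
        by (simp add: quad_var_def)
      then have "\<bar>g (y n) - g (y m)\<bar> < e"
        by (rule power_less_imp_less_base) (use e in simp)
      then show ?thesis
        by (simp add: dist_real_def abs_minus_commute)
    qed
    then show "\<exists>M. \<forall>m\<ge>M. \<forall>n>m. dist (g (y m)) (g (y n)) < e"
      by blast
  qed
  then show ?thesis
    by (simp add: Cauchy_convergent_iff)
qed

text \<open>Cutting off the first \<open>N\<close> values creates a jump across \<open>N\<close>.
  Since the values tend to 0 it adds at most a quarter of \<open>\<epsilon>\<^sup>2\<close>, and the
  intervals beyond add at most half of it.\<close>

lemma dual_null_tail:
  assumes g: "g \<in> dual_on Y" and null: "(\<lambda>n. g (y n)) \<longlonglongrightarrow> 0" and \<epsilon>: "0 < \<epsilon>"
  shows "\<exists>N. \<exists>x\<in>james_tests. \<forall>n. (if n < N then 0 else g (y n)) = \<epsilon> * x n"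
proof -
  obtain c where c: "\<And>\<pi>. interval_family \<pi> \<Longrightarrow> quad_var \<pi> (\<lambda>n. g (y n)) \<le> c"
    using dual_quad_var_bounded[OF g] by blast
  have "0 < \<epsilon>\<^sup>2 / 2"
    using \<epsilon> by simp
  then obtain N1 where N1: "\<And>\<pi>. interval_family \<pi> \<Longrightarrow> (\<forall>p\<in>\<pi>. N1 \<le> fst p) \<Longrightarrow> quad_var \<pi> (\<lambda>n. g (y n)) \<le> \<epsilon>\<^sup>2 / 2"
    using quad_var_tail[of "\<lambda>n. g (y n)" c] c by blast
  obtain N2 where N2: "\<And>n. n \<ge> N2 \<Longrightarrow> \<bar>g (y n)\<bar> < \<epsilon> / 2"
    using null \<epsilon> unfolding LIMSEQ_iff by (metis diff_zero half_gt_zero real_norm_def)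
  define N where "N = max N1 N2"
  \<comment> \<open>\<open>w\<close> is the tail with the prepended 0, hence the index shift by
    one.\<close>
  define w where "w k = (if N < k then g (y (k - 1)) else 0)" for k
  have "quad_var \<pi> w \<le> \<epsilon>\<^sup>2" if \<pi>: "interval_family \<pi>" for \<pi>
  proof -
    let ?A = "{p\<in>\<pi>. N < fst p}" and ?B = "{p\<in>\<pi>. fst p \<le> N \<and> N < snd p}"
    have fin: "finite \<pi>"
      by (rule interval_familyD(1)[OF \<pi>])
    have "quad_var \<pi> w \<le> (\<Sum>p\<in>\<pi>. (if N < fst p then (w (snd p) - w (fst p))\<^sup>2 else 0)
        + (if fst p \<le> N \<and> N < snd p then \<epsilon>\<^sup>2 / 4 else 0))"
      unfolding quad_var_def
    proof (rule sum_mono)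
      fix p assume "p \<in> \<pi>"
      then have p: "fst p < snd p"
        using interval_familyD(2)[OF \<pi>] by blast
      have "(w (snd p))\<^sup>2 \<le> (\<epsilon> / 2)\<^sup>2" if "N < snd p"
      proof -
        have "N2 < snd p"
          using that by (simp add: N_def)
        then have "N2 \<le> snd p - 1"
          by linarith
        then show ?thesis
          using N2[of "snd p - 1"] \<epsilon> that by (intro abs_le_square_iff[THEN iffD1]) (simp add: w_def)
      qed
      then show "(w (snd p) - w (fst p))\<^sup>2 \<le> (if N < fst p then (w (snd p) - w (fst p))\<^sup>2 else 0)
        + (if fst p \<le> N \<and> N < snd p then \<epsilon>\<^sup>2 / 4 else 0)"
        using p by (auto simp: w_def power_divide split: if_splits)
    qed
    also have "\<dots> = quad_var ?A w + card ?B * (\<epsilon>\<^sup>2 / 4)"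
      using fin by (simp add: sum.distrib quad_var_def sum.inter_filter[symmetric])
    also have "quad_var ?A w \<le> \<epsilon>\<^sup>2 / 2"
    proof -
      define \<rho> where "\<rho> = map_prod (\<lambda>k. k - 1) (\<lambda>k. k - 1) ` ?A"
      have A: "interval_family ?A"
        by (rule interval_family_subset[OF \<pi>]) auto
      have A\<rho>: "?A = map_prod Suc Suc ` \<rho>"
        unfolding \<rho>_def image_image using interval_familyD(2)[OF A]
        by (auto simp: image_iff map_prod_def split: prod.splits) force+
      have \<rho>: "interval_family \<rho>"
        unfolding interval_family_def
      proof (intro conjI ballI impI)
        show "finite \<rho>"
          using fin by (simp add: \<rho>_def)
        show "fst p < snd p" if "p \<in> \<rho>" for p
          using that interval_familyD(2)[OF \<pi>] unfolding \<rho>_def by fastforce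
        show "{fst p..<snd p} \<inter> {fst p'..<snd p'} = {}" if p: "p \<in> \<rho>" "p' \<in> \<rho>" "p \<noteq> p'" for p p'
        proof (rule ccontr)
          assume "{fst p..<snd p} \<inter> {fst p'..<snd p'} \<noteq> {}"
          then obtain i where i: "i \<in> {fst p..<snd p}" "i \<in> {fst p'..<snd p'}"
            by blast
          have "map_prod Suc Suc p \<in> ?A" "map_prod Suc Suc p' \<in> ?A"
            unfolding A\<rho> using p by blast+
          from interval_familyD(3)[OF A this, of "Suc i"] i have "map_prod Suc Suc p = map_prod Suc Suc p'"
            by simp
          then show False
            using p(3) by (metis prod.inj_map inj_Suc injD)
        qed
      qed
      have "quad_var ?A w = quad_var \<rho> (\<lambda>n. w (Suc n))"
        unfolding A\<rho> by (rule interval_family_shift(2)[OF \<rho>])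
      also have "\<dots> = quad_var \<rho> (\<lambda>n. g (y n))"
        unfolding quad_var_def
      proof (intro sum.cong refl)
        fix p assume "p \<in> \<rho>"
        then have mem: "map_prod Suc Suc p \<in> ?A"
          unfolding A\<rho> by blast
        then have "N < Suc (fst p)" "Suc (fst p) < Suc (snd p)"
          using interval_familyD(2)[OF A mem] by simp_all
        then show "(w (Suc (snd p)) - w (Suc (fst p)))\<^sup>2 = (g (y (snd p)) - g (y (fst p)))\<^sup>2"
          by (simp add: w_def)
      qed
      also have "\<dots> \<le> \<epsilon>\<^sup>2 / 2"
      proof (rule N1[OF \<rho>], rule ballI)
        fix p assume "p \<in> \<rho>"
        then have "map_prod Suc Suc p \<in> ?A"
          unfolding A\<rho> by blast
        then have "N < Suc (fst p)"
          by auto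
        then show "N1 \<le> fst p"
          by (simp add: N_def)
      qed
      finally show ?thesis .
    qed
    also have "card ?B * (\<epsilon>\<^sup>2 / 4) \<le> 1 * (\<epsilon>\<^sup>2 / 4)"
      using card_crossing_le[OF \<pi>, of N] by (intro mult_right_mono) auto
    finally show ?thesis
      using zero_le_power2[of \<epsilon>] by linarith
  qed
  then have "quad_var \<pi> (\<lambda>k. (1 / \<epsilon>) * w k) \<le> 1" if "interval_family \<pi>" for \<pi>
    using that \<epsilon> unfolding quad_var_scale by (simp add: power_divide pos_divide_le_eq)
  moreover have "case_nat 0 (\<lambda>n. (if n < N then 0 else g (y n)) / \<epsilon>) = (\<lambda>k. (1 / \<epsilon>) * w k)"
    by (auto simp: w_def split: nat.splits)
  ultimately have "(\<lambda>n. (if n < N then 0 else g (y n)) / \<epsilon>) \<in> james_tests"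
    by (simp add: james_tests_def)
  then show ?thesis
    using \<epsilon> by (intro exI[of _ N] bexI[of _ "\<lambda>n. (if n < N then 0 else g (y n)) / \<epsilon>"]) auto
qed

text \<open>The only jump is the one from the prepended 0. Consequently the sum of the coefficients
  is a continuous functional that equals 1 on the whole basis; it is the functional missed by the
  closed span of the \<open>coef n\<close>.\<close>

lemma one_in_james_tests: "(\<lambda>_. 1) \<in> james_tests"
proof -
  have "quad_var \<pi> (case_nat 0 (\<lambda>_. 1)) \<le> 1" if \<pi>: "interval_family \<pi>" for \<pi>
  proof -
    have "quad_var \<pi> (case_nat 0 (\<lambda>_. 1)) = (\<Sum>p\<in>\<pi>. if fst p \<le> 0 \<and> 0 < snd p then 1 else 0)"
      unfolding quad_var_def using interval_familyD(2)[OF \<pi>]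
      by (intro sum.cong refl) (force split: nat.splits)
    also have "\<dots> = card {p\<in>\<pi>. fst p \<le> 0 \<and> 0 < snd p}"
      using interval_familyD(1)[OF \<pi>] by (simp add: sum.inter_filter[symmetric])
    finally show ?thesis
      using card_crossing_le[OF \<pi>, of 0] by simp
  qed
  then show ?thesis
    by (simp add: james_tests_def)
qed

definition coef_total :: "'a \<Rightarrow> real" where
  "coef_total v = (\<Sum>n. coef n v)"

lemma coef_total_sums:
  assumes v: "v \<in> Y"
  shows "(\<lambda>n. coef n v) sums coef_total v"
proof -
  have "summable (\<lambda>n. coef n v)"
    unfolding summable_Cauchy
  proof (intro allI impI)
    fix e :: real assume e: "0 < e"
    have "summable (\<lambda>n. coef n v *\<^sub>R y n)"
      using coef_sums[OF v] by (rule sums_summable)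
    then obtain N where N: "\<And>m n. N \<le> m \<Longrightarrow> norm (\<Sum>i=m..<n. coef i v *\<^sub>R y i) < e / K"
      unfolding summable_Cauchy using e K_pos by (metis divide_pos_pos)
    have "norm (\<Sum>i=m..<n. coef i v) < e" if "N \<le> m" for m n
    proof -
      have 1: "(\<Sum>i<n. (if m \<le> i then coef i v else 0) * 1) = (\<Sum>i=m..<n. coef i v)"
        by (rule sum.mono_neutral_cong_right) auto
      have 2: "(\<Sum>i<n. (if m \<le> i then coef i v else 0) *\<^sub>R y i) = (\<Sum>i=m..<n. coef i v *\<^sub>R y i)"
        by (rule sum.mono_neutral_cong_right) auto
      have "\<bar>\<Sum>i=m..<n. coef i v\<bar> \<le> K * norm (\<Sum>i=m..<n. coef i v *\<^sub>R y i)"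
        using lower[OF one_in_james_tests, of "\<lambda>i. if m \<le> i then coef i v else 0" n] unfolding 1 2 .
      also have "\<dots> < K * (e / K)"
        by (intro mult_strict_left_mono N that K_pos)
      finally show ?thesis
        using K_pos by simp
    qed
    then show "\<exists>N. \<forall>m\<ge>N. \<forall>n. norm (\<Sum>i=m..<n. coef i v) < e"
      by blast
  qed
  then show ?thesis
    unfolding coef_total_def by (rule summable_sums)
qed

lemma coef_total_in_dual: "coef_total \<in> dual_on Y"
  unfolding dual_on_def
proof (intro CollectI conjI ballI allI impI)
  fix u v assume uv: "u \<in> Y" "v \<in> Y"
  show "coef_total (u + v) = coef_total u + coef_total v"
    using sums_add[OF coef_total_sums[OF uv(1)] coef_total_sums[OF uv(2)]] coef_linear(1)[OF uv]
      coef_total_sums[OF subspace_add[OF subspace_Y uv]] by (simp add: sums_unique2)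
next
  fix c u assume u: "u \<in> Y"
  show "coef_total (c *\<^sub>R u) = c * coef_total u"
    using sums_mult[OF coef_total_sums[OF u], of c] coef_linear(2)[OF u u, of _ c]
      coef_total_sums[OF subspace_scale[OF subspace_Y u], of c] by (simp add: sums_unique2)
next
  show "\<exists>C. \<forall>v\<in>Y. \<bar>coef_total v\<bar> \<le> C * norm v"
  proof (intro exI[of _ "2 * K"] ballI)
    fix v assume v: "v \<in> Y"
    have lim: "(\<lambda>N. \<bar>\<Sum>n<N. coef n v\<bar>) \<longlonglongrightarrow> \<bar>coef_total v\<bar>"
      using coef_total_sums[OF v] unfolding sums_def by (intro tendsto_intros)
    have "\<bar>\<Sum>n<N. coef n v\<bar> \<le> 2 * K * norm v" for N
      using coef_test_le[OF v one_in_james_tests, of N] by simp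
    then show "\<bar>coef_total v\<bar> \<le> 2 * K * norm v"
      using LIMSEQ_le_const2[OF lim] by blast
  qed
next
  fix v assume "v \<notin> Y"
  then show "coef_total v = 0"
    by (simp add: coef_total_def coef_def)
qed

lemma coef_total_basis: "coef_total (y m) = 1"
  using sums_unique2[OF coef_total_sums[OF in_closed_span[of y m]]] sums_single[of m "\<lambda>_. 1 :: real"]
  by (simp add: coef_basis)

text \<open>The additional direction of the bidual is the weak* limit of the basis.\<close>

definition limit_functional :: "('a \<Rightarrow> real) \<Rightarrow> real" where
  "limit_functional f = (if f \<in> dual_on Y then lim (\<lambda>n. f (y n)) else 0)"

lemma limit_functional_tendsto: "f \<in> dual_on Y \<Longrightarrow> (\<lambda>n. f (y n)) \<longlonglongrightarrow> limit_functional f"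
  using dual_limit by (simp add: limit_functional_def convergent_LIMSEQ_iff)

lemma limit_functional_in_bidual: "limit_functional \<in> bidual_on Y"
  unfolding bidual_on_def
proof (intro CollectI conjI ballI allI impI)
  fix f g assume fg: "f \<in> dual_on Y" "g \<in> dual_on Y"
  show "limit_functional (\<lambda>x. f x + g x) = limit_functional f + limit_functional g"
    by (rule LIMSEQ_unique[OF limit_functional_tendsto[OF dual_on_add[OF subspace_Y fg]]
      tendsto_add[OF limit_functional_tendsto[OF fg(1)] limit_functional_tendsto[OF fg(2)]]])
next
  fix c f assume f: "f \<in> dual_on Y"
  show "limit_functional (\<lambda>x. c * f x) = c * limit_functional f"
    by (rule LIMSEQ_unique[OF limit_functional_tendsto[OF dual_on_scale[OF f]]
      tendsto_mult_left[OF limit_functional_tendsto[OF f]]])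
next
  show "\<exists>C. \<forall>f\<in>dual_on Y. \<bar>limit_functional f\<bar> \<le> C * dual_norm Y f"
  proof (intro exI[of _ K] ballI)
    fix f assume f: "f \<in> dual_on Y"
    have "\<bar>f (y n)\<bar> \<le> K * dual_norm Y f" for n
      using dual_norm_apply[OF subspace_Y f in_closed_span, of n]
        mult_right_mono[OF norm_basis_le dual_norm_nonneg[OF subspace_Y f], of n] by linarith
    then show "\<bar>limit_functional f\<bar> \<le> K * dual_norm Y f"
      using LIMSEQ_le_const2[OF tendsto_rabs[OF limit_functional_tendsto[OF f]]] by blast
  qed
qed (simp add: limit_functional_def)

lemma limit_functional_coef: "limit_functional (coef m) = 0"
proof -
  have "(\<lambda>n. coef m (y n)) \<longlonglongrightarrow> 0"
    by (rule tendsto_eventually) (auto simp: coef_basis eventually_sequentially intro!: exI[of _ "Suc m"])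
  then show ?thesis
    using LIMSEQ_unique[OF limit_functional_tendsto[OF coef_in_dual]] by blast
qed

lemma limit_functional_total: "limit_functional coef_total = 1"
  using limit_functional_tendsto[OF coef_total_in_dual] by (simp add: coef_total_basis LIMSEQ_const_iff)

text \<open>Subtracting from a functional its limit along the basis times \<open>coef_total\<close>
  leaves a functional with limit 0, and on these \<open>\<phi>\<close> agrees with its
  representative \<open>v\<close>. Hence \<open>\<phi>\<close> differs from \<open>v\<close> only by
  what happens at \<open>coef_total\<close>.\<close>

theorem order_one_quasireflexive: "order_one_quasireflexive Y"
  unfolding order_one_quasireflexive_def
proof (intro bexI[OF _ limit_functional_in_bidual] conjI)
  show "limit_functional \<notin> canonical Y ` Y"
  proof
    assume "limit_functional \<in> canonical Y ` Y"
    then obtain v where v: "v \<in> Y" "limit_functional = canonical Y v"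
      by blast
    have "coef n v = 0" for n
      using limit_functional_coef[of n] coef_in_dual[of n] by (simp add: v(2) canonical_def)
    then have "coef_total v = 0"
      by (simp add: coef_total_def)
    then show False
      using limit_functional_total coef_total_in_dual by (simp add: v(2) canonical_def)
  qed
  show "bidual_on Y = {\<lambda>f. canonical Y v f + c * limit_functional f |v c. v \<in> Y}"
  proof (intro equalityI subsetI)
    fix \<phi> assume \<phi>: "\<phi> \<in> bidual_on Y"
    obtain v where v: "v \<in> Y" "\<And>n. coef n v = \<phi> (coef n)"
      using bidual_representative[OF \<phi>] by blast
    define c where "c = \<phi> coef_total - coef_total v"
    have "\<phi> f = canonical Y v f + c * limit_functional f" for f
    proof (cases "f \<in> dual_on Y")
      case True
      let ?L = "limit_functional f"
      define g where "g = (\<lambda>u. f u + (- ?L) * coef_total u)"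
      have sc: "(\<lambda>u. (- ?L) * coef_total u) \<in> dual_on Y"
        by (rule dual_on_scale[OF coef_total_in_dual])
      have g: "g \<in> dual_on Y"
        unfolding g_def by (rule dual_on_add[OF subspace_Y True sc])
      have "(\<lambda>n. f (y n) + (- ?L) * coef_total (y n)) \<longlonglongrightarrow> ?L + (- ?L) * 1"
        unfolding coef_total_basis by (intro tendsto_intros limit_functional_tendsto True)
      then have "(\<lambda>n. g (y n)) \<longlonglongrightarrow> 0"
        by (simp add: g_def)
      then have "\<phi> g = g v"
        by (intro bidual_eq_on_small_tail[OF \<phi> v g] dual_null_tail[OF g])
      moreover have "\<phi> g = \<phi> f + (- ?L) * \<phi> coef_total"
        unfolding g_def using bidual_onD(1)[OF \<phi> True sc] bidual_onD(2)[OF \<phi> coef_total_in_dual, of "- ?L"] by simp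
      ultimately show ?thesis
        using True by (simp add: g_def c_def canonical_def algebra_simps)
    next
      case False
      then show ?thesis
        using \<phi> by (simp add: canonical_def bidual_on_def limit_functional_def)
    qed
    then show "\<phi> \<in> {\<lambda>f. canonical Y v f + c * limit_functional f |v c. v \<in> Y}"
      using v(1) by blast
  next
    fix \<phi> assume "\<phi> \<in> {\<lambda>f. canonical Y v f + c * limit_functional f |v c. v \<in> Y}"
    then obtain v c where "v \<in> Y" "\<phi> = (\<lambda>f. canonical Y v f + c * limit_functional f)"
      by blast
    then show "\<phi> \<in> bidual_on Y"
      using bidual_on_combination[OF subspace_Y canonical_in_bidual[OF subspace_Y] limit_functional_in_bidual] by simp
  qed
qed

end

section \<open>Basic sequences in the predual\<close>

context test_sequences
begin

lemma coefficient_le: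
  assumes "n < N" "\<And>x. x \<in> X \<Longrightarrow> \<bar>\<Sum>n<N. a n * x n\<bar> \<le> B"
  shows "\<bar>a n\<bar> \<le> 2 * B"
proof -
  have "(\<Sum>k<N. a k * (if k = n then 1 / 2 else 0)) = a n / 2"
    using assms(1) by (simp add: if_distrib sum.delta cong: if_cong)
  then show ?thesis
    using assms(2)[OF half_delta[of n]] by simp
qed

lemma perturbed_sum_le:
  fixes d :: "nat \<Rightarrow> 'a::real_normed_vector"
  assumes d: "\<And>n. norm (d n) \<le> \<eta> / 2 ^ n" and \<eta>: "0 \<le> \<eta>"
    and B: "\<And>x. x \<in> X \<Longrightarrow> \<bar>\<Sum>n<N. a n * x n\<bar> \<le> B"
  shows "norm (\<Sum>n<N. a n *\<^sub>R d n) \<le> 4 * \<eta> * B"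
proof -
  have B0: "0 \<le> B"
    using B[OF zero_mem] by simp
  have "norm (\<Sum>n<N. a n *\<^sub>R d n) \<le> (\<Sum>n<N. \<bar>a n\<bar> * norm (d n))"
    by (rule order_trans[OF norm_sum]) simp
  also have "\<dots> \<le> (\<Sum>n<N. (2 * B) * (\<eta> / 2 ^ n))"
    using coefficient_le[OF _ B] d B0 by (intro sum_mono mult_mono) auto
  also have "\<dots> = 2 * B * (\<Sum>n<N. \<eta> / 2 ^ n)"
    by (rule sum_distrib_left[symmetric])
  also have "\<dots> \<le> 2 * B * (2 * \<eta>)"
    using B0 by (intro mult_left_mono sum_half_powers_le \<eta>) auto
  finally show ?thesis
    by (simp add: mult_ac)
qed

text \<open>A small perturbation principle. The errors are controlled by the coefficients, hence by
  the supremum \<open>s\<close> of the test values; \<open>8 * K1 * \<eta> \<le> 1\<close> lets half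
  of the finite number \<open>s\<close> be absorbed.\<close>

lemma test_basis_perturbation:
  fixes u y :: "nat \<Rightarrow> 'a::banach"
  assumes K: "0 < K1" "0 < K2" and \<eta>: "0 < \<eta>" "8 * K1 * \<eta> \<le> 1"
    and lower: "\<And>x N a. x \<in> X \<Longrightarrow> \<bar>\<Sum>n<N. a n * x n\<bar> \<le> K1 * norm (\<Sum>n<N. a n *\<^sub>R u n)"
    and upper: "\<And>N a B. (\<And>x. x \<in> X \<Longrightarrow> \<bar>\<Sum>n<N. a n * x n\<bar> \<le> B) \<Longrightarrow> norm (\<Sum>n<N. a n *\<^sub>R u n) \<le> K2 * B"
    and d: "\<And>n. norm (y n - u n) \<le> \<eta> / 2 ^ n"
  shows "test_basis X y (2 * K1 + (K2 + 4 * \<eta>))"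
proof
  let ?K = "2 * K1 + (K2 + 4 * \<eta>)"
  show "0 < ?K"
    using K \<eta> by simp
  have split: "(\<Sum>n<N. a n *\<^sub>R y n) = (\<Sum>n<N. a n *\<^sub>R u n) + (\<Sum>n<N. a n *\<^sub>R (y n - u n))" for a :: "nat \<Rightarrow> real" and N
    by (simp add: scaleR_diff_right sum_subtractf)
  fix x :: "nat \<Rightarrow> real" and N a
  assume x: "x \<in> X"
  define s where "s = (SUP x\<in>X. \<bar>\<Sum>n<N. a n * x n\<bar>)"
  have bdd: "bdd_above ((\<lambda>x. \<bar>\<Sum>n<N. a n * x n\<bar>) ` X)"
    unfolding bdd_above_def
  proof (intro exI ballI)
    fix r assume "r \<in> (\<lambda>x. \<bar>\<Sum>n<N. a n * x n\<bar>) ` X"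
    then obtain x where r: "r = \<bar>\<Sum>n<N. a n * x n\<bar>" and x: "x \<in> X"
      by blast
    have "\<bar>\<Sum>n<N. a n * x n\<bar> \<le> (\<Sum>n<N. \<bar>a n\<bar> * \<bar>x n\<bar>)"
      using sum_abs[of "\<lambda>n. a n * x n" "{..<N}"] by (simp add: abs_mult)
    also have "\<dots> \<le> (\<Sum>n<N. \<bar>a n\<bar> * 1)"
      using bounded[OF x] by (intro sum_mono mult_left_mono) auto
    finally show "r \<le> (\<Sum>n<N. \<bar>a n\<bar> * 1)"
      by (simp add: r)
  qed
  have s: "\<bar>\<Sum>n<N. a n * x n\<bar> \<le> s" if "x \<in> X" for x
    unfolding s_def by (rule cSUP_upper[OF that bdd])
  have "s \<le> K1 * norm (\<Sum>n<N. a n *\<^sub>R y n) + s / 2"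
    unfolding s_def
  proof (rule cSUP_least)
    show "X \<noteq> {}"
      using zero_mem by blast
    fix x assume x: "x \<in> X"
    have "\<bar>\<Sum>n<N. a n * x n\<bar> \<le> K1 * norm (\<Sum>n<N. a n *\<^sub>R u n)"
      by (rule lower[OF x])
    also have "\<dots> \<le> K1 * (norm (\<Sum>n<N. a n *\<^sub>R y n) + norm (\<Sum>n<N. a n *\<^sub>R (y n - u n)))"
      using K(1) norm_triangle_ineq4[of "\<Sum>n<N. a n *\<^sub>R y n" "\<Sum>n<N. a n *\<^sub>R (y n - u n)"]
      by (intro mult_left_mono) (simp_all add: split)
    also have "\<dots> \<le> K1 * (norm (\<Sum>n<N. a n *\<^sub>R y n) + 4 * \<eta> * s)"
      using perturbed_sum_le[OF d less_imp_le[OF \<eta>(1)] s] K(1) by (intro mult_left_mono add_left_mono) auto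
    also have "\<dots> = K1 * norm (\<Sum>n<N. a n *\<^sub>R y n) + (8 * K1 * \<eta>) * (s / 2)"
      by (simp add: algebra_simps)
    also have "\<dots> \<le> K1 * norm (\<Sum>n<N. a n *\<^sub>R y n) + 1 * (s / 2)"
      using \<eta>(2) s[OF zero_mem] by (intro add_left_mono mult_right_mono) auto
    finally show "\<bar>\<Sum>n<N. a n * x n\<bar> \<le> K1 * norm (\<Sum>n<N. a n *\<^sub>R y n) + (SUP x\<in>X. \<bar>\<Sum>n<N. a n * x n\<bar>) / 2"
      by (simp add: s_def)
  qed
  then have "s \<le> 2 * K1 * norm (\<Sum>n<N. a n *\<^sub>R y n)"
    by simp
  also have "\<dots> \<le> ?K * norm (\<Sum>n<N. a n *\<^sub>R y n)"
    using K \<eta> by (intro mult_right_mono) auto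
  finally show "\<bar>\<Sum>n<N. a n * x n\<bar> \<le> ?K * norm (\<Sum>n<N. a n *\<^sub>R y n)"
    using s[OF x] by linarith
next
  fix a :: "nat \<Rightarrow> real" and N B
  assume B: "\<And>x. x \<in> X \<Longrightarrow> \<bar>\<Sum>n<N. a n * x n\<bar> \<le> B"
  have B0: "0 \<le> B"
    using B[OF zero_mem] by simp
  have "norm (\<Sum>n<N. a n *\<^sub>R y n) = norm ((\<Sum>n<N. a n *\<^sub>R u n) + (\<Sum>n<N. a n *\<^sub>R (y n - u n)))"
    by (simp add: scaleR_diff_right sum_subtractf)
  also have "\<dots> \<le> norm (\<Sum>n<N. a n *\<^sub>R u n) + norm (\<Sum>n<N. a n *\<^sub>R (y n - u n))"
    by (rule norm_triangle_ineq)
  also have "\<dots> \<le> K2 * B + 4 * \<eta> * B"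
    by (intro add_mono upper B perturbed_sum_le d less_imp_le[OF \<eta>(1)])
  also have "\<dots> \<le> (2 * K1 + (K2 + 4 * \<eta>)) * B"
    using K B0 by (simp add: algebra_simps)
  finally show "norm (\<Sum>n<N. a n *\<^sub>R y n) \<le> (2 * K1 + (K2 + 4 * \<eta>)) * B" .
qed

end

text \<open>A segment cuts the chain \<open>t\<close> in an interval of indices, over which the
  increments telescope to a jump of \<open>X\<close>; disjoint segments give disjoint intervals.
  This is how the James norm appears on a branch.\<close>

lemma norm_chain_units_le:
  fixes X :: "nat \<Rightarrow> real"
  assumes X: "\<And>\<pi>. interval_family \<pi> \<Longrightarrow> quad_var \<pi> X \<le> 1"
    and t: "inj t" "\<And>m n. m \<le> n \<Longrightarrow> prefix (t m) (t n)"
  shows "norm (\<Sum>m<N. (X (Suc m) - X m) *\<^sub>R jt_unit (t m)) \<le> 1"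
  unfolding norm_jt_le_iff jt_bounded_L2_set
proof
  fix F assume F: "F \<in> segment_families"
  have finF: "finite F" "F \<subseteq> segments" "pairwise disjnt F"
    using F by (auto simp: segment_families_def)
  let ?w = "\<Sum>m<N. (X (Suc m) - X m) *\<^sub>R jt_unit (t m)"
  define M where "M S = {m. m < N \<and> t m \<in> S}" for S
  have Mfin: "finite (M S)" for S
    by (simp add: M_def)
  have val: "sum (jt_fun ?w) S = (\<Sum>m\<in>M S. X (Suc m) - X m)" if S: "S \<in> F" for S
  proof -
    have "sum (jt_fun ?w) S = (\<Sum>s\<in>S. \<Sum>m<N. if s = t m then X (Suc m) - X m else 0)"
      by (intro sum.cong refl) (auto simp: jt_fun_sum jt_fun_scaleR jt_fun_unit intro!: sum.cong)
    also have "\<dots> = (\<Sum>m<N. \<Sum>s\<in>S. if s = t m then X (Suc m) - X m else 0)"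
      by (rule sum.swap)
    also have "\<dots> = (\<Sum>m<N. if t m \<in> S then X (Suc m) - X m else 0)"
      using S finF(2) segments_finite by (intro sum.cong refl) auto
    also have "\<dots> = (\<Sum>m\<in>M S. X (Suc m) - X m)"
      unfolding M_def by (subst sum.inter_filter[symmetric]) (auto intro!: sum.cong)
    finally show ?thesis .
  qed
  define \<iota> where "\<iota> S = (Min (M S), Suc (Max (M S)))" for S
  have Mint: "M S = {fst (\<iota> S)..<snd (\<iota> S)}" if S: "S \<in> F" "M S \<noteq> {}" for S
  proof -
    obtain p u where pu: "S = {t. prefix p t \<and> prefix t u}"
      using S(1) finF(2) unfolding segments_def by blast
    have ends: "Min (M S) \<in> M S" "Max (M S) \<in> M S"
      using Mfin S(2) by auto
    have "m \<in> M S" if "Min (M S) \<le> m" "m \<le> Max (M S)" for m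
      using ends t(2)[OF that(1)] t(2)[OF that(2)] that(2) prefix_order.trans unfolding M_def pu by auto
    then show ?thesis
      using Mfin[of S] by (auto simp: \<iota>_def less_Suc_eq_le)
  qed
  define G where "G = {S\<in>F. M S \<noteq> {}}"
  have lt: "fst (\<iota> S) < snd (\<iota> S)" if "S \<in> G" for S
    using Mint[of S] that by (auto simp: G_def)
  have tele: "sum (jt_fun ?w) S = X (snd (\<iota> S)) - X (fst (\<iota> S))" if S: "S \<in> G" for S
  proof -
    have "sum (jt_fun ?w) S = (\<Sum>m=fst (\<iota> S)..<snd (\<iota> S). X (Suc m) - X m)"
      using S val Mint by (simp add: G_def)
    also have "\<dots> = X (snd (\<iota> S)) - X (fst (\<iota> S))"
      using lt[OF S] by (simp add: sum_Suc_diff')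
    finally show ?thesis .
  qed
  have Mdis: "M S \<inter> M R = {}" if "S \<in> F" "R \<in> F" "S \<noteq> R" for S R
    using finF(3) that unfolding pairwise_def disjnt_def M_def by blast
  have Gdis: "{fst (\<iota> S)..<snd (\<iota> S)} \<inter> {fst (\<iota> R)..<snd (\<iota> R)} = {}" if "S \<in> G" "R \<in> G" "S \<noteq> R" for S R
    using Mdis[of S R] Mint[of S] Mint[of R] that by (simp add: G_def)
  have inj: "inj_on \<iota> G"
  proof (rule inj_onI)
    fix S R assume SR: "S \<in> G" "R \<in> G" "\<iota> S = \<iota> R"
    show "S = R"
    proof (rule ccontr)
      assume "S \<noteq> R"
      then show False
        using Gdis[OF SR(1,2)] lt[OF SR(1)] SR(3) by auto
    qed
  qed
  have fam: "interval_family (\<iota> ` G)"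
    unfolding interval_family_def
  proof (intro conjI ballI impI)
    show "finite (\<iota> ` G)"
      using finF(1) by (simp add: G_def)
    show "fst p < snd p" if "p \<in> \<iota> ` G" for p
      using that lt by blast
    show "{fst p..<snd p} \<inter> {fst p'..<snd p'} = {}" if "p \<in> \<iota> ` G" "p' \<in> \<iota> ` G" "p \<noteq> p'" for p p'
      using that Gdis by blast
  qed
  have "(L2_set (sum (jt_fun ?w)) F)\<^sup>2 = (\<Sum>S\<in>F. (sum (jt_fun ?w) S)\<^sup>2)"
    by (simp add: L2_set_def sum_nonneg)
  also have "\<dots> = (\<Sum>S\<in>G. (sum (jt_fun ?w) S)\<^sup>2)"
    using finF(1) val by (intro sum.mono_neutral_right) (auto simp: G_def)
  also have "\<dots> = (\<Sum>S\<in>G. (X (snd (\<iota> S)) - X (fst (\<iota> S)))\<^sup>2)"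
    using tele by simp
  also have "\<dots> = quad_var (\<iota> ` G) X"
    by (simp add: quad_var_def sum.reindex[OF inj])
  also have "\<dots> \<le> 1\<^sup>2"
    using X[OF fam] by simp
  finally show "L2_set (sum (jt_fun ?w)) F \<le> 1"
    by (rule power2_le_imp_le) simp
qed

lemma jcut_unit:
  assumes "order_convex D"
  shows "jcut D (jt_unit t) = (if t \<in> D then jt_unit t else 0)"
  using assms by (intro jt_eqI) (simp add: jt_fun_cut jt_fun_unit jt_fun_zero)

text \<open>Averages over \<open>{m..<2 * m}\<close> remove the humps: these live on disjoint
  shells, so their sum has norm at most \<open>M * sqrt m\<close>, which division by
  \<open>m\<close> makes small. If \<open>z\<close> lies in \<open>B_inf\<close>, its own tails
  vanish too, and the averages, which lie in tails of the basic sequence, converge in norm to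
  \<open>z\<close>.\<close>

lemma weak_limit_in_B_inf_eq_0:
  fixes e :: "nat \<Rightarrow> jt_inf \<Rightarrow>\<^sub>L real" and r :: "nat \<Rightarrow> nat"
  assumes basic: "basic_sequence e" and B: "\<And>n. e n \<in> B_inf" and M: "\<And>n. norm (e n) \<le> M"
    and r: "strict_mono r" and lim: "\<And>x. (\<lambda>n. e (r n) x) \<longlonglongrightarrow> blinfun_apply z x" and z: "z \<in> B_inf"
  shows "z = 0"
proof -
  obtain i q :: "nat \<Rightarrow> nat" where i: "strict_mono i" and q: "strict_mono q" "q 0 = 0"
    and err: "\<And>n. norm (e (r (i n)) - fcut z (tbox (q n))
      - fcut (e (r (i n))) (tbox (q (Suc n)) - tbox (q n))) \<le> 1 / 2 ^ n"
    by (rule gliding_hump[of "\<lambda>n. e (r n)", OF B lim order_refl zero_less_one]) (rule that)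
  define u where "u n = e (r (i n))" for n
  define D where "D n = tbox (q (Suc n)) - tbox (q n)" for n
  define \<rho> where "\<rho> n = u n - fcut z (tbox (q n)) - fcut (u n) (D n)" for n
  have \<rho>: "norm (\<rho> n) \<le> 1 / 2 ^ n" for n
    using err by (simp add: \<rho>_def u_def D_def)
  have M0: "0 \<le> M"
    using order_trans[OF norm_ge_zero M] .
  define v where "v m = (1 / real m) *\<^sub>R (\<Sum>n=m..<2 * m. u n)" for m
  have ri: "n \<le> r (i n)" for n
    using strict_mono_imp_increasing[OF r, of "i n"] strict_mono_imp_increasing[OF i, of n] by linarith
  have "v m \<in> span (e ` {m..})" for m
    unfolding v_def u_def
  proof (intro span_scale span_sum span_base imageI)
    fix n assume "n \<in> {m..<2 * m}"
    then show "r (i n) \<in> {m..}"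
      using ri[of n] by simp
  qed
  moreover have "v \<longlonglongrightarrow> z"
  proof (rule LIM_zero_cancel, rule Lim_null_comparison)
    have bound: "norm (v m - z) \<le> M / sqrt m + 2 / m + norm (fcut z (- tbox m))" if m: "1 \<le> m" for m
    proof -
      have u: "u n = z + fcut (u n) (D n) + (\<rho> n - fcut z (- tbox (q n)))" for n
        using fcut_box_split[of z "q n"] by (simp add: \<rho>_def algebra_simps)
      have "v m - z = (1 / m) *\<^sub>R (\<Sum>n=m..<2 * m. u n - z)"
        using m by (simp add: v_def sum_subtractf scaleR_diff_right sum_constant_scaleR)
      also have "(\<Sum>n=m..<2 * m. u n - z) = (\<Sum>n=m..<2 * m. fcut (u n) (D n)) + (\<Sum>n=m..<2 * m. \<rho> n - fcut z (- tbox (q n)))"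
        unfolding sum.distrib[symmetric] by (intro sum.cong refl) (subst u, simp)
      finally have "norm (v m - z) = norm ((\<Sum>n=m..<2 * m. fcut (u n) (D n)) + (\<Sum>n=m..<2 * m. \<rho> n - fcut z (- tbox (q n)))) / m"
        by simp
      also have "\<dots> \<le> (M * sqrt m + (2 + m * norm (fcut z (- tbox m)))) / m"
      proof (intro divide_right_mono order_trans[OF norm_triangle_ineq] add_mono)
        have "norm (\<Sum>n=m..<2 * m. fcut (u n) (D n)) \<le> L2_set (\<lambda>n. norm (u n)) {m..<2 * m}"
          using disjoint_shells[OF q(1)] by (intro fcut_upper_2) (auto simp: D_def disjoint_family_on_def)
        also have "\<dots> \<le> L2_set (\<lambda>n. M) {m..<2 * m}"
          using M by (intro L2_set_mono) (auto simp: u_def)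
        also have "\<dots> = M * sqrt m"
          using M0 by (simp add: L2_set_def real_sqrt_mult mult.commute)
        finally show "norm (\<Sum>n=m..<2 * m. fcut (u n) (D n)) \<le> M * sqrt m" .
        have "norm (\<Sum>n=m..<2 * m. \<rho> n - fcut z (- tbox (q n))) \<le> (\<Sum>n=m..<2 * m. 1 / 2 ^ n + norm (fcut z (- tbox m)))"
        proof (rule order_trans[OF norm_sum sum_mono])
          fix n assume n: "n \<in> {m..<2 * m}"
          have "m \<le> q n"
            using n strict_mono_imp_increasing[OF q(1), of n] by simp
          then have "norm (fcut z (- tbox (q n))) \<le> norm (fcut z (- tbox m))"
            by (rule fcut_co_box_antimono)
          then show "norm (\<rho> n - fcut z (- tbox (q n))) \<le> 1 / 2 ^ n + norm (fcut z (- tbox m))"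
            using \<rho>[of n] norm_triangle_ineq4[of "\<rho> n" "fcut z (- tbox (q n))"] by linarith
        qed
        also have "\<dots> = (\<Sum>n=m..<2 * m. 1 / 2 ^ n) + m * norm (fcut z (- tbox m))"
          by (simp add: sum.distrib)
        also have "(\<Sum>n=m..<2 * m. 1 / 2 ^ n) \<le> (\<Sum>n<2 * m. 1 / 2 ^ n :: real)"
          by (intro sum_mono2) auto
        also have "\<dots> \<le> 2"
          using sum_half_powers_le[of 1 "2 * m"] by simp
        finally show "norm (\<Sum>n=m..<2 * m. \<rho> n - fcut z (- tbox (q n))) \<le> 2 + m * norm (fcut z (- tbox m))"
          by simp
      qed simp
      also have "\<dots> = M * sqrt m / m + 2 / m + norm (fcut z (- tbox m))"
        using m by (simp add: add_divide_distrib)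
      also have "M * sqrt m / m = M / sqrt m"
        using m by (simp add: real_sqrt_eq_iff field_simps flip: real_sqrt_mult)
      finally show ?thesis .
    qed
    then show "\<forall>\<^sub>F m in sequentially. norm (v m - z) \<le> M / sqrt m + 2 / m + norm (fcut z (- tbox m))"
      unfolding eventually_sequentially by blast
    have t3: "(\<lambda>m. norm (fcut z (- tbox m))) \<longlonglongrightarrow> 0"
      unfolding LIMSEQ_iff using B_inf_tail[OF z] by simp
    have t1: "(\<lambda>m. M / sqrt (real m)) \<longlonglongrightarrow> 0"
      by (rule tendsto_divide_0[OF tendsto_const])
        (intro filterlim_at_top_imp_at_infinity filterlim_compose[OF sqrt_at_top filterlim_real_sequentially])
    have t2: "(\<lambda>m. 2 / real m) \<longlonglongrightarrow> 0"
      by (rule lim_const_over_n)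
    show "(\<lambda>m. M / sqrt m + 2 / m + norm (fcut z (- tbox m))) \<longlonglongrightarrow> 0"
      using tendsto_add[OF tendsto_add[OF t1 t2] t3] by simp
  qed
  ultimately show ?thesis
    by (rule basic_sequence_tail_limit[OF basic])
qed

text \<open>After a gliding hump the functionals are blocks up to summable errors. Cutting gives the
  upper 2-estimate, \<open>weakly_null_lower_2\<close> the lower one, and the perturbation principle
  returns to the original functionals.\<close>

lemma weakly_null_l2_subsequence:
  fixes e :: "nat \<Rightarrow> jt_inf \<Rightarrow>\<^sub>L real"
  assumes B: "\<And>n. e n \<in> B_inf" and M: "\<And>n. norm (e n) \<le> M" and \<delta>: "0 < \<delta>" "\<And>n. \<delta> \<le> norm (e n)"
    and lim: "\<And>x. (\<lambda>n. e n x) \<longlonglongrightarrow> 0"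
  shows "\<exists>(r :: nat \<Rightarrow> nat) K. strict_mono r \<and> test_basis l2_tests (e \<circ> r) K"
proof -
  \<comment> \<open>The humps will have norm at least \<open>\<delta> / 2\<close>, for which
    \<open>weakly_null_lower_2\<close> gives the constant
    \<open>24 / (\<delta> / 2)\<close>.\<close>
  define K1 where "K1 = 48 / \<delta>"
  have K1: "0 < K1"
    using \<delta>(1) by (simp add: K1_def)
  define \<eta> where "\<eta> = min (\<delta> / 2) (1 / (8 * K1))"
  have \<eta>: "0 < \<eta>" "\<eta> \<le> \<delta> / 2" "8 * K1 * \<eta> \<le> 1"
    using \<delta>(1) K1 mult_left_mono[of \<eta> "1 / (8 * K1)" "8 * K1"] by (auto simp: \<eta>_def)
  have lim0: "(\<lambda>n. e n x) \<longlonglongrightarrow> blinfun_apply 0 x" for x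
    using lim by simp
  obtain i q :: "nat \<Rightarrow> nat" where i: "strict_mono i" and q: "strict_mono q" "q 0 = 0"
    and err: "\<And>n. norm (e (i n) - fcut 0 (tbox (q n))
      - fcut (e (i n)) (tbox (q (Suc n)) - tbox (q n))) \<le> \<eta> / 2 ^ n"
    by (rule gliding_hump[of e, OF B lim0 order_refl \<eta>(1)]) (rule that)
  define D where "D n = tbox (q (Suc n)) - tbox (q n)" for n
  define w where "w n = fcut (e (i n)) (D n)" for n
  have fcut0: "fcut 0 (tbox k) = 0" for k
    by (rule blinfun_eqI) (simp add: fcut_apply)
  have err': "norm (e (i n) - w n) \<le> \<eta> / 2 ^ n" for n
    using err[of n] by (simp add: w_def D_def fcut0)
  have D_le: "n \<le> q n" for n
    by (rule strict_mono_imp_increasing[OF q(1)])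
  have wcut: "fcut (w n) (tbox (q (Suc n)) - tbox n) = w n" for n
  proof (rule blinfun_eqI)
    fix x
    have "jcut (D n) (jcut (tbox (q (Suc n)) - tbox n) x) = jcut (D n) x"
      using box_mono[OF D_le[of n]] by (intro jt_eqI) (auto simp: D_def)
    then show "fcut (w n) (tbox (q (Suc n)) - tbox n) x = w n x"
      by (simp add: w_def fcut_apply D_def)
  qed
  have wlow: "\<delta> / 2 \<le> norm (w n)" for n
  proof -
    have "\<eta> / 2 ^ n \<le> \<eta> / 1"
      using \<eta>(1) by (intro divide_left_mono) auto
    then have "norm (e (i n) - w n) \<le> \<delta> / 2"
      using err'[of n] \<eta>(2) by linarith
    then show ?thesis
      using \<delta>(2)[of "i n"] norm_triangle_sub[of "e (i n)" "w n"] by linarith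
  qed
  have "0 < \<delta> / 2"
    using \<delta>(1) by simp
  obtain r :: "nat \<Rightarrow> nat" where r: "strict_mono r"
    and low: "\<And>N a. L2_set a {..<N} \<le> 24 / (\<delta> / 2) * norm (\<Sum>k<N. a k *\<^sub>R w (r k))"
    by (rule weakly_null_lower_2[OF wcut \<open>0 < \<delta> / 2\<close> wlow]) (rule that)
  have M0: "0 \<le> M"
    using order_trans[OF norm_ge_zero M] .
  have "test_basis l2_tests (\<lambda>k. e (i (r k))) (2 * K1 + (M + 1 + 4 * \<eta>))"
  proof (rule test_sequences.test_basis_perturbation[OF l2_test_sequences K1 _ \<eta>(1,3)])
    show "0 < M + 1"
      using M0 by simp
    fix x :: "nat \<Rightarrow> real" and N a assume x: "x \<in> l2_tests"
    have "\<bar>\<Sum>n<N. a n * x n\<bar> \<le> (\<Sum>n<N. \<bar>a n\<bar> * \<bar>x n\<bar>)"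
      using sum_abs[of "\<lambda>n. a n * x n" "{..<N}"] by (simp add: abs_mult)
    also have "\<dots> \<le> L2_set a {..<N} * L2_set x {..<N}"
      by (rule L2_set_mult_ineq)
    also have "\<dots> \<le> L2_set a {..<N} * 1"
    proof (intro mult_left_mono)
      show "L2_set x {..<N} \<le> 1"
        using x by (simp add: l2_tests_def L2_set_def)
    qed simp
    also have "\<dots> \<le> K1 * norm (\<Sum>n<N. a n *\<^sub>R w (r n))"
      using low[of a N] by (simp add: K1_def)
    finally show "\<bar>\<Sum>n<N. a n * x n\<bar> \<le> K1 * norm (\<Sum>n<N. a n *\<^sub>R w (r n))" .
  next
    fix N a B assume Bd: "\<And>x. x \<in> l2_tests \<Longrightarrow> \<bar>\<Sum>n<N. a n * x n\<bar> \<le> B"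
    let ?L = "L2_set a {..<N}"
    have "0 \<le> B"
      using Bd[OF test_sequences.zero_mem[OF l2_test_sequences]] by simp
    have L: "?L \<le> B"
    proof (cases "?L = 0")
      case True
      then show ?thesis
        using \<open>0 \<le> B\<close> by simp
    next
      case False
      have sq: "(\<Sum>n<N. (a n)\<^sup>2) = ?L * ?L"
        by (simp add: L2_set_def sum_nonneg)
      define x where "x n = (if n < N then a n else 0) / ?L" for n
      have "(\<Sum>n<N'. (x n)\<^sup>2) \<le> 1" for N'
      proof -
        have "(\<Sum>n<N'. (x n)\<^sup>2) \<le> (\<Sum>n<max N N'. (x n)\<^sup>2)"
          by (intro sum_mono2) auto
        also have "\<dots> = (\<Sum>n<N. (x n)\<^sup>2)"
          by (intro sum.mono_neutral_right) (auto simp: x_def)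
        also have "\<dots> = (\<Sum>n<N. (a n)\<^sup>2) / (?L * ?L)"
          by (simp add: x_def power_divide sum_divide_distrib power2_eq_square)
        also have "\<dots> = 1"
          using False by (simp add: sq)
        finally show ?thesis
          by simp
      qed
      then have "x \<in> l2_tests"
        by (simp add: l2_tests_def)
      then have "\<bar>\<Sum>n<N. a n * x n\<bar> \<le> B"
        by (rule Bd)
      moreover have "(\<Sum>n<N. a n * x n) = (\<Sum>n<N. (a n)\<^sup>2) / ?L"
        by (simp add: x_def power2_eq_square sum_divide_distrib)
      ultimately show ?thesis
        using False by (simp add: sq)
    qed
    have "(\<Sum>n<N. a n *\<^sub>R w (r n)) = (\<Sum>n<N. fcut (a n *\<^sub>R e (i (r n))) (D (r n)))"
      by (intro sum.cong refl blinfun_eqI) (simp add: w_def D_def fcut_apply blinfun.scaleR_left)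
    also have "norm \<dots> \<le> L2_set (\<lambda>n. norm (a n *\<^sub>R e (i (r n)))) {..<N}"
    proof (rule fcut_upper_2)
      show "disjoint_family_on (\<lambda>n. D (r n)) {..<N}"
        using disjoint_shells[OF q(1)] strict_mono_eq[OF r] unfolding D_def disjoint_family_on_def by blast
    qed (simp_all add: D_def)
    also have "\<dots> \<le> L2_set (\<lambda>n. (M + 1) * \<bar>a n\<bar>) {..<N}"
    proof (rule L2_set_mono)
      fix n
      show "norm (a n *\<^sub>R e (i (r n))) \<le> (M + 1) * \<bar>a n\<bar>"
        using mult_right_mono[OF M[of "i (r n)"], of "\<bar>a n\<bar>"] by (simp add: algebra_simps)
    qed simp
    also have "\<dots> = (M + 1) * ?L"
      using M0 by (subst L2_set_right_distrib[symmetric]) (simp_all add: L2_set_def)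
    also have "\<dots> \<le> (M + 1) * B"
      using L M0 by (intro mult_left_mono) auto
    finally show "norm (\<Sum>n<N. a n *\<^sub>R w (r n)) \<le> (M + 1) * B" .
  next
    fix n
    have "\<eta> / 2 ^ r n \<le> \<eta> / 2 ^ n"
      using \<eta>(1) strict_mono_imp_increasing[OF r, of n] by (intro divide_left_mono power_increasing) auto
    then show "norm (e (i (r n)) - w (r n)) \<le> \<eta> / 2 ^ n"
      using err'[of "r n"] by linarith
  qed
  moreover have "strict_mono (i \<circ> r)"
    by (rule strict_mono_o[OF i r])
  moreover have "(\<lambda>k. e (i (r k))) = e \<circ> (i \<circ> r)"
    by auto
  ultimately show ?thesis
    by auto
qed

section \<open>Subsequences of James type\<close>

lemma interval_shells_disjoint:
  assumes b: "\<And>m n. m \<le> n \<Longrightarrow> b m \<subseteq> (b n :: 'a set)" and \<pi>: "interval_family \<pi>"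
  shows "disjoint_family_on (\<lambda>p. b (snd p) - b (fst p)) \<pi>"
  unfolding disjoint_family_on_def
proof (intro ballI impI)
  fix p p' assume p: "p \<in> \<pi>" "p' \<in> \<pi>" "p \<noteq> p'"
  have "snd p \<le> fst p' \<or> snd p' \<le> fst p"
  proof (rule ccontr)
    assume "\<not> ?thesis"
    then have "max (fst p) (fst p') \<in> {fst p..<snd p}" "max (fst p) (fst p') \<in> {fst p'..<snd p'}"
      using interval_familyD(2)[OF \<pi> p(1)] interval_familyD(2)[OF \<pi> p(2)] by auto
    then show False
      using interval_familyD(3)[OF \<pi> p(1,2)] p(3) by blast
  qed
  then show "(b (snd p) - b (fst p)) \<inter> (b (snd p') - b (fst p')) = {}"
    using b[of "snd p" "fst p'"] b[of "snd p'" "fst p"] by blast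
qed

text \<open>The values of \<open>z\<close> along some infinite chain stay away from 0, so their
  inverses are bounded and cluster at some \<open>\<theta>\<close>. The inverses serve to normalise
  the unit vectors to \<open>z\<close>-value 1, and the rate makes the deviation from a constant
  factor summable.\<close>

lemma inverse_value_limit:
  assumes "\<not> null_on_chains z"
  obtains T :: "nat \<Rightarrow> nat list" and \<theta> where "\<And>m n. prefix (T m) (T n) \<or> prefix (T n) (T m)"
    "\<And>q. T q \<notin> tbox q" "\<And>q. blinfun_apply z (jt_unit (T q)) \<noteq> 0"
    "\<And>q. \<bar>1 / blinfun_apply z (jt_unit (T q)) - \<theta>\<bar> \<le> 1 / 2 ^ q"
proof -
  obtain C \<eta> where C: "infinite C" "\<And>s t. s \<in> C \<Longrightarrow> t \<in> C \<Longrightarrow> prefix s t \<or> prefix t s"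
    and \<eta>: "0 < \<eta>" "\<And>t. t \<in> C \<Longrightarrow> \<eta> \<le> \<bar>z (jt_unit t)\<bar>"
    using assms unfolding null_on_chains_def by (auto simp: not_less)
  obtain f :: "nat \<Rightarrow> nat list" where f: "inj f" "range f \<subseteq> C"
    using infinite_countable_subset[OF C(1)] by blast
  define g where "g n = 1 / z (jt_unit (f n))" for n
  have gb: "norm (g n) \<le> 1 / \<eta>" for n
  proof -
    have "\<eta> \<le> \<bar>z (jt_unit (f n))\<bar>"
      using \<eta>(2) f(2) by blast
    then show ?thesis
      using \<eta>(1) by (simp add: g_def abs_divide frac_le)
  qed
  then have "bounded (range g)"
    unfolding bounded_iff by blast
  then obtain \<theta> s where s: "strict_mono (s :: nat \<Rightarrow> nat)" "(g \<circ> s) \<longlonglongrightarrow> \<theta>"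
    using bounded_imp_convergent_subsequence by blast
  have "\<exists>t\<in>C. t \<notin> tbox q \<and> \<bar>1 / z (jt_unit t) - \<theta>\<bar> \<le> 1 / 2 ^ q" for q
  proof -
    have "finite {n. f (s n) \<in> tbox q}"
    proof (rule finite_imageD[of "\<lambda>n. f (s n)"])
      show "finite ((\<lambda>n. f (s n)) ` {n. f (s n) \<in> tbox q})"
        by (rule finite_subset[OF _ finite_box[of q]]) auto
      show "inj_on (\<lambda>n. f (s n)) {n. f (s n) \<in> tbox q}"
        using f(1) strict_mono_eq[OF s(1)] by (auto simp: inj_on_def)
    qed
    then obtain N1 where N1: "\<And>n. n \<ge> N1 \<Longrightarrow> f (s n) \<notin> tbox q"
      by (metis (mono_tags, lifting) finite_nat_set_iff_bounded mem_Collect_eq not_less)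
    have "0 < (1 :: real) / 2 ^ q"
      by simp
    then obtain N2 where N2: "\<And>n. n \<ge> N2 \<Longrightarrow> \<bar>g (s n) - \<theta>\<bar> < 1 / 2 ^ q"
      using s(2) unfolding LIMSEQ_iff o_def real_norm_def by blast
    have "f (s (max N1 N2)) \<in> C"
      using f(2) by blast
    moreover have "f (s (max N1 N2)) \<notin> tbox q"
      by (rule N1) simp
    moreover have "\<bar>1 / z (jt_unit (f (s (max N1 N2)))) - \<theta>\<bar> \<le> 1 / 2 ^ q"
      using N2[of "max N1 N2"] by (simp add: g_def)
    ultimately show ?thesis
      by blast
  qed
  then obtain T where T: "\<And>q. T q \<in> C" "\<And>q. T q \<notin> tbox q" "\<And>q. \<bar>1 / z (jt_unit (T q)) - \<theta>\<bar> \<le> 1 / 2 ^ q"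
    by metis
  show thesis
  proof (rule that[of T \<theta>])
    show "z (jt_unit (T q)) \<noteq> 0" for q
      using \<eta>(1) \<eta>(2)[OF T(1)[of q]] by auto
  qed (use C(2) T in blast)+
qed

text \<open>If the pointwise limit lies outside \<^term>\<open>B_inf\<close>, it does not tend to zero along some branch. Differences of
  unit vectors on that branch are test vectors showing that a subsequence dominates the coordinate basis
  of the predual of the James space; the lower 2-estimate of the James tree space gives the converse.\<close>

lemma james_subsequence:
  fixes e :: "nat \<Rightarrow> jt_inf \<Rightarrow>\<^sub>L real"
  assumes B: "\<And>n. e n \<in> B_inf" and M: "\<And>n. norm (e n) \<le> M"
    and lim: "\<And>x. (\<lambda>n. e n x) \<longlonglongrightarrow> blinfun_apply z x" and z: "z \<notin> B_inf"
  shows "\<exists>(r :: nat \<Rightarrow> nat) K. strict_mono r \<and> test_basis james_tests (e \<circ> r) K"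
proof -
  obtain T \<theta> where T: "\<And>m n. prefix (T m) (T n) \<or> prefix (T n) (T m)" "\<And>q. T q \<notin> tbox q"
    "\<And>q. z (jt_unit (T q)) \<noteq> 0" "\<And>q. \<bar>1 / z (jt_unit (T q)) - \<theta>\<bar> \<le> 1 / 2 ^ q"
    by (rule inverse_value_limit[OF not_null_on_chains[OF z]]) (rule that)
  \<comment> \<open>The summand 4 bounds the total of the errors \<open>2 / 2 ^ m\<close> in the
    test vector \<open>w\<close>.\<close>
  define K1 where "K1 = \<bar>\<theta>\<bar> + 4"
  define \<eta> where "\<eta> = 1 / (8 * K1)"
  have K1: "0 < K1" and \<eta>: "0 < \<eta>" "8 * K1 * \<eta> \<le> 1"
    by (auto simp: K1_def \<eta>_def)
  obtain k where k: "\<And>q. T q \<in> tbox (k q)"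
    using choice[of "\<lambda>q k. T q \<in> tbox k"] in_some_box by blast
  \<comment> \<open>The gap between \<open>q\<close> and \<open>h q\<close> makes room for the node
    \<open>T q\<close>, which lies outside \<open>tbox q\<close> and inside
    \<open>tbox (h q)\<close>; the chosen nodes thus avoid all shells of the gliding hump.\<close>
  define h where "h q = max q (k q)" for q
  have h: "q \<le> h q" "T q \<in> tbox (h q)" for q
    using k[of q] box_mono[of "k q" "h q"] by (auto simp: h_def)
  obtain i q :: "nat \<Rightarrow> nat" where i: "strict_mono i" and q: "strict_mono q" "\<And>n. h (q n) < q (Suc n)"
    and err: "\<And>n. norm (e (i n) - fcut z (tbox (h (q n)))
      - fcut (e (i n)) (tbox (q (Suc n)) - tbox (h (q n)))) \<le> \<eta> / 2 ^ n"
    by (rule gliding_hump[of e, OF B lim h(1) \<eta>(1)]) (rule that)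
  define D where "D n = tbox (q (Suc n)) - tbox (h (q n))" for n
  define u where "u n = fcut z (tbox (h (q n))) + fcut (e (i n)) (D n)" for n
  define t where "t m = T (q m)" for m
  have qm: "tbox (q m) \<subseteq> tbox (q n)" if "m \<le> n" for m n
    using q(1) that by (intro box_mono) (simp add: strict_mono_less_eq)
  have hq: "tbox (h (q m)) \<subseteq> tbox (q n)" if "m < n" for m n
    using box_mono[OF less_imp_le[OF q(2)[of m]]] qm[of "Suc m" n] that by auto
  have hh: "tbox (h (q m)) \<subseteq> tbox (h (q n))" if "m \<le> n" for m n
    using hq[of m n] box_mono[OF h(1)[of "q n"]] that by (cases "m = n") auto
  have tin: "t m \<in> tbox (h (q m))" and tout: "t m \<notin> tbox (q m)" for m
    using h(2) T(2) by (simp_all add: t_def)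
  have tnot: "\<not> prefix (t n) (t m)" if "m < n" for m n
    using tin[of m] tout[of n] hq[OF that] prefix_box by blast
  then have tpre: "prefix (t m) (t n)" if "m \<le> n" for m n
    using T(1)[of "q m" "q n"] that by (cases "m = n") (auto simp: t_def)
  have tinj: "inj t"
    by (rule linorder_injI) (metis tnot prefix_order.refl)
  \<comment> \<open>On the chosen nodes the functionals form a triangular pattern: among them,
    \<open>u n\<close> sees exactly those of index up to \<open>n\<close>, with the values of
    \<open>z\<close>.\<close>
  have ut: "u n (jt_unit (t m)) = (if m \<le> n then z (jt_unit (t m)) else 0)" for n m
  proof (cases "m \<le> n")
    case True
    then have "t m \<in> tbox (h (q n))"
      using tin hh by blast
    then show ?thesis
      using True by (simp add: u_def D_def blinfun.add_left fcut_apply jcut_unit)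
  next
    case False
    then have "t m \<notin> tbox (q (Suc n))"
      using tout[of m] qm[of "Suc n" m] by auto
    moreover have "tbox (h (q n)) \<subseteq> tbox (q (Suc n))"
      by (rule hq) simp
    ultimately show ?thesis
      using False by (auto simp: u_def D_def blinfun.add_left fcut_apply jcut_unit)
  qed
  have M0: "0 \<le> M"
    using order_trans[OF norm_ge_zero M] .
  define K2 where "K2 = (norm z + 1) + 2 * (M + 1)"
  have "test_basis james_tests (\<lambda>n. e (i n)) (2 * K1 + (K2 + 4 * \<eta>))"
  proof (rule test_sequences.test_basis_perturbation[OF james_test_sequences K1 _ \<eta>])
    show "0 < K2"
      using M0 by (simp add: K2_def add_pos_nonneg)
    show "norm (e (i n) - u n) \<le> \<eta> / 2 ^ n" for n
      using err[of n] by (simp add: u_def D_def algebra_simps)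
  next
    fix x :: "nat \<Rightarrow> real" and N a
    assume x: "x \<in> james_tests"
    define X where "X = case_nat 0 x"
    define \<Delta> where "\<Delta> m = X (Suc m) - X m" for m
    have Xv: "quad_var \<pi> X \<le> 1" if "interval_family \<pi>" for \<pi>
      using x that by (simp add: james_tests_def X_def)
    have \<Delta>: "\<bar>\<Delta> m\<bar> \<le> 2" for m
      using james_tests_bounded[OF x, of m] james_tests_bounded[OF x, of "Suc m"] by (simp add: \<Delta>_def X_def)
    define \<zeta> where "\<zeta> m = 1 / z (jt_unit (t m))" for m
    \<comment> \<open>The increments of \<open>X\<close> are placed on the nodes, scaled to
      \<open>z\<close>-value 1, so that the triangular pattern telescopes to \<open>x n\<close>.
      Replacing the scaling factors by their limit \<open>\<theta>\<close> leaves a multiple of a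
      chain vector of norm at most 1.\<close>
    define w where "w = (\<Sum>m<N. (\<Delta> m * \<zeta> m) *\<^sub>R jt_unit (t m))"
    have "w = \<theta> *\<^sub>R (\<Sum>m<N. \<Delta> m *\<^sub>R jt_unit (t m)) + (\<Sum>m<N. (\<Delta> m * (\<zeta> m - \<theta>)) *\<^sub>R jt_unit (t m))"
      unfolding w_def scaleR_sum_right sum.distrib[symmetric]
      by (intro sum.cong refl) (simp add: algebra_simps flip: scaleR_add_left)
    also have "norm \<dots> \<le> \<bar>\<theta>\<bar> * 1 + (\<Sum>m<N. 2 * (1 / 2 ^ m) * 1)"
    proof (intro order_trans[OF norm_triangle_ineq] add_mono)
      show "norm (\<theta> *\<^sub>R (\<Sum>m<N. \<Delta> m *\<^sub>R jt_unit (t m))) \<le> \<bar>\<theta>\<bar> * 1"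
        unfolding norm_scaleR \<Delta>_def by (intro mult_left_mono norm_chain_units_le Xv tinj tpre) auto
      show "norm (\<Sum>m<N. (\<Delta> m * (\<zeta> m - \<theta>)) *\<^sub>R jt_unit (t m)) \<le> (\<Sum>m<N. 2 * (1 / 2 ^ m) * 1)"
      proof (rule order_trans[OF norm_sum sum_mono])
        fix m
        have "\<bar>\<zeta> m - \<theta>\<bar> \<le> 1 / 2 ^ q m"
          using T(4)[of "q m"] by (simp add: \<zeta>_def t_def)
        also have "\<dots> \<le> 1 / 2 ^ m"
          using strict_mono_imp_increasing[OF q(1), of m] by (intro divide_left_mono power_increasing) auto
        finally show "norm ((\<Delta> m * (\<zeta> m - \<theta>)) *\<^sub>R jt_unit (t m)) \<le> 2 * (1 / 2 ^ m) * 1"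
          unfolding norm_scaleR abs_mult by (intro mult_mono \<Delta> norm_jt_unit_le) auto
      qed
    qed
    also have "\<dots> \<le> K1"
      using sum_half_powers_le[of 2 N] by (simp add: K1_def)
    finally have wn: "norm w \<le> K1" .
    have uw: "u n w = x n" if "n < N" for n
    proof -
      have "u n w = (\<Sum>m<N. \<Delta> m * \<zeta> m * u n (jt_unit (t m)))"
        by (simp add: w_def blinfun.sum_right blinfun.scaleR_right)
      also have "\<dots> = (\<Sum>m<N. if m \<le> n then \<Delta> m else 0)"
        using T(3)[of "q _", folded t_def] by (intro sum.cong refl) (simp add: ut \<zeta>_def)
      also have "\<dots> = (\<Sum>m<Suc n. \<Delta> m)"
        using that by (intro sum.mono_neutral_cong_right) auto
      also have "\<dots> = X (Suc n) - X 0"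
        unfolding \<Delta>_def by (rule sum_lessThan_telescope)
      finally show ?thesis
        by (simp add: X_def)
    qed
    have "\<bar>\<Sum>n<N. a n * x n\<bar> = \<bar>(\<Sum>n<N. a n *\<^sub>R u n) w\<bar>"
      using uw by (simp add: blinfun.sum_left blinfun.scaleR_left)
    also have "\<dots> \<le> norm (\<Sum>n<N. a n *\<^sub>R u n) * norm w"
      by (rule norm_blinfun_le)
    also have "\<dots> \<le> norm (\<Sum>n<N. a n *\<^sub>R u n) * K1"
      by (intro mult_left_mono wn) auto
    finally show "\<bar>\<Sum>n<N. a n * x n\<bar> \<le> K1 * norm (\<Sum>n<N. a n *\<^sub>R u n)"
      by (simp add: mult.commute)
  next
    fix N and a :: "nat \<Rightarrow> real" and Bd
    assume Bd: "\<And>x. x \<in> james_tests \<Longrightarrow> \<bar>\<Sum>n<N. a n * x n\<bar> \<le> Bd"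
    have scaled: "\<bar>\<Sum>n<N. a n * f n\<bar> \<le> c * Bd" if "(\<lambda>n. f n / c) \<in> james_tests" "0 < c" for f :: "nat \<Rightarrow> real" and c
    proof -
      have "\<bar>(\<Sum>n<N. a n * f n) / c\<bar> \<le> Bd"
        using Bd[OF that(1)] by (simp add: sum_divide_distrib)
      then show ?thesis
        using that(2) by (simp add: abs_divide pos_divide_le_eq mult.commute)
    qed
    have Bd0: "0 \<le> Bd"
      using Bd[OF test_sequences.zero_mem[OF james_test_sequences]] by simp
    show "norm (\<Sum>n<N. a n *\<^sub>R u n) \<le> K2 * Bd"
    proof (rule norm_blinfun_bound)
      show "0 \<le> K2 * Bd"
        using Bd0 M0 by (simp add: K2_def)
      fix w
      show "norm ((\<Sum>n<N. a n *\<^sub>R u n) w) \<le> K2 * Bd * norm w"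
      proof (cases "w = 0")
        case False
        define c where "c = (norm z + 1) * norm w"
        have c: "0 < c"
          using False by (simp add: c_def add_nonneg_pos)
        \<comment> \<open>The pairing with \<open>w\<close> splits into the part \<open>f\<close> of
          \<open>z\<close> on increasing boxes, whose jumps belong to disjoint shells and so have
          square sum at most \<open>c\<^sup>2\<close>, and the square summable hump part
          \<open>g\<close>.\<close>
        define f where "f n = z (jcut (tbox (h (q n))) w)" for n
        \<comment> \<open>The empty set in front corresponds to the prepended 0.\<close>
        define b where "b j = (case j of 0 \<Rightarrow> {} | Suc n \<Rightarrow> tbox (h (q n)))" for j
        have b: "b m \<subseteq> b n" if "m \<le> n" for m n
          using that hh by (auto simp: b_def split: nat.splits)
        have bcx: "order_convex (b n - b m)" for m n
          by (auto simp: b_def order_convex_def split: nat.splits intro: prefix_box)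
        have "quad_var \<pi> (case_nat 0 f) \<le> c\<^sup>2" if \<pi>: "interval_family \<pi>" for \<pi>
        proof -
          have diff: "case_nat 0 f n - case_nat 0 f m = z (jcut (b n - b m) w)" if "m < n" for m n
          proof -
            have sub: "b m \<subseteq> b n"
              using that by (intro b) simp
            have bc: "order_convex (b j)" for j
              by (auto simp: b_def order_convex_def split: nat.splits intro: prefix_box)
            have val: "case_nat 0 f j = z (jcut (b j) w)" for j
            proof (cases j)
              case 0
              have "jcut (b 0) w = 0"
                using bc[of 0] by (intro jt_eqI) (simp add: jt_fun_cut jt_fun_zero b_def)
              then show ?thesis
                by (simp add: 0)
            qed (simp add: f_def b_def)
            have "jcut (b n) w - jcut (b m) w = jcut (b n - b m) w"
              using sub bc bcx by (intro jt_eqI) (auto simp: jt_fun_cut jt_fun_simps)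
            then show ?thesis
              by (simp add: val flip: blinfun.diff_right)
          qed
          have "quad_var \<pi> (case_nat 0 f) = (\<Sum>p\<in>\<pi>. (z (jcut (b (snd p) - b (fst p)) w))\<^sup>2)"
            unfolding quad_var_def using diff interval_familyD(2)[OF \<pi>] by (intro sum.cong refl) simp
          also have "\<dots> \<le> (\<Sum>p\<in>\<pi>. (norm z)\<^sup>2 * (norm (jcut (b (snd p) - b (fst p)) w))\<^sup>2)"
          proof (rule sum_mono)
            fix p
            have "\<bar>z (jcut (b (snd p) - b (fst p)) w)\<bar>\<^sup>2 \<le> (norm z * norm (jcut (b (snd p) - b (fst p)) w))\<^sup>2"
              by (intro power_mono norm_blinfun_le) auto
            then show "(z (jcut (b (snd p) - b (fst p)) w))\<^sup>2 \<le> (norm z)\<^sup>2 * (norm (jcut (b (snd p) - b (fst p)) w))\<^sup>2"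
              by (simp add: power_mult_distrib)
          qed
          also have "\<dots> = (norm z)\<^sup>2 * (L2_set (\<lambda>p. norm (jcut (b (snd p) - b (fst p)) w)) \<pi>)\<^sup>2"
            by (simp add: L2_set_def sum_nonneg sum_distrib_left)
          also have "\<dots> \<le> (norm z + 1)\<^sup>2 * (norm w)\<^sup>2"
          proof (intro mult_mono power_mono)
            show "L2_set (\<lambda>p. norm (jcut (b (snd p) - b (fst p)) w)) \<pi> \<le> norm w"
              by (intro L2_norm_cut_le interval_familyD(1)[OF \<pi>] bcx interval_shells_disjoint[OF b \<pi>])
          qed auto
          finally show ?thesis
            by (simp add: c_def power_mult_distrib)
        qed
        then have "quad_var \<pi> (\<lambda>k. (1 / c) * case_nat 0 f k) \<le> 1" if "interval_family \<pi>" for \<pi>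
          using that c unfolding quad_var_scale by (simp add: power_divide pos_divide_le_eq)
        moreover have "case_nat 0 (\<lambda>n. f n / c) = (\<lambda>k. (1 / c) * case_nat 0 f k)"
          by (auto split: nat.splits)
        ultimately have "(\<lambda>n. f n / c) \<in> james_tests"
          by (simp add: james_tests_def)
        then have 1: "\<bar>\<Sum>n<N. a n * f n\<bar> \<le> c * Bd"
          using c by (rule scaled)
        \<comment> \<open>The factor 2 is what reaches the bound 1/4 required of square summable
          tests.\<close>
        define c' where "c' = 2 * ((M + 1) * norm w)"
        have c': "0 < c'"
          using False M0 by (simp add: c'_def)
        define g where "g n = e (i n) (jcut (D n) w)" for n
        have Dsub: "D n \<subseteq> tbox (q (Suc n)) - tbox (q n)" for n
          using box_mono[OF h(1)[of "q n"]] by (auto simp: D_def)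
        have Ddis: "disjoint_family_on D I" for I
          using disjoint_shells[OF q(1)] Dsub unfolding disjoint_family_on_def by blast
        have "(\<lambda>n. g n / c') \<in> james_tests"
        proof (rule test_sequences.square_summable[OF james_test_sequences])
          fix N'
          have "(\<Sum>n<N'. (g n)\<^sup>2) \<le> (\<Sum>n<N'. (M + 1)\<^sup>2 * (norm (jcut (D n) w))\<^sup>2)"
          proof (rule sum_mono)
            fix n
            have "\<bar>g n\<bar> \<le> (M + 1) * norm (jcut (D n) w)"
              unfolding g_def using M[of "i n"] by (intro order_trans[OF norm_blinfun_le] mult_right_mono) auto
            then have "\<bar>g n\<bar>\<^sup>2 \<le> ((M + 1) * norm (jcut (D n) w))\<^sup>2"
              by (intro power_mono) auto
            then show "(g n)\<^sup>2 \<le> (M + 1)\<^sup>2 * (norm (jcut (D n) w))\<^sup>2"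
              by (simp add: power_mult_distrib)
          qed
          also have "\<dots> = (M + 1)\<^sup>2 * (L2_set (\<lambda>n. norm (jcut (D n) w)) {..<N'})\<^sup>2"
            by (simp add: L2_set_def sum_nonneg sum_distrib_left)
          also have "\<dots> \<le> (M + 1)\<^sup>2 * (norm w)\<^sup>2"
          proof (intro mult_left_mono power_mono)
            show "L2_set (\<lambda>n. norm (jcut (D n) w)) {..<N'} \<le> norm w"
              by (intro L2_norm_cut_le Ddis) (simp_all add: D_def)
          qed auto
          finally have "(\<Sum>n<N'. (g n)\<^sup>2) \<le> c'\<^sup>2 / 4"
            by (simp add: c'_def power_mult_distrib)
          then have "(\<Sum>n<N'. (g n)\<^sup>2) / c'\<^sup>2 \<le> 1 / 4"
            using c' by (simp add: pos_divide_le_eq)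
          then show "(\<Sum>n<N'. (g n / c')\<^sup>2) \<le> 1 / 4"
            by (simp add: power_divide sum_divide_distrib)
        qed
        then have 2: "\<bar>\<Sum>n<N. a n * g n\<bar> \<le> c' * Bd"
          using c' by (rule scaled)
        have "(\<Sum>n<N. a n *\<^sub>R u n) w = (\<Sum>n<N. a n * f n) + (\<Sum>n<N. a n * g n)"
          unfolding sum.distrib[symmetric] blinfun.sum_left
          by (intro sum.cong refl) (simp add: u_def f_def g_def D_def blinfun.scaleR_left blinfun.add_left fcut_apply algebra_simps)
        then have "norm ((\<Sum>n<N. a n *\<^sub>R u n) w) \<le> c * Bd + c' * Bd"
          using 1 2 abs_triangle_ineq[of "\<Sum>n<N. a n * f n" "\<Sum>n<N. a n * g n"] by simp
        also have "\<dots> = K2 * Bd * norm w"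
          by (simp add: c_def c'_def K2_def algebra_simps)
        finally show ?thesis .
      qed simp
    qed
  qed
  moreover have "(\<lambda>n. e (i n)) = e \<circ> i"
    by auto
  ultimately show ?thesis
    using i by auto
qed

lemma basic_subsequence_dichotomy:
  fixes e :: "nat \<Rightarrow> jt_inf \<Rightarrow>\<^sub>L real"
  assumes B: "range e \<subseteq> B_inf" and basic: "basic_sequence e" and sn: "semi_normalized e"
  shows "\<exists>(r :: nat \<Rightarrow> nat) K. strict_mono r \<and> (test_basis l2_tests (e \<circ> r) K \<or> test_basis james_tests (e \<circ> r) K)"
proof -
  obtain M where M: "\<And>n. norm (e n) \<le> M"
    using sn unfolding semi_normalized_def bdd_above_def by auto
  define \<delta> where "\<delta> = (INF n. norm (e n))"
  have \<delta>: "0 < \<delta>" "\<And>n. \<delta> \<le> norm (e n)"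
    using sn by (auto simp: \<delta>_def semi_normalized_def intro!: cINF_lower bdd_belowI[of _ 0])
  have eB: "e n \<in> B_inf" for n
    using B by blast
  obtain s z where s: "strict_mono (s :: nat \<Rightarrow> nat)" and z: "\<And>x. (\<lambda>n. e (s n) x) \<longlonglongrightarrow> blinfun_apply z x"
    by (rule pointwise_convergent_subsequence[of e M, OF M]) (rule that)
  have "\<exists>(r :: nat \<Rightarrow> nat) K. strict_mono r \<and>
    (test_basis l2_tests ((\<lambda>n. e (s n)) \<circ> r) K \<or> test_basis james_tests ((\<lambda>n. e (s n)) \<circ> r) K)"
  proof (cases "z \<in> B_inf")
    case True
    have "z = 0"
      by (rule weak_limit_in_B_inf_eq_0[OF basic eB M s z True])
    then have "(\<lambda>n. e (s n) x) \<longlonglongrightarrow> 0" for x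
      using z[of x] by simp
    then show ?thesis
      using weakly_null_l2_subsequence[of "\<lambda>n. e (s n)" M \<delta>, OF eB M \<delta>] by blast
  next
    case False
    then show ?thesis
      using james_subsequence[of "\<lambda>n. e (s n)" M z, OF eB M z] by blast
  qed
  then obtain r :: "nat \<Rightarrow> nat" and K where r: "strict_mono r"
    "test_basis l2_tests ((\<lambda>n. e (s n)) \<circ> r) K \<or> test_basis james_tests ((\<lambda>n. e (s n)) \<circ> r) K"
    by blast
  moreover have "(\<lambda>n. e (s n)) \<circ> r = e \<circ> (s \<circ> r)"
    by auto
  ultimately show ?thesis
    using strict_mono_o[OF s r(1)] by auto
qed

theorem corollary2p5:
  shows "\<not> point_of_continuity_property B_inf
    \<and> \<not> contains_ell1 B_inf
    \<and> (\<forall>e. range e \<subseteq> B_inf \<and> basic_sequence e \<and> semi_normalized e \<longrightarrow>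
          (\<exists>r :: nat \<Rightarrow> nat. strict_mono r \<and> boundedly_complete (e \<circ> r) \<and>
             (reflexive_space (closed_span (e \<circ> r)) \<or>
              order_one_quasireflexive (closed_span (e \<circ> r)))))"
proof (intro conjI allI impI B_inf_not_pcp B_inf_no_ell1)
  fix e :: "nat \<Rightarrow> jt_inf \<Rightarrow>\<^sub>L real"
  assume e: "range e \<subseteq> B_inf \<and> basic_sequence e \<and> semi_normalized e"
  then obtain r :: "nat \<Rightarrow> nat" and K where r: "strict_mono r"
    and K: "test_basis l2_tests (e \<circ> r) K \<or> test_basis james_tests (e \<circ> r) K"
    using basic_subsequence_dichotomy[of e] by blast
  have "boundedly_complete (e \<circ> r) \<and>
    (reflexive_space (closed_span (e \<circ> r)) \<or> order_one_quasireflexive (closed_span (e \<circ> r)))"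
    using K
  proof
    assume l2: "test_basis l2_tests (e \<circ> r) K"
    then show ?thesis
      using test_basis.boundedly_complete_basis[OF l2] l2_basis_reflexive[OF l2] by blast
  next
    assume j: "test_basis james_tests (e \<circ> r) K"
    then show ?thesis
      using test_basis.boundedly_complete_basis[OF j]
        james_basis.order_one_quasireflexive[OF james_basis.intro[OF j]] by blast
  qed
  then show "\<exists>r :: nat \<Rightarrow> nat. strict_mono r \<and> boundedly_complete (e \<circ> r) \<and>
      (reflexive_space (closed_span (e \<circ> r)) \<or> order_one_quasireflexive (closed_span (e \<circ> r)))"
    using r by blast
qed

end
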